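(* Let $\nu>0$, $\gamma>0$ and, for $N\ge1$, $\theta^N_k=|k|^{-\gamma}\mathbf{1}_{\{N\le|k|\le2N\}}$, $k\in\mathbb{Z}^3_0$. Then for any smooth divergence free vector field $v:\mathbb{T}^3\to\mathbb{R}^3$, the following limit holds in $L^2(\mathbb{T}^3,\mathbb{R}^3)$: $$\lim_{N\to\infty}S_{\theta^N}(v)=\frac{3\nu}{5}\,\Delta v .$$
   Context: $\mathbb{T}^3=\mathbb{R}^3/\mathbb{Z}^3$, $\mathbb{Z}^3_0=\mathbb{Z}^3\setminus\{0\}$, partitioned as $\mathbb{Z}^3_0=\mathbb{Z}^3_+\cup\mathbb{Z}^3_-$ (disjoint) with $\mathbb{Z}^3_+=-\mathbb{Z}^3_-$. $e_k(x)=e^{2\pi \mathrm{i}k\cdot x}$. For $k\in\mathbb{Z}^3_+$, $\{a_{k,1},a_{k,2}\}$ is an orthonormal basis of $k^\perp\subset\mathbb{R}^3$ such that $\{a_{k,1},a_{k,2},k/|k|\}$ is right-handed; $a_{-k,\alpha}=a_{k,\alpha}$. $\sigma_{k,\alpha}(x)=a_{k,\alpha}e_k(x)$. $\Pi$ is the Leray projection (orthogonal projection in $L^2$ onto divergence free vector fields). $C_\nu=\sqrt{3\nu/2}$ and for $\theta\in\ell^2(\mathbb{Z}^3_0)$, $$S_\theta(v)=\frac{C_\nu^2}{\|\theta\|_{\ell^2}^2}\sum_{k\in\mathbb{Z}^3_0}\sum_{\alpha=1}^2\theta_k^2\,\Pi\big[\sigma_{k,\alpha}\cdot\nabla\Pi(\sigma_{-k,\alpha}\cdot\nabla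 v)\big].$$ *)

theory Defs
  imports "HOL-Analysis.Analysis"
begin

text \<open>Functions on the torus are functions on \<open>real^3\<close> with period lattice \<open>\<int>\<^sup>3\<close>;
  integrals over the torus are taken over the unit cube.\<close>

definition lat :: "int^3 \<Rightarrow> real^3" where
  "lat k = (\<chi> i. real_of_int (k $ i))"

definition Z0 :: "(int^3) set" where
  "Z0 = - {0}"

definition periodic :: "(real^3 \<Rightarrow> 'a) \<Rightarrow> bool" where
  "periodic f \<longleftrightarrow> (\<forall>k x. f (x + lat k) = f x)"

definition T3 :: "(real^3) measure" where
  "T3 = restrict_space lborel (cbox 0 1)"

definition pd :: "3 \<Rightarrow> (real^3 \<Rightarrow> 'a::real_normed_vector) \<Rightarrow> real^3 \<Rightarrow> 'a" where
  "pd j f x = frechet_derivative f (at x) (axis j 1)"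

primrec Ck :: "nat \<Rightarrow> (real^3 \<Rightarrow> 'a::real_normed_vector) \<Rightarrow> bool" where
  "Ck 0 f \<longleftrightarrow> continuous_on UNIV f"
| "Ck (Suc n) f \<longleftrightarrow> (\<forall>x. f differentiable (at x)) \<and> (\<forall>j. Ck n (pd j f))"

definition smooth_T3 :: "(real^3 \<Rightarrow> 'a::real_normed_vector) \<Rightarrow> bool" where
  "smooth_T3 f \<longleftrightarrow> periodic f \<and> (\<forall>n. Ck n f)"

definition laplacian :: "(real^3 \<Rightarrow> 'a::real_normed_vector) \<Rightarrow> real^3 \<Rightarrow> 'a" where
  "laplacian f x = (\<Sum>j\<in>UNIV. pd j (pd j f) x)"

definition divergence :: "(real^3 \<Rightarrow> real^3) \<Rightarrow> real^3 \<Rightarrow> real" where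
  "divergence v x = (\<Sum>j\<in>UNIV. pd j v x $ j)"

definition L2_T3 :: "(real^3 \<Rightarrow> 'a::real_normed_vector) set" where
  "L2_T3 = {f. periodic f \<and> f \<in> borel_measurable borel \<and> integrable T3 (\<lambda>x. (norm (f x))\<^sup>2)}"

definition L2_norm_T3 :: "(real^3 \<Rightarrow> 'a::real_normed_vector) \<Rightarrow> real" where
  "L2_norm_T3 f = sqrt (\<integral>x. (norm (f x))\<^sup>2 \<partial>T3)"

definition L2_inner_T3 :: "(real^3 \<Rightarrow> complex^3) \<Rightarrow> (real^3 \<Rightarrow> complex^3) \<Rightarrow> complex" where
  "L2_inner_T3 f g = (\<integral>x. (\<Sum>i\<in>UNIV. f x $ i * cnj (g x $ i)) \<partial>T3)"

text \<open>Square integrable fields whose divergence vanishes in the sense of distributions.\<close>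

definition L2_div_free :: "(real^3 \<Rightarrow> complex^3) set" where
  "L2_div_free = {h \<in> L2_T3. \<forall>\<phi> :: real^3 \<Rightarrow> complex. smooth_T3 \<phi> \<longrightarrow>
     (\<integral>x. (\<Sum>j\<in>UNIV. h x $ j * pd j \<phi> x) \<partial>T3) = 0}"

definition is_leray :: "(real^3 \<Rightarrow> complex^3) \<Rightarrow> (real^3 \<Rightarrow> complex^3) \<Rightarrow> bool" where
  "is_leray f g \<longleftrightarrow> f \<in> L2_T3 \<and> g \<in> L2_div_free \<and>
     (\<forall>h\<in>L2_div_free. L2_inner_T3 (\<lambda>x. f x - g x) h = 0)"

text \<open>The projection is determined only up to null sets. Since it gets differentiated,
  its continuous representative (unique if there is one) is chosen whenever it exists.\<close>

definition leray :: "(real^3 \<Rightarrow> complex^3) \<Rightarrow> real^3 \<Rightarrow> complex^3" where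
  "leray f = (SOME g. is_leray f g \<and>
     ((\<exists>g'. is_leray f g' \<and> continuous_on UNIV g') \<longrightarrow> continuous_on UNIV g))"

definition efun :: "int^3 \<Rightarrow> real^3 \<Rightarrow> complex" where
  "efun k x = exp (2 * complex_of_real pi * \<i> * complex_of_real (lat k \<bullet> x))"

text \<open>Only the indices \<open>\<alpha> = 1, 2\<close> of \<open>a k \<alpha>\<close> are used. The sets \<open>Zp\<close> and \<open>Zm\<close> are the two
  halves of \<open>Z0\<close>.\<close>

definition half_partition :: "(int^3) set \<Rightarrow> (int^3) set \<Rightarrow> bool" where
  "half_partition Zp Zm \<longleftrightarrow> Zp \<union> Zm = Z0 \<and> Zp \<inter> Zm = {} \<and> Zp = uminus ` Zm"

definition frame_family :: "(int^3) set \<Rightarrow> (int^3 \<Rightarrow> nat \<Rightarrow> real^3) \<Rightarrow> bool" where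
  "frame_family Zp a \<longleftrightarrow> (\<forall>k\<in>Zp.
      norm (a k 1) = 1 \<and> norm (a k 2) = 1 \<and> a k 1 \<bullet> a k 2 = 0 \<and>
      span {a k 1, a k 2} = {x. x \<bullet> lat k = 0} \<and>
      det (vector [a k 1, a k 2, lat k /\<^sub>R norm (lat k)] :: real^3^3) > 0 \<and>
      (\<forall>\<alpha>\<in>{1, 2}. a (- k) \<alpha> = a k \<alpha>))"

definition sigma :: "(int^3 \<Rightarrow> nat \<Rightarrow> real^3) \<Rightarrow> int^3 \<Rightarrow> nat \<Rightarrow> real^3 \<Rightarrow> complex^3" where
  "sigma a k \<alpha> x = (\<chi> i. complex_of_real (a k \<alpha> $ i) * efun k x)"

definition advect :: "(real^3 \<Rightarrow> complex^3) \<Rightarrow> (real^3 \<Rightarrow> complex^3) \<Rightarrow> real^3 \<Rightarrow> complex^3" where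
  "advect s u x = (\<chi> i. \<Sum>j\<in>UNIV. s x $ j * pd j u x $ i)"

definition C_nu :: "real \<Rightarrow> real" where
  "C_nu \<nu> = sqrt (3 * \<nu> / 2)"

definition l2_norm :: "(int^3 \<Rightarrow> real) \<Rightarrow> real" where
  "l2_norm \<theta> = sqrt (\<Sum>\<^sub>\<infinity>k\<in>Z0. (\<theta> k)\<^sup>2)"

definition S_op :: "real \<Rightarrow> (int^3 \<Rightarrow> nat \<Rightarrow> real^3) \<Rightarrow> (int^3 \<Rightarrow> real) \<Rightarrow>
    (real^3 \<Rightarrow> complex^3) \<Rightarrow> real^3 \<Rightarrow> complex^3" where
  "S_op \<nu> a \<theta> v x = ((C_nu \<nu>)\<^sup>2 / (l2_norm \<theta>)\<^sup>2) *\<^sub>R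
     (\<Sum>\<^sub>\<infinity>k\<in>Z0. \<Sum>\<alpha>\<in>{1, 2}. (\<theta> k)\<^sup>2 *\<^sub>R
        leray (advect (sigma a k \<alpha>) (leray (advect (sigma a (- k) \<alpha>) v))) x)"

definition thetaN :: "real \<Rightarrow> nat \<Rightarrow> int^3 \<Rightarrow> real" where
  "thetaN \<gamma> N k = (if real N \<le> norm (lat k) \<and> norm (lat k) \<le> 2 * real N
     then norm (lat k) powr (- \<gamma>) else 0)"

definition complexify :: "(real^3 \<Rightarrow> real^3) \<Rightarrow> real^3 \<Rightarrow> complex^3" where
  "complexify v x = (\<chi> i. complex_of_real (v x $ i))"

text \<open>\<open>L\<^sup>2(T\<^sup>3, \<real>\<^sup>3)\<close>, viewed inside \<open>L\<^sup>2(T\<^sup>3, \<complex>\<^sup>3)\<close>.\<close>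

definition L2_T3_real :: "(real^3 \<Rightarrow> complex^3) set" where
  "L2_T3_real = {f \<in> L2_T3. \<forall>x i. f x $ i \<in> \<real>}"

end

theory Submission
  imports Defs
begin

text \<open>
  The operator \<open>S\<^sub>\<theta>\<close> is a Fourier multiplier, and its symbol is an average over directions that
  becomes isotropic as \<open>N\<close> grows.

  Let \<open>v = \<Sum>l. c\<^sub>l e\<^sub>l\<close> with \<open>l \<cdot> c\<^sub>l = 0\<close>, and let \<open>P\<^sub>m\<close> be the orthogonal projection onto the complement
  of \<open>m\<close>. The field \<open>\<sigma>\<^bsub>-k,\<alpha>\<^esub>\<close> transports the frequency \<open>l\<close> to \<open>l - k\<close>, the Leray projection acts there as
  \<open>P\<^bsub>l-k\<^esub>\<close>, and \<open>\<sigma>\<^bsub>k,\<alpha>\<^esub>\<close> transports back to \<open>l\<close>. Each transport yields the factor \<open>2 \<pi> i (a \<cdot> l)\<close>, because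
  \<open>a \<perp> k\<close>, and the two vectors of a frame together give \<open>|l|\<^sup>2 - (l \<cdot> k)\<^sup>2/|k|\<^sup>2\<close>. So (\<open>S_op_fser\<close>) the
  coefficient of \<open>S\<^sub>\<theta> v\<close> at \<open>l\<close> is \<open>- 6 \<pi>\<^sup>2 \<nu> P\<^sub>l A\<^sub>l c\<^sub>l\<close>, where \<open>A\<^sub>l\<close> is the average of
  \<open>(|l|\<^sup>2 - (l \<cdot> k)\<^sup>2/|k|\<^sup>2) P\<^bsub>l-k\<^esub>\<close> over \<open>k\<close> with weights \<open>\<theta>\<^sub>k\<^sup>2\<close>.

  For \<open>\<theta> = \<theta>\<^sup>N\<close> the frequencies \<open>k\<close> are at least \<open>N\<close> in length, so \<open>P\<^bsub>l-k\<^esub>\<close> is close to \<open>P\<^sub>k\<close>. After rescaling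
  by \<open>N\<close> the average is a Riemann sum for an integral over the shell \<open>1 \<le> |y| \<le> 2\<close> with the radial
  weight \<open>|y|\<^bsup>-2\<gamma>\<^esup>\<close> (\<open>shell_lattice_sum_tendsto\<close>). Rotation invariance determines the second and fourth
  moments of the direction \<open>y/|y|\<close>, and \<open>A\<^sub>l\<close> tends to \<open>2/5 |l|\<^sup>2 I + 2/15 l l\<^sup>T\<close>
  (\<open>projected_moment\<close>, \<open>entry_average_tendsto\<close>). On \<open>c\<^sub>l \<perp> l\<close> this is \<open>2/5 |l|\<^sup>2\<close>, and
  \<open>- 6 \<pi>\<^sup>2 \<nu> (2/5) |l|\<^sup>2 = (3 \<nu>/5) (- 4 \<pi>\<^sup>2 |l|\<^sup>2)\<close> is the symbol of \<open>(3 \<nu>/5) \<Delta>\<close>.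

  The symbols are bounded by a multiple of \<open>|l|\<^sup>2\<close> uniformly in \<open>N\<close>, and the coefficients of a smooth field
  decay rapidly. Dominated convergence for the sum over \<open>l\<close> then makes the sum of the moduli of all
  coefficient differences tend to zero, and this sum bounds the \<open>L\<^sup>2\<close> norm.

  Two facts connect this computation with the fields themselves. A smooth periodic function is the
  sum of its Fourier series (\<open>fourier_inversion\<close>): its coefficients decay by integration by parts, and
  Stone-Weierstrass on the torus shows that they determine a continuous function. The Leray
  projection of a rapidly converging series is the series projected mode by mode (\<open>leray_fser\<close>),
  since this is a continuous projection and there is only one.
\<close>

section \<open>Rapidly converging trigonometric series\<close>

lemma pd_eqI:
  assumes "(f has_derivative D) (at x)"
  shows "pd j f x = D (axis j 1)"
  using frechet_derivative_at[OF assms] by (simp add: pd_def)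

lemma lat_nth [simp]: "lat k $ i = real_of_int (k $ i)"
  by (simp add: lat_def)

lemma lat_0 [simp]: "lat 0 = 0" and lat_add: "lat (k + l) = lat k + lat l"
  and lat_minus: "lat (- k) = - lat k" and lat_diff: "lat (k - l) = lat k - lat l"
  by (simp_all add: vec_eq_iff)

lemma lat_eq_0_iff [simp]: "lat k = 0 \<longleftrightarrow> k = 0"
  by (auto simp: vec_eq_iff)

lemma norm_efun [simp]: "norm (efun k x) = 1"
proof -
  have "efun k x = exp (\<i> * complex_of_real (2 * pi * (lat k \<bullet> x)))"
    by (simp add: efun_def algebra_simps)
  then show ?thesis by (simp only: norm_exp_i_times)
qed

lemma efun_0 [simp]: "efun 0 x = 1"
  by (simp add: efun_def)

lemma efun_add: "efun (k + l) x = efun k x * efun l x"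
  by (simp add: efun_def lat_add inner_add_left ring_distribs exp_add)

lemma efun_plus: "efun k (x + y) = efun k x * efun k y"
  by (simp add: efun_def inner_add_right ring_distribs exp_add)

lemma efun_minus: "efun (- k) x = cnj (efun k x)"
  by (simp add: efun_def exp_cnj lat_minus)

lemma periodic_efun: "periodic (efun k)"
  unfolding periodic_def
proof (intro allI)
  fix l x
  define m where "m = (\<Sum>i\<in>UNIV. k $ i * l $ i)"
  have "lat k \<bullet> lat l = real_of_int m"
    by (simp add: inner_vec_def m_def)
  then have "efun k (lat l) = exp (complex_of_real (2 * real_of_int m * pi) * \<i>)"
    by (simp add: efun_def mult_ac)
  also have "\<dots> = 1"
    by (rule exp_integer_2pi) simp
  finally show "efun k (x + lat l) = efun k x"
    by (simp add: efun_plus)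
qed

lemma has_derivative_efun:
  "(efun k has_derivative (\<lambda>h. 2 * complex_of_real pi * \<i> * complex_of_real (lat k \<bullet> h) * efun k x)) (at x)"
proof -
  have "bounded_linear (\<lambda>h. 2 * complex_of_real pi * \<i> * complex_of_real (lat k \<bullet> h))"
    by (intro bounded_linear_const_mult bounded_linear_compose[OF bounded_linear_of_real bounded_linear_inner_right])
  from has_derivative_compose[OF bounded_linear_imp_has_derivative[OF this] DERIV_exp[unfolded has_field_derivative_def]]
  show ?thesis by (simp add: efun_def[abs_def] mult_ac)
qed

lemma pd_efun: "pd j (\<lambda>x. a * efun k x) x = a * (2 * complex_of_real pi * \<i> * of_int (k $ j)) * efun k x"
  by (subst pd_eqI[OF has_derivative_mult_right[OF has_derivative_efun]])
     (simp add: inner_axis mult_ac)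

lemma continuous_efun: "continuous_on UNIV (efun k)"
  using has_derivative_continuous[OF has_derivative_efun] by (simp add: continuous_on_eq_continuous_at)

lemma smooth_efun: "smooth_T3 (efun k)"
proof -
  have "Ck n (\<lambda>x. a * efun k x)" for n a
  proof (induction n arbitrary: a)
    case 0
    then show ?case by (auto intro!: continuous_intros continuous_efun)
  next
    case (Suc n)
    have "pd j (\<lambda>x. a * efun k x) = (\<lambda>x. a * (2 * complex_of_real pi * \<i> * of_int (k $ j)) * efun k x)" for j
      by (rule ext) (rule pd_efun)
    moreover have "(\<lambda>x. a * efun k x) differentiable (at x)" for x
      using has_derivative_mult_right[OF has_derivative_efun] by (rule differentiableI)
    ultimately show ?case using Suc by simp
  qed
  from this[of _ 1] show ?thesis by (simp add: smooth_T3_def periodic_efun)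
qed

text \<open>Asking for all powers of the weight makes the class stable under differentiation, frequency
  shifts and symbols of polynomial growth, so that derivatives can be taken freely.\<close>

definition rapid :: "(int^3 \<Rightarrow> complex) \<Rightarrow> bool" where
  "rapid c \<longleftrightarrow> (\<forall>p. (\<lambda>l. (1 + (norm (lat l))\<^sup>2) ^ p * norm (c l)) summable_on UNIV)"

definition tser :: "(int^3 \<Rightarrow> complex) \<Rightarrow> real^3 \<Rightarrow> complex" where
  "tser c x = (\<Sum>\<^sub>\<infinity>l. c l * efun l x)"

lemma rapid_summable: "rapid c \<Longrightarrow> (\<lambda>l. norm (c l)) summable_on UNIV"
  unfolding rapid_def by (drule spec[of _ 0]) simp

lemma rapid_dominated:
  assumes "rapid c" and "\<And>l. norm (d l) \<le> C * (1 + (norm (lat l))\<^sup>2) ^ q * norm (c l)"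
  shows "rapid d"
  unfolding rapid_def
proof
  fix p
  have "(\<lambda>l. C * ((1 + (norm (lat l))\<^sup>2) ^ (p + q) * norm (c l))) summable_on UNIV"
    using assms(1) by (intro summable_on_cmult_right) (simp only: rapid_def)
  then show "(\<lambda>l. (1 + (norm (lat l))\<^sup>2) ^ p * norm (d l)) summable_on UNIV"
  proof (rule summable_on_comparison_test)
    fix l :: "int^3"
    have "(1 + (norm (lat l))\<^sup>2) ^ p * norm (d l) \<le> (1 + (norm (lat l))\<^sup>2) ^ p * (C * (1 + (norm (lat l))\<^sup>2) ^ q * norm (c l))"
      by (intro mult_left_mono assms) simp
    then show "(1 + (norm (lat l))\<^sup>2) ^ p * norm (d l) \<le> C * ((1 + (norm (lat l))\<^sup>2) ^ (p + q) * norm (c l))"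
      by (simp add: power_add mult_ac)
  qed simp
qed

lemma rapid_mult_bounded:
  assumes "rapid c" and "\<And>l. norm (m l) \<le> C * (1 + (norm (lat l))\<^sup>2) ^ q"
  shows "rapid (\<lambda>l. m l * c l)"
  using assms(1) by (rule rapid_dominated[where C = C and q = q]) (auto simp: norm_mult intro!: mult_right_mono assms)

lemma rapid_cmult: "rapid c \<Longrightarrow> rapid (\<lambda>l. z * c l)"
  by (rule rapid_mult_bounded[where C = "norm z" and q = 0]) simp_all

lemma rapid_add:
  assumes "rapid c" "rapid d" shows "rapid (\<lambda>l. c l + d l)"
  unfolding rapid_def
proof
  fix p
  have "(\<lambda>l. (1 + (norm (lat l))\<^sup>2) ^ p * norm (c l) + (1 + (norm (lat l))\<^sup>2) ^ p * norm (d l)) summable_on UNIV"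
    using assms by (intro summable_on_add) (simp_all only: rapid_def)
  then show "(\<lambda>l. (1 + (norm (lat l))\<^sup>2) ^ p * norm (c l + d l)) summable_on UNIV"
    by (rule summable_on_comparison_test)
       (auto simp: distrib_left[symmetric] intro!: mult_left_mono norm_triangle_ineq)
qed

lemma rapid_zero: "rapid (\<lambda>l. 0)"
  by (simp add: rapid_def)

lemma rapid_sum: "(\<And>j. j \<in> J \<Longrightarrow> rapid (c j)) \<Longrightarrow> rapid (\<lambda>l. \<Sum>j\<in>J. c j l)"
  by (induction J rule: infinite_finite_induct) (auto intro: rapid_add rapid_zero)

lemma rapid_diff: "rapid c \<Longrightarrow> rapid d \<Longrightarrow> rapid (\<lambda>l. c l - d l)"
  using rapid_add[of c "\<lambda>l. (-1) * d l"] rapid_cmult[of d "-1"] by simp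

lemma abs_nth_le_weight:
  fixes x :: "real^3"
  shows "\<bar>x $ j\<bar> \<le> 1 + (norm x)\<^sup>2" and "norm x \<le> 1 + (norm x)\<^sup>2"
proof -
  have "0 \<le> (norm x - 1)\<^sup>2" by simp
  then have "2 * norm x \<le> 1 + (norm x)\<^sup>2" by (simp add: power2_eq_square algebra_simps)
  then show "norm x \<le> 1 + (norm x)\<^sup>2" using norm_ge_zero[of x] by linarith
  then show "\<bar>x $ j\<bar> \<le> 1 + (norm x)\<^sup>2" using component_le_norm_cart[of x j] by linarith
qed

lemma rapid_mult_inner: "rapid c \<Longrightarrow> rapid (\<lambda>l. 2 * complex_of_real pi * \<i> * complex_of_real (b \<bullet> lat l) * c l)"
proof (rule rapid_mult_bounded[where C = "2 * pi * norm b" and q = 1])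
  fix l
  have "\<bar>b \<bullet> lat l\<bar> \<le> norm b * norm (lat l)" by (rule Cauchy_Schwarz_ineq2)
  also have "\<dots> \<le> norm b * (1 + (norm (lat l))\<^sup>2)" by (intro mult_left_mono abs_nth_le_weight) simp
  finally show "norm (2 * complex_of_real pi * \<i> * complex_of_real (b \<bullet> lat l)) \<le> 2 * pi * norm b * (1 + (norm (lat l))\<^sup>2) ^ 1"
    by (simp add: norm_mult mult_left_mono)
qed

lemma rapid_deriv: "rapid c \<Longrightarrow> rapid (\<lambda>l. 2 * complex_of_real pi * \<i> * of_int (l $ j) * c l)"
  using rapid_mult_inner[of c "axis j 1"] by (simp add: inner_axis')

text \<open>Since \<open>1 + |l + k|\<^sup>2 \<le> 2 (1 + |k|\<^sup>2) (1 + |l|\<^sup>2)\<close>, a shift changes every weighted sum by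
  at most a constant factor.\<close>

lemma rapid_shift:
  assumes "rapid c" shows "rapid (\<lambda>l. c (l - k))"
  unfolding rapid_def
proof
  fix p
  have "(\<lambda>l. (2 * (1 + (norm (lat k))\<^sup>2)) ^ p * ((1 + (norm (lat l))\<^sup>2) ^ p * norm (c l))) summable_on UNIV"
    using assms by (intro summable_on_cmult_right) (simp only: rapid_def)
  then have *: "(\<lambda>l. (1 + (norm (lat (l + k)))\<^sup>2) ^ p * norm (c l)) summable_on UNIV"
  proof (rule summable_on_comparison_test)
    fix l :: "int^3"
    have "(norm (lat l + lat k))\<^sup>2 \<le> (norm (lat l) + norm (lat k))\<^sup>2"
      by (intro power_mono norm_triangle_ineq) simp
    also have "\<dots> \<le> 2 * (norm (lat l))\<^sup>2 + 2 * (norm (lat k))\<^sup>2"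
      using sum_squares_bound[of "norm (lat l)" "norm (lat k)"] by (simp add: power2_sum)
    finally have "1 + (norm (lat (l + k)))\<^sup>2 \<le> 1 + 2 * (norm (lat l))\<^sup>2 + 2 * (norm (lat k))\<^sup>2"
      by (simp add: lat_add)
    also have "\<dots> \<le> 2 * (1 + (norm (lat k))\<^sup>2) * (1 + (norm (lat l))\<^sup>2)"
      by (simp add: algebra_simps)
    finally have "(1 + (norm (lat (l + k)))\<^sup>2) ^ p \<le> (2 * (1 + (norm (lat k))\<^sup>2) * (1 + (norm (lat l))\<^sup>2)) ^ p"
      by (intro power_mono) simp_all
    then have "(1 + (norm (lat (l + k)))\<^sup>2) ^ p * norm (c l) \<le> (2 * (1 + (norm (lat k))\<^sup>2) * (1 + (norm (lat l))\<^sup>2)) ^ p * norm (c l)"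
      by (rule mult_right_mono) simp
    then show "(1 + (norm (lat (l + k)))\<^sup>2) ^ p * norm (c l) \<le> (2 * (1 + (norm (lat k))\<^sup>2)) ^ p * ((1 + (norm (lat l))\<^sup>2) ^ p * norm (c l))"
      by (simp add: power_mult_distrib mult_ac)
  qed simp
  have "bij_betw (\<lambda>l. l - k) UNIV (UNIV :: (int^3) set)"
    by (rule bij_betwI[where g = "\<lambda>l. l + k"]) auto
  from summable_on_reindex_bij_betw[OF this, of "\<lambda>l. (1 + (norm (lat (l + k)))\<^sup>2) ^ p * norm (c l)"] *
  show "(\<lambda>l. (1 + (norm (lat l))\<^sup>2) ^ p * norm (c (l - k))) summable_on UNIV" by simp
qed

lemma has_sum_tser:
  assumes "(\<lambda>l. norm (c l)) summable_on UNIV"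
  shows "((\<lambda>l. c l * efun l x) has_sum tser c x) UNIV"
  unfolding tser_def
  by (rule has_sum_infsum, rule abs_summable_summable) (use assms in \<open>simp add: norm_mult\<close>)

lemma norm_tser_le:
  assumes "(\<lambda>l. norm (c l)) summable_on UNIV"
  shows "norm (tser c x) \<le> (\<Sum>\<^sub>\<infinity>l. norm (c l))"
  by (rule norm_infsum_le[OF has_sum_tser[OF assms] has_sum_infsum[OF assms]]) (simp add: norm_mult)

lemma has_sum_subtract:
  fixes f g :: "'a \<Rightarrow> 'b :: {topological_ab_group_add}"
  assumes "(f has_sum a) A" "(g has_sum b) A"
  shows "((\<lambda>x. f x - g x) has_sum (a - b)) A"
  using has_sum_add[OF assms(1), of "\<lambda>x. - g x" "- b"] assms(2) by (simp add: has_sum_uminus)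

text \<open>The second order bound \<open>|exp (i t) - 1 - i t| \<le> t\<^sup>2\<close> for each character, summed against the
  coefficients, gives a remainder of order \<open>|h|\<^sup>2\<close>; that is differentiability with the termwise
  derivative.\<close>

lemma has_derivative_tser:
  assumes "rapid c"
  shows "(tser c has_derivative (\<lambda>h. tser (\<lambda>l. 2 * complex_of_real pi * \<i> * complex_of_real (h \<bullet> lat l) * c l) x)) (at x)"
    (is "(_ has_derivative ?D) _")
proof -
  have summ: "(\<lambda>l. norm (2 * complex_of_real pi * \<i> * complex_of_real (h \<bullet> lat l) * c l)) summable_on UNIV" for h
    by (rule rapid_summable[OF rapid_mult_inner[OF assms]])
  define K where "K = (\<Sum>\<^sub>\<infinity>l. 4 * pi\<^sup>2 * ((1 + (norm (lat l))\<^sup>2) ^ 1 * norm (c l)))"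
  have hsK: "((\<lambda>l. 4 * pi\<^sup>2 * ((1 + (norm (lat l))\<^sup>2) ^ 1 * norm (c l))) has_sum K) UNIV"
    unfolding K_def using assms by (intro has_sum_infsum summable_on_cmult_right) (simp only: rapid_def)
  have bound: "norm (tser c (x + h) - tser c x - ?D h) \<le> K * (norm h)\<^sup>2" for h
  proof (rule norm_infsum_le)
    show "((\<lambda>l. c l * efun l (x + h) - c l * efun l x - 2 * complex_of_real pi * \<i> * complex_of_real (h \<bullet> lat l) * c l * efun l x)
        has_sum (tser c (x + h) - tser c x - ?D h)) UNIV"
      by (intro has_sum_subtract has_sum_tser rapid_summable assms rapid_mult_inner)
    show "((\<lambda>l. 4 * pi\<^sup>2 * ((1 + (norm (lat l))\<^sup>2) ^ 1 * norm (c l)) * (norm h)\<^sup>2) has_sum K * (norm h)\<^sup>2) UNIV"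
      by (intro has_sum_cmult_left hsK)
    fix l
    define t where "t = 2 * pi * (lat l \<bullet> h)"
    have e: "efun l h = exp (\<i> * complex_of_real t)"
      by (simp add: efun_def t_def mult_ac)
    have eq: "c l * efun l (x + h) - c l * efun l x - 2 * complex_of_real pi * \<i> * complex_of_real (h \<bullet> lat l) * c l * efun l x
       = c l * efun l x * (exp (\<i> * complex_of_real t) - (1 + \<i> * complex_of_real t))"
      by (simp add: efun_plus e t_def algebra_simps inner_commute)
    have e1: "norm (exp (\<i> * complex_of_real t) - (1 + \<i> * complex_of_real t)) \<le> t\<^sup>2"
      using Taylor_exp[of "\<i> * complex_of_real t" 1] by (simp add: norm_mult power2_eq_square)
    have e2: "t\<^sup>2 \<le> 4 * pi\<^sup>2 * ((1 + (norm (lat l))\<^sup>2)) * (norm h)\<^sup>2"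
    proof -
      have "(lat l \<bullet> h)\<^sup>2 \<le> (norm (lat l))\<^sup>2 * (norm h)\<^sup>2"
        using Cauchy_Schwarz_ineq[of "lat l" h] by (simp add: power2_norm_eq_inner)
      also have "\<dots> \<le> (1 + (norm (lat l))\<^sup>2) * (norm h)\<^sup>2" by (simp add: mult_right_mono)
      finally show ?thesis by (simp add: t_def power_mult_distrib mult_left_mono)
    qed
    have e3: "norm (c l) * norm (exp (\<i> * complex_of_real t) - (1 + \<i> * complex_of_real t))
        \<le> norm (c l) * (4 * pi\<^sup>2 * ((1 + (norm (lat l))\<^sup>2)) * (norm h)\<^sup>2)"
      by (rule mult_left_mono[OF order_trans[OF e1 e2]]) simp
    show "norm (c l * efun l (x + h) - c l * efun l x - 2 * complex_of_real pi * \<i> * complex_of_real (h \<bullet> lat l) * c l * efun l x)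
        \<le> 4 * pi\<^sup>2 * ((1 + (norm (lat l))\<^sup>2) ^ 1 * norm (c l)) * (norm h)\<^sup>2"
      unfolding eq norm_mult using e3 by (simp add: mult_ac)
  qed
  have lin: "bounded_linear ?D"
  proof (rule bounded_linear_intro)
    fix h h' :: "real^3" and r :: real
    show "?D (h + h') = ?D h + ?D h'"
    proof -
      have "((\<lambda>l. 2 * complex_of_real pi * \<i> * complex_of_real (h \<bullet> lat l) * c l * efun l x
           + 2 * complex_of_real pi * \<i> * complex_of_real (h' \<bullet> lat l) * c l * efun l x) has_sum (?D h + ?D h')) UNIV"
        by (intro has_sum_add has_sum_tser summ)
      then have "((\<lambda>l. 2 * complex_of_real pi * \<i> * complex_of_real ((h + h') \<bullet> lat l) * c l * efun l x) has_sum (?D h + ?D h')) UNIV"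
        by (simp add: inner_add_left ring_distribs)
      then show ?thesis using has_sum_unique[OF has_sum_tser[OF summ]] by blast
    qed
    show "?D (r *\<^sub>R h) = r *\<^sub>R ?D h"
    proof -
      have "((\<lambda>l. complex_of_real r * (2 * complex_of_real pi * \<i> * complex_of_real (h \<bullet> lat l) * c l * efun l x))
          has_sum (complex_of_real r * ?D h)) UNIV"
        by (intro has_sum_cmult_right has_sum_tser summ)
      moreover have "complex_of_real r * (2 * complex_of_real pi * \<i> * complex_of_real (h \<bullet> lat l) * c l * efun l x)
          = 2 * complex_of_real pi * \<i> * complex_of_real ((r *\<^sub>R h) \<bullet> lat l) * c l * efun l x" for l
        by simp
      ultimately have "((\<lambda>l. 2 * complex_of_real pi * \<i> * complex_of_real ((r *\<^sub>R h) \<bullet> lat l) * c l * efun l x) has_sum (r *\<^sub>R ?D h)) UNIV"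
        by (simp only: scaleR_conv_of_real)
      then show ?thesis using has_sum_unique[OF has_sum_tser[OF summ]] by blast
    qed
    show "norm (?D h) \<le> norm h * (\<Sum>\<^sub>\<infinity>l. 2 * pi * ((1 + (norm (lat l))\<^sup>2) ^ 1 * norm (c l)))"
    proof (rule norm_infsum_le[OF has_sum_tser[OF summ]])
      show "((\<lambda>l. norm h * (2 * pi * ((1 + (norm (lat l))\<^sup>2) ^ 1 * norm (c l)))) has_sum
          norm h * (\<Sum>\<^sub>\<infinity>l. 2 * pi * ((1 + (norm (lat l))\<^sup>2) ^ 1 * norm (c l)))) UNIV"
        using assms by (intro has_sum_cmult_right has_sum_infsum summable_on_cmult_right) (simp only: rapid_def)
      fix l
      have "\<bar>h \<bullet> lat l\<bar> \<le> norm h * (1 + (norm (lat l))\<^sup>2)"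
        by (rule order_trans[OF Cauchy_Schwarz_ineq2]) (intro mult_left_mono abs_nth_le_weight norm_ge_zero)
      then have "2 * pi * \<bar>h \<bullet> lat l\<bar> * norm (c l) \<le> 2 * pi * (norm h * (1 + (norm (lat l))\<^sup>2)) * norm (c l)"
        by (intro mult_left_mono mult_right_mono) auto
      then show "norm (2 * complex_of_real pi * \<i> * complex_of_real (h \<bullet> lat l) * c l * efun l x)
          \<le> norm h * (2 * pi * ((1 + (norm (lat l))\<^sup>2) ^ 1 * norm (c l)))"
        by (simp add: norm_mult mult_ac)
    qed
  qed
  have "(\<lambda>h. norm (tser c (x + h) - tser c x - ?D h) / norm h) \<midarrow>0\<rightarrow> 0"
  proof (rule Lim_null_comparison[OF always_eventually])
    show "\<forall>h. norm (norm (tser c (x + h) - tser c x - ?D h) / norm h) \<le> K * norm h"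
    proof
      fix h show "norm (norm (tser c (x + h) - tser c x - ?D h) / norm h) \<le> K * norm h"
        using bound[of h] by (cases "h = 0") (auto simp: divide_simps power2_eq_square mult_ac)
    qed
    show "((\<lambda>h. K * norm h) \<longlongrightarrow> 0) (at 0)"
      by (auto intro!: tendsto_eq_intros)
  qed
  with lin show ?thesis by (simp add: has_derivative_at)
qed

lemma continuous_tser: "rapid c \<Longrightarrow> continuous_on UNIV (tser c)"
  using has_derivative_continuous[OF has_derivative_tser] by (simp add: continuous_on_eq_continuous_at)

lemma pd_tser: "rapid c \<Longrightarrow> pd j (tser c) = tser (\<lambda>l. 2 * complex_of_real pi * \<i> * of_int (l $ j) * c l)"
  by (rule ext) (simp add: pd_eqI[OF has_derivative_tser] inner_axis')

lemma periodic_tser: "periodic (tser c)"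
  using periodic_efun by (simp add: periodic_def tser_def)

lemma tser_add: "rapid c \<Longrightarrow> rapid d \<Longrightarrow> tser (\<lambda>l. c l + d l) x = tser c x + tser d x"
proof -
  assume "rapid c" "rapid d"
  then have "((\<lambda>l. c l * efun l x + d l * efun l x) has_sum (tser c x + tser d x)) UNIV"
    by (intro has_sum_add has_sum_tser rapid_summable)
  then show ?thesis
    by (simp add: tser_def ring_distribs infsumI)
qed

lemma tser_cmult: "tser (\<lambda>l. z * c l) x = z * tser c x"
  by (simp add: tser_def mult.assoc infsum_cmult_right')

lemma tser_diff: "rapid c \<Longrightarrow> rapid d \<Longrightarrow> tser (\<lambda>l. c l - d l) x = tser c x - tser d x"
proof -
  assume "rapid c" "rapid d"
  then have "((\<lambda>l. c l * efun l x - d l * efun l x) has_sum (tser c x - tser d x)) UNIV"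
    by (intro has_sum_subtract has_sum_tser rapid_summable)
  then show ?thesis
    by (simp add: tser_def ring_distribs infsumI)
qed

lemma tser_sum: "(\<And>j. j \<in> J \<Longrightarrow> rapid (c j)) \<Longrightarrow> tser (\<lambda>l. \<Sum>j\<in>J. c j l) x = (\<Sum>j\<in>J. tser (c j) x)"
proof (induction J rule: infinite_finite_induct)
  case (insert j J)
  then show ?case by (simp add: tser_add rapid_sum)
qed (simp_all add: tser_def)

lemma tser_shift: "efun k x * tser c x = tser (\<lambda>l. c (l - k)) x"
proof -
  have "bij_betw (\<lambda>l. l - k) UNIV (UNIV :: (int^3) set)"
    by (rule bij_betwI[where g = "\<lambda>l. l + k"]) auto
  from infsum_reindex_bij_betw[OF this, of "\<lambda>l. c l * efun (l + k) x"]
  have "tser (\<lambda>l. c (l - k)) x = (\<Sum>\<^sub>\<infinity>l. c l * efun (l + k) x)"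
    by (simp add: tser_def)
  also have "\<dots> = (\<Sum>\<^sub>\<infinity>l. efun k x * (c l * efun l x))"
    by (simp add: efun_add mult_ac)
  finally show ?thesis by (simp add: tser_def infsum_cmult_right')
qed

text \<open>Hence a series is real valued as soon as opposite frequencies carry conjugate coefficients.\<close>

lemma cnj_tser: "cnj (tser c x) = tser (\<lambda>l. cnj (c (- l))) x"
proof -
  have "bij_betw uminus UNIV (UNIV :: (int^3) set)"
    by (rule bij_betwI[where g = uminus]) auto
  from infsum_reindex_bij_betw[OF this, of "\<lambda>l. cnj (c l * efun l x)"]
  have "(\<Sum>\<^sub>\<infinity>l. cnj (c l * efun l x)) = tser (\<lambda>l. cnj (c (- l))) x"
    by (simp add: tser_def efun_minus)
  then show ?thesis by (simp only: tser_def infsum_cnj)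
qed


section \<open>Integration over the torus\<close>

lemma content_unit_cube: "emeasure lborel (cbox 0 (1 :: real^3)) = 1" "emeasure lborel (box 0 (1 :: real^3)) = 1"
proof -
  have "inner 1 b = 1" if "b \<in> Basis" for b :: "real^3"
    using that by (auto simp: Basis_vec_def inner_axis)
  then show "emeasure lborel (cbox 0 (1 :: real^3)) = 1" "emeasure lborel (box 0 (1 :: real^3)) = 1"
    by (simp_all add: emeasure_lborel_cbox_eq emeasure_lborel_box_eq)
qed

interpretation T3: finite_measure T3
  unfolding T3_def
  by (rule finite_measureI) (simp add: emeasure_restrict_space space_restrict_space content_unit_cube)

lemma space_T3 [simp]: "space T3 = cbox 0 1"
  by (simp add: T3_def space_restrict_space)

lemma measure_T3 [simp]: "measure T3 (cbox 0 1) = 1"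
proof -
  have "emeasure T3 (cbox 0 1) = 1"
    by (simp only: T3_def emeasure_restrict_space[of "cbox 0 1" lborel, simplified] content_unit_cube order_refl)
  then show ?thesis by (simp add: measure_def)
qed

lemma borel_measurable_T3: "f \<in> borel_measurable borel \<Longrightarrow> f \<in> borel_measurable T3"
  unfolding T3_def by (rule measurable_restrict_space1) simp

lemma continuous_measurable_T3: "continuous_on UNIV f \<Longrightarrow> f \<in> borel_measurable T3"
  by (intro borel_measurable_T3 borel_measurable_continuous_onI)

lemma integrable_T3_continuous:
  fixes f :: "real^3 \<Rightarrow> 'b::{banach, second_countable_topology}"
  assumes "continuous_on UNIV f"
  shows "integrable T3 f"
proof -
  have "compact (f ` cbox 0 1)"
    by (intro compact_continuous_image continuous_on_subset[OF assms]) auto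
  then obtain B where "\<And>x. x \<in> cbox 0 1 \<Longrightarrow> norm (f x) \<le> B"
    using compact_imp_bounded bounded_iff by (metis imageI)
  then show ?thesis
    by (intro T3.integrable_const_bound[where B = B] continuous_measurable_T3 assms AE_I2) simp
qed

text \<open>The torus has volume one, so a uniform bound passes to the integral unchanged.\<close>

lemma norm_integral_T3_le:
  fixes f :: "real^3 \<Rightarrow> 'b::{banach, second_countable_topology}"
  assumes "\<And>x. norm (f x) \<le> B"
  shows "norm (\<integral>x. f x \<partial>T3) \<le> B"
proof (cases "integrable T3 f")
  case True
  have "norm (\<integral>x. f x \<partial>T3) \<le> (\<integral>x. norm (f x) \<partial>T3)" by simp
  also have "\<dots> \<le> (\<integral>x. B \<partial>T3)"
    using True assms by (intro integral_mono) auto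
  finally show ?thesis by simp
next
  case False
  then show ?thesis using order_trans[OF norm_ge_zero assms[of 0]] by (simp add: not_integrable_integral_eq)
qed

lemma unit_cube_representative:
  obtains y k where "y \<in> cbox 0 1" "x = y + lat k"
proof
  show "(\<chi> i. frac (x $ i)) \<in> cbox 0 1"
    by (auto simp: mem_box_cart intro: less_imp_le frac_lt_1)
  show "x = (\<chi> i. frac (x $ i)) + lat (\<chi> i. \<lfloor>x $ i\<rfloor>)"
    by (simp add: vec_eq_iff frac_def)
qed

lemma periodic_bounded:
  fixes f :: "real^3 \<Rightarrow> 'b::real_normed_vector"
  assumes "continuous_on UNIV f" "periodic f"
  obtains B where "\<And>x. norm (f x) \<le> B"
proof -
  have "compact (f ` cbox 0 1)"
    using assms by (intro compact_continuous_image continuous_on_subset[OF assms(1)]) auto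
  then obtain B where B: "\<And>x. x \<in> cbox 0 1 \<Longrightarrow> norm (f x) \<le> B"
    using compact_imp_bounded bounded_iff by (metis imageI)
  have "norm (f x) \<le> B" for x
    using unit_cube_representative[of x] B assms(2) unfolding periodic_def by metis
  then show ?thesis by (rule that)
qed

lemma lborel_integral_translation:
  fixes g :: "'a::euclidean_space \<Rightarrow> 'b::{banach, second_countable_topology}"
  assumes [measurable]: "g \<in> borel_measurable borel"
  shows "(\<integral>x. g (c + x) \<partial>lborel) = (\<integral>x. g x \<partial>lborel)"
proof -
  have "(\<integral>x. g x \<partial>lborel) = (\<integral>x. g x \<partial>(distr lborel borel ((+) c)))"
    by (simp only: lborel_distr_plus)
  also have "\<dots> = (\<integral>x. g (c + x) \<partial>lborel)"
    by (rule integral_distr) auto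
  finally show ?thesis by simp
qed

text \<open>Cut by a coordinate hyperplane and with one piece moved by a period, it is again a half-open cube,
  with no overlap along faces.\<close>

definition half_open_cube :: "(real^3) set" where
  "half_open_cube = {x. \<forall>i. 0 \<le> x $ i \<and> x $ i < 1}"

lemma half_open_cube_measurable [measurable]: "half_open_cube \<in> sets borel"
  unfolding half_open_cube_def by measurable

lemma half_open_cube_subset: "half_open_cube \<subseteq> cbox 0 1"
  by (simp add: subset_iff mem_box_cart half_open_cube_def less_imp_le)

lemma integral_T3_half_open:
  fixes f :: "real^3 \<Rightarrow> 'b::{banach, second_countable_topology}"
  assumes [measurable]: "f \<in> borel_measurable borel"
  shows "(\<integral>x. f x \<partial>T3) = (\<integral>x. indicator half_open_cube x *\<^sub>R f x \<partial>lborel)"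
proof -
  have "emeasure lborel (cbox 0 1 - box 0 (1 :: real^3)) = 0"
    by (subst emeasure_Diff) (auto simp: content_unit_cube box_subset_cbox)
  then have "AE x in lborel. x \<notin> cbox 0 1 - box 0 (1 :: real^3)"
    by (intro AE_not_in) (simp add: null_sets_def)
  then have AE: "AE x in lborel. indicator (cbox 0 1) x *\<^sub>R f x = indicator half_open_cube x *\<^sub>R f x"
  proof (rule eventually_mono)
    fix x :: "real^3" assume x: "x \<notin> cbox 0 1 - box 0 1"
    have "box 0 1 \<subseteq> half_open_cube"
      by (simp add: subset_iff mem_box_cart half_open_cube_def less_imp_le)
    with x half_open_cube_subset have "x \<in> cbox 0 1 \<longleftrightarrow> x \<in> half_open_cube"
      by blast
    then show "indicator (cbox 0 1) x *\<^sub>R f x = indicator half_open_cube x *\<^sub>R f x"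
      by (simp add: indicator_def)
  qed
  have "(\<integral>x. f x \<partial>T3) = (\<integral>x. indicator (cbox 0 1) x *\<^sub>R f x \<partial>lborel)"
    unfolding T3_def by (rule integral_restrict_space) simp
  also have "\<dots> = (\<integral>x. indicator half_open_cube x *\<^sub>R f x \<partial>lborel)"
    by (rule integral_cong_AE[OF _ _ AE]; intro borel_measurable_scaleR borel_measurable_indicator; simp add: assms)
  finally show ?thesis .
qed

text \<open>The translated cube is cut where it leaves the original one, and the protruding slab is moved
  back by one period.\<close>

lemma integral_T3_translation:
  fixes f :: "real^3 \<Rightarrow> 'b::{banach, second_countable_topology}"
  assumes cont: "continuous_on UNIV f" and per: "periodic f" and t: "0 \<le> t" "t \<le> 1"
  shows "(\<integral>x. f (x + t *\<^sub>R axis j 1) \<partial>T3) = (\<integral>x. f x \<partial>T3)"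
proof -
  note [measurable] = borel_measurable_continuous_onI[OF cont]
  define e :: "real^3" where "e = axis j 1"
  define H where "H = half_open_cube"
  define A where "A = {y \<in> H. t \<le> y $ j}"
  define B where "B = {y \<in> H. y $ j < t}"
  have [measurable]: "H \<in> sets borel" "A \<in> sets borel" "B \<in> sets borel"
    unfolding A_def B_def H_def by measurable
  have fe: "f (e + x) = f x" for x
  proof -
    have "lat (axis j 1) = e" by (simp add: e_def vec_eq_iff axis_def)
    with per show ?thesis unfolding periodic_def by (metis add.commute)
  qed
  have iH: "integrable lborel (\<lambda>x. indicator H x *\<^sub>R f x)"
  proof -
    obtain M where M: "\<And>x. norm (f x) \<le> M" using periodic_bounded[OF cont per] by blast
    have "emeasure lborel H \<le> emeasure lborel (cbox 0 (1 :: real^3))"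
      by (rule emeasure_mono) (simp_all add: H_def half_open_cube_subset)
    then have "emeasure lborel H < \<infinity>"
      using content_unit_cube(1) by (simp add: order_le_less_trans[OF _ ennreal_one_less_top])
    then have "integrable lborel (\<lambda>x. indicator H x *\<^sub>R M)"
      by (intro integrable_scaleR_left integrable_real_indicator) auto
    then show ?thesis
    proof (rule Bochner_Integration.integrable_bound)
      have "norm (f x) \<le> \<bar>M\<bar>" for x using M[of x] by linarith
      then show "AE x in lborel. norm (indicator H x *\<^sub>R f x) \<le> norm (indicator H x *\<^sub>R M)"
        by (simp add: indicator_def)
    qed measurable
  qed
  have iA: "integrable lborel (\<lambda>x. indicator A x *\<^sub>R f x)" and iB: "integrable lborel (\<lambda>x. indicator B x *\<^sub>R f x)"
  proof -
    have AB: "AE x in lborel. norm (indicator A x *\<^sub>R f x) \<le> norm (indicator H x *\<^sub>R f x)"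
      "AE x in lborel. norm (indicator B x *\<^sub>R f x) \<le> norm (indicator H x *\<^sub>R f x)"
      by (intro AE_I2; simp add: A_def B_def indicator_def)+
    show "integrable lborel (\<lambda>x. indicator A x *\<^sub>R f x)"
      by (rule Bochner_Integration.integrable_bound[OF iH _ AB(1)];
          intro borel_measurable_scaleR borel_measurable_indicator; simp)
    show "integrable lborel (\<lambda>x. indicator B x *\<^sub>R f x)"
      by (rule Bochner_Integration.integrable_bound[OF iH _ AB(2)];
          intro borel_measurable_scaleR borel_measurable_indicator; simp)
  qed
  have iBe: "integrable lborel (\<lambda>x. indicator B (- e + x) *\<^sub>R f x)"
  proof -
    have "integrable (distr lborel borel ((+) (- e))) (\<lambda>x. indicator B x *\<^sub>R f x)"
      using iB by (simp only: lborel_distr_plus)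
    then have "integrable lborel (\<lambda>x. indicator B (- e + x) *\<^sub>R f (- e + x))"
      by (subst (asm) integrable_distr_eq) auto
    moreover have "f (- e + x) = f x" for x using fe[of "- e + x"] by simp
    ultimately show ?thesis by simp
  qed
  have split: "(indicator H (- (t *\<^sub>R e) + y) :: real) = indicator A y + indicator B (- e + y)" for y
  proof -
    define P where "P x \<longleftrightarrow> (\<forall>i. i \<noteq> j \<longrightarrow> 0 \<le> x $ i \<and> x $ i < 1)" for x :: "real^3"
    have H: "x \<in> H \<longleftrightarrow> P x \<and> 0 \<le> x $ j \<and> x $ j < 1" for x
      unfolding H_def half_open_cube_def P_def mem_Collect_eq by metis
    have ei: "e $ i = (if i = j then 1 else 0)" for i by (simp add: e_def axis_def)
    have P: "P (y - t *\<^sub>R e) \<longleftrightarrow> P y" "P (y - e) \<longleftrightarrow> P y"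
      unfolding P_def by (simp_all add: ei)
    have "(- (t *\<^sub>R e) + y \<in> H) \<longleftrightarrow> y \<in> A \<or> - e + y \<in> B"
      using t by (auto simp: A_def B_def H P ei)
    moreover have "\<not> (y \<in> A \<and> - e + y \<in> B)"
      by (auto simp: A_def B_def H P ei)
    ultimately show ?thesis by (auto simp: indicator_def)
  qed
  have "(\<integral>x. f (x + t *\<^sub>R e) \<partial>T3) = (\<integral>x. indicator H x *\<^sub>R f (x + t *\<^sub>R e) \<partial>lborel)"
    unfolding H_def by (rule integral_T3_half_open) measurable
  also have "\<dots> = (\<integral>x. indicator H (- (t *\<^sub>R e) + x) *\<^sub>R f x \<partial>lborel)"
    by (subst lborel_integral_translation[of "\<lambda>x. indicator H x *\<^sub>R f (x + t *\<^sub>R e)" "- (t *\<^sub>R e)", symmetric])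
       (simp_all add: algebra_simps)
  also have "\<dots> = (\<integral>x. indicator A x *\<^sub>R f x \<partial>lborel) + (\<integral>x. indicator B (- e + x) *\<^sub>R f x \<partial>lborel)"
    unfolding split scaleR_left_distrib by (rule Bochner_Integration.integral_add[OF iA iBe])
  also have "(\<integral>x. indicator B (- e + x) *\<^sub>R f x \<partial>lborel) = (\<integral>x. indicator B x *\<^sub>R f x \<partial>lborel)"
    by (subst lborel_integral_translation[of "\<lambda>x. indicator B (- e + x) *\<^sub>R f x" e, symmetric]) (simp_all add: fe)
  also have "(\<integral>x. indicator A x *\<^sub>R f x \<partial>lborel) + (\<integral>x. indicator B x *\<^sub>R f x \<partial>lborel)
      = (\<integral>x. indicator A x *\<^sub>R f x + indicator B x *\<^sub>R f x \<partial>lborel)"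
    by (rule Bochner_Integration.integral_add[OF iA iB, symmetric])
  also have "\<dots> = (\<integral>x. indicator H x *\<^sub>R f x \<partial>lborel)"
    by (intro Bochner_Integration.integral_cong) (auto simp: A_def B_def indicator_def)
  also have "\<dots> = (\<integral>x. f x \<partial>T3)"
    unfolding H_def by (rule integral_T3_half_open[symmetric]) measurable
  finally show ?thesis by (simp add: e_def)
qed

lemma periodic_pd:
  assumes "periodic f"
  shows "periodic (pd j f)"
proof -
  have *: "(f has_derivative D) (at (x + lat k)) \<longleftrightarrow> (f has_derivative D) (at x)" for D x k
  proof -
    have eq: "f (x + lat k + h) = f (x + h)" "f (x + lat k) = f x" for h
      using assms unfolding periodic_def by (metis add.assoc add.commute)+
    show ?thesis unfolding has_derivative_at eq ..
  qed
  show ?thesis unfolding periodic_def pd_def frechet_derivative_def * by simp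
qed

lemma has_derivative_pd:
  "f differentiable (at x) \<Longrightarrow> (f has_derivative frechet_derivative f (at x)) (at x)"
  by (simp add: frechet_derivative_works)

text \<open>Difference quotients in a coordinate direction have integral zero by translation invariance.
  The mean value theorem bounds them by the supremum of the partial derivative, so dominated
  convergence carries this over to the derivative. This is integration by parts on the torus.\<close>

lemma integral_pd_eq_0:
  fixes f :: "real^3 \<Rightarrow> complex"
  assumes diff: "\<And>x. f differentiable (at x)" and cont: "continuous_on UNIV (pd j f)" and per: "periodic f"
  shows "(\<integral>x. pd j f x \<partial>T3) = 0"
proof -
  define e :: "real^3" where "e = axis j 1"
  have contf: "continuous_on UNIV f"
    using diff by (simp add: continuous_on_eq_continuous_at differentiable_imp_continuous_within)
  obtain M where M: "\<And>x. norm (pd j f x) \<le> M" using periodic_bounded[OF cont periodic_pd[OF per]] by blast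
  define g where "g n x = (f (x + (1 / real (Suc n)) *\<^sub>R e) - f x) * of_nat (Suc n)" for n x
  have "continuous_on UNIV (\<lambda>x. f (x + s *\<^sub>R e))" for s
    by (rule continuous_on_compose2[OF contf]) (auto intro!: continuous_intros)
  note cont_shift = this
  have "(\<integral>x. g n x \<partial>T3) = 0" for n
    unfolding g_def using integral_T3_translation[OF contf per, of "1 / real (Suc n)" j]
    by (simp add: integrable_T3_continuous contf cont_shift e_def del: of_nat_Suc)
       (simp add: integrable_T3_continuous contf cont_shift[unfolded e_def])
  moreover have "(\<lambda>n. \<integral>x. g n x \<partial>T3) \<longlonglongrightarrow> (\<integral>x. pd j f x \<partial>T3)"
  proof (rule integral_dominated_convergence[where w = "\<lambda>_. M"])
    show "AE x in T3. (\<lambda>n. g n x) \<longlonglongrightarrow> pd j f x"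
    proof (rule AE_I2)
      fix x
      let ?D = "frechet_derivative f (at x)"
      have D: "(f has_derivative ?D) (at x)" by (rule has_derivative_pd[OF diff])
      then have bl: "bounded_linear ?D" and lim: "(\<lambda>h. norm (f (x + h) - f x - ?D h) / norm h) \<midarrow>0\<rightarrow> 0"
        by (auto simp: has_derivative_at)
      have "filterlim (\<lambda>n. (1 / real (Suc n)) *\<^sub>R e) (at 0) sequentially"
        unfolding filterlim_at
      proof
        show "(\<lambda>n. (1 / real (Suc n)) *\<^sub>R e) \<longlonglongrightarrow> 0"
          using tendsto_scaleR[OF LIMSEQ_inverse_real_of_nat tendsto_const[of e]] by (simp add: divide_inverse)
        show "\<forall>\<^sub>F n in sequentially. (1 / real (Suc n)) *\<^sub>R e \<in> UNIV \<and> (1 / real (Suc n)) *\<^sub>R e \<noteq> 0"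
          by (simp add: e_def axis_eq_0_iff)
      qed
      from filterlim_compose[OF lim this]
      have "(\<lambda>n. norm (f (x + (1 / real (Suc n)) *\<^sub>R e) - f x - ?D ((1 / real (Suc n)) *\<^sub>R e))
          / norm ((1 / real (Suc n)) *\<^sub>R e)) \<longlonglongrightarrow> 0" .
      moreover have "norm (f (x + (1 / real (Suc n)) *\<^sub>R e) - f x - ?D ((1 / real (Suc n)) *\<^sub>R e))
          / norm ((1 / real (Suc n)) *\<^sub>R e) = norm (g n x - pd j f x)" for n
      proof -
        have "?D ((1 / real (Suc n)) *\<^sub>R e) = complex_of_real (1 / real (Suc n)) * pd j f x"
          using linear_scale[OF bounded_linear.linear[OF bl]] by (simp add: pd_def e_def scaleR_conv_of_real)
        then have "g n x - pd j f x = (f (x + (1 / real (Suc n)) *\<^sub>R e) - f x - ?D ((1 / real (Suc n)) *\<^sub>R e)) * of_nat (Suc n)"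
          unfolding g_def by (simp add: ring_distribs mult_ac del: of_nat_Suc)
        then have "norm (g n x - pd j f x) = norm (f (x + (1 / real (Suc n)) *\<^sub>R e) - f x - ?D ((1 / real (Suc n)) *\<^sub>R e)) * real (Suc n)"
          by (simp only: norm_mult norm_of_nat)
        moreover have "norm ((1 / real (Suc n)) *\<^sub>R e) = 1 / real (Suc n)"
          by (simp add: e_def)
        ultimately show ?thesis by (simp only: divide_divide_eq_right div_by_1)
      qed
      ultimately have "(\<lambda>n. g n x - pd j f x) \<longlonglongrightarrow> 0"
        by (simp only: tendsto_norm_zero_iff)
      then show "(\<lambda>n. g n x) \<longlonglongrightarrow> pd j f x" by (rule LIM_zero_cancel)
    qed
    show "AE x in T3. norm (g n x) \<le> M" for n
    proof (rule AE_I2)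
      fix x
      have der: "((\<lambda>s. f (x + s *\<^sub>R e)) has_derivative (\<lambda>r. r *\<^sub>R pd j f (x + s *\<^sub>R e))) (at s)" for s
      proof -
        have D: "(f has_derivative frechet_derivative f (at (x + s *\<^sub>R e))) (at (x + s *\<^sub>R e))"
          by (rule has_derivative_pd[OF diff])
        have "((\<lambda>s. x + s *\<^sub>R e) has_derivative (\<lambda>r. r *\<^sub>R e)) (at s)"
          by (auto intro!: derivative_eq_intros)
        from has_derivative_compose[OF this D] show ?thesis
          using linear_scale[OF has_derivative_linear[OF D]] by (simp add: pd_def e_def)
      qed
      have "continuous_on {0..1 / real (Suc n)} (\<lambda>s. f (x + s *\<^sub>R e))"
        by (rule continuous_on_compose2[OF contf]) (auto intro!: continuous_intros)
      with mvt_general[of 0 "1 / real (Suc n)", OF _ _ der]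
      obtain s where "norm (f (x + (1 / real (Suc n)) *\<^sub>R e) - f x) \<le> norm ((1 / real (Suc n)) *\<^sub>R pd j f (x + s *\<^sub>R e))"
        by (auto simp del: of_nat_Suc)
      also have "\<dots> \<le> (1 / real (Suc n)) * M"
        unfolding norm_scaleR by (intro mult_mono M) auto
      finally show "norm (g n x) \<le> M"
        unfolding g_def norm_mult norm_of_nat by (simp add: field_simps del: of_nat_Suc)
    qed
    show "g n \<in> borel_measurable T3" for n
      unfolding g_def by (intro continuous_measurable_T3 continuous_intros cont_shift contf)
  qed (auto intro: continuous_measurable_T3 cont)
  ultimately show ?thesis by (simp add: LIMSEQ_const_iff)
qed

lemma pd_mult:
  fixes f g :: "real^3 \<Rightarrow> complex"
  assumes "f differentiable (at x)" "g differentiable (at x)"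
  shows "pd j (\<lambda>x. f x * g x) x = f x * pd j g x + pd j f x * g x"
  by (subst pd_eqI[OF has_derivative_mult[OF has_derivative_pd[OF assms(1)] has_derivative_pd[OF assms(2)]]])
     (simp add: pd_def)

definition coef :: "(real^3 \<Rightarrow> complex) \<Rightarrow> int^3 \<Rightarrow> complex" where
  "coef f l = (\<integral>x. f x * efun (- l) x \<partial>T3)"

lemma differentiable_efun: "efun k differentiable (at x)"
  using has_derivative_efun by (rule differentiableI)

lemma coef_pd:
  assumes diff: "\<And>x. f differentiable (at x)" and cont: "continuous_on UNIV (pd j f)" and per: "periodic f"
  shows "coef (pd j f) l = 2 * complex_of_real pi * \<i> * of_int (l $ j) * coef f l"
proof -
  have contf: "continuous_on UNIV f"
    using diff by (simp add: continuous_on_eq_continuous_at differentiable_imp_continuous_within)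
  define b where "b = 2 * complex_of_real pi * \<i> * of_int (l $ j)"
  \<comment> \<open>product rule; the derivative of the conjugate character supplies the factor \<open>- b\<close>\<close>
  have pdm: "pd j (\<lambda>x. f x * efun (- l) x) = (\<lambda>x. pd j f x * efun (- l) x - b * (f x * efun (- l) x))"
    using pd_efun[of j 1 "- l"] by (intro ext) (simp add: pd_mult[OF diff differentiable_efun] b_def)
  have "(\<integral>x. pd j (\<lambda>x. f x * efun (- l) x) x \<partial>T3) = 0"
  proof (rule integral_pd_eq_0)
    show "(\<lambda>x. f x * efun (- l) x) differentiable (at x)" for x
      by (intro differentiable_mult diff differentiable_efun)
    show "continuous_on UNIV (pd j (\<lambda>x. f x * efun (- l) x))"
      unfolding pdm by (intro continuous_intros cont contf continuous_efun)
    show "periodic (\<lambda>x. f x * efun (- l) x)"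
      using per periodic_efun[of "- l"] by (simp add: periodic_def)
  qed
  moreover have "integrable T3 (\<lambda>x. pd j f x * efun (- l) x)" "integrable T3 (\<lambda>x. b * (f x * efun (- l) x))"
    by (intro integrable_T3_continuous continuous_intros cont contf continuous_efun)+
  ultimately show ?thesis
    unfolding pdm coef_def by (simp add: b_def)
qed

text \<open>For \<open>k \<noteq> 0\<close> some partial derivative of the character is a nonzero multiple of it, and that
  derivative integrates to zero.\<close>

lemma integral_efun: "(\<integral>x. efun k x \<partial>T3) = (if k = 0 then 1 else 0)"
proof (cases "k = 0")
  case False
  then obtain j where j: "k $ j \<noteq> 0" by (auto simp: vec_eq_iff)
  have pde: "pd j (efun k) = (\<lambda>x. (2 * complex_of_real pi * \<i> * of_int (k $ j)) * efun k x)"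
    using pd_efun[of j 1 k] by (intro ext) simp
  have "(\<integral>x. pd j (efun k) x \<partial>T3) = 0"
    by (rule integral_pd_eq_0) (auto simp: differentiable_efun periodic_efun pde intro!: continuous_intros continuous_efun)
  then have "(2 * complex_of_real pi * \<i> * of_int (k $ j)) * (\<integral>x. efun k x \<partial>T3) = 0"
    unfolding pde by (simp only: integral_mult_right_zero)
  with j False show ?thesis by simp
qed simp

text \<open>The tails of the series are uniformly small, and the integral against an integrable function is
  continuous for uniform convergence.\<close>

lemma integral_tser_has_sum:
  assumes c: "rapid c" and h: "integrable T3 h"
  shows "((\<lambda>l. c l * (\<integral>x. efun l x * h x \<partial>T3)) has_sum (\<integral>x. tser c x * h x \<partial>T3)) UNIV"
proof -
  have [measurable]: "h \<in> borel_measurable T3" using h by auto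
  have [measurable]: "tser c \<in> borel_measurable T3" "efun l \<in> borel_measurable T3" for l
    by (intro continuous_measurable_T3 continuous_tser continuous_efun c)+
  note sc = rapid_summable[OF c]
  let ?s = "\<Sum>\<^sub>\<infinity>l. norm (c l)" and ?I = "\<integral>x. tser c x * h x \<partial>T3"
  have ie: "integrable T3 (\<lambda>x. efun l x * h x)" for l
    by (rule Bochner_Integration.integrable_bound[OF h]) (auto simp: norm_mult)
  have "((\<lambda>F. (\<Sum>l\<in>F. c l * (\<integral>x. efun l x * h x \<partial>T3)) - ?I) \<longlongrightarrow> 0) (finite_subsets_at_top UNIV)"
  proof (rule Lim_null_comparison)
    have "((\<lambda>F. \<Sum>l\<in>F. norm (c l)) \<longlongrightarrow> ?s) (finite_subsets_at_top UNIV)"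
      using has_sum_infsum[OF sc] by (simp only: has_sum_def)
    from tendsto_mult_right[OF tendsto_diff[OF tendsto_const[of ?s] this], of "\<integral>x. norm (h x) \<partial>T3"]
    show "((\<lambda>F. (?s - (\<Sum>l\<in>F. norm (c l))) * (\<integral>x. norm (h x) \<partial>T3)) \<longlongrightarrow> 0) (finite_subsets_at_top UNIV)"
      by simp
    show "\<forall>\<^sub>F F in finite_subsets_at_top UNIV. norm ((\<Sum>l\<in>F. c l * (\<integral>x. efun l x * h x \<partial>T3)) - ?I)
        \<le> (?s - (\<Sum>l\<in>F. norm (c l))) * (\<integral>x. norm (h x) \<partial>T3)"
    proof (rule eventually_finite_subsets_at_top_weakI)
      fix F :: "(int^3) set" assume "finite F"
      have tail: "norm ((\<Sum>l\<in>F. c l * efun l x) - tser c x) \<le> ?s - (\<Sum>l\<in>F. norm (c l))" for x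
      proof -
        have "((\<lambda>l. c l * efun l x - (if l \<in> F then c l * efun l x else 0)) has_sum (tser c x - (\<Sum>l\<in>F. c l * efun l x))) UNIV"
          by (intro has_sum_subtract has_sum_tser sc has_sum_finite_neutralI[OF \<open>finite F\<close>]) auto
        moreover have "((\<lambda>l. norm (c l) - (if l \<in> F then norm (c l) else 0)) has_sum (?s - (\<Sum>l\<in>F. norm (c l)))) UNIV"
          by (intro has_sum_subtract has_sum_infsum sc has_sum_finite_neutralI[OF \<open>finite F\<close>]) auto
        ultimately have "norm (tser c x - (\<Sum>l\<in>F. c l * efun l x)) \<le> ?s - (\<Sum>l\<in>F. norm (c l))"
          by (rule norm_infsum_le) (simp add: norm_mult)
        then show ?thesis by (simp only: norm_minus_commute)
      qed
      have nn: "0 \<le> ?s - (\<Sum>l\<in>F. norm (c l))" using order_trans[OF norm_ge_zero tail[of 0]] .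
      have ib: "integrable T3 (\<lambda>x. ((\<Sum>l\<in>F. c l * efun l x) - tser c x) * h x)"
        by (rule Bochner_Integration.integrable_bound[OF integrable_mult_right[OF h, of "complex_of_real (?s - (\<Sum>l\<in>F. norm (c l)))"]])
           (auto simp: norm_mult abs_of_nonneg[OF nn] norm_of_real simp del: of_real_diff of_real_sum intro!: mult_right_mono tail AE_I2)
      have iF: "integrable T3 (\<lambda>x. \<Sum>l\<in>F. c l * (efun l x * h x))"
        by (intro Bochner_Integration.integrable_sum integrable_mult_right ie)
      have "integrable T3 (\<lambda>x. (\<Sum>l\<in>F. c l * (efun l x * h x)) - ((\<Sum>l\<in>F. c l * efun l x) - tser c x) * h x)"
        by (intro Bochner_Integration.integrable_diff iF ib)
      then have it: "integrable T3 (\<lambda>x. tser c x * h x)"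
        by (simp add: algebra_simps sum_distrib_left)
      have "(\<Sum>l\<in>F. c l * (\<integral>x. efun l x * h x \<partial>T3)) = (\<integral>x. (\<Sum>l\<in>F. c l * (efun l x * h x)) \<partial>T3)"
        by (subst Bochner_Integration.integral_sum) (auto intro!: integrable_mult_right ie)
      then have "(\<Sum>l\<in>F. c l * (\<integral>x. efun l x * h x \<partial>T3)) - ?I = (\<integral>x. (\<Sum>l\<in>F. c l * (efun l x * h x)) - tser c x * h x \<partial>T3)"
        using Bochner_Integration.integral_diff[OF iF it] by simp
      also have "\<dots> = (\<integral>x. ((\<Sum>l\<in>F. c l * efun l x) - tser c x) * h x \<partial>T3)"
        by (simp add: algebra_simps sum_distrib_left)
      also have "norm \<dots> \<le> (\<integral>x. norm (((\<Sum>l\<in>F. c l * efun l x) - tser c x) * h x) \<partial>T3)"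
        by (rule integral_norm_bound)
      also have "\<dots> \<le> (\<integral>x. (?s - (\<Sum>l\<in>F. norm (c l))) * norm (h x) \<partial>T3)"
        by (intro integral_mono integrable_norm ib integrable_mult_right h)
           (auto simp only: norm_mult intro!: mult_right_mono tail norm_ge_zero)
      finally show "norm ((\<Sum>l\<in>F. c l * (\<integral>x. efun l x * h x \<partial>T3)) - ?I)
        \<le> (?s - (\<Sum>l\<in>F. norm (c l))) * (\<integral>x. norm (h x) \<partial>T3)" by simp
    qed
  qed
  then show ?thesis
    unfolding has_sum_def by (rule LIM_zero_cancel)
qed

lemma coef_tser:
  assumes "rapid c" shows "coef (tser c) l = c l"
proof -
  have "((\<lambda>k. c k * (\<integral>x. efun k x * efun (- l) x \<partial>T3)) has_sum coef (tser c) l) UNIV"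
    unfolding coef_def
    by (intro integral_tser_has_sum assms integrable_T3_continuous continuous_efun)
  moreover have "c k * (\<integral>x. efun k x * efun (- l) x \<partial>T3) = (if k = l then c l else 0)" for k
  proof -
    have "(\<integral>x. efun k x * efun (- l) x \<partial>T3) = (\<integral>x. efun (k + - l) x \<partial>T3)"
      by (simp only: efun_add)
    then show ?thesis unfolding integral_efun by simp
  qed
  moreover have "((\<lambda>k. if k = l then c l else 0) has_sum c l) UNIV"
    by (rule has_sum_finite_neutralI[where B = "{l}"]) auto
  ultimately show ?thesis by (simp add: has_sum_unique)
qed


section \<open>Fourier inversion\<close>

text \<open>Trigonometric polynomials, generated so that closure under products follows by induction from
  the multiplicativity of characters.\<close>

inductive trig :: "(real^3 \<Rightarrow> complex) \<Rightarrow> bool" where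
  mono: "trig (\<lambda>x. a * efun k x)"
| add: "trig f \<Longrightarrow> trig g \<Longrightarrow> trig (\<lambda>x. f x + g x)"

lemma trig_const: "trig (\<lambda>x. a)"
  using trig.mono[of a 0] by simp

lemma trig_mono_mult: "trig g \<Longrightarrow> trig (\<lambda>x. a * efun k x * g x)"
proof (induction rule: trig.induct)
  case (mono b l)
  have "(\<lambda>x. a * efun k x * (b * efun l x)) = (\<lambda>x. a * b * efun (k + l) x)"
    by (simp add: efun_add mult_ac)
  then show ?case by (simp only: trig.mono)
next
  case (add f g)
  then show ?case by (simp add: distrib_left trig.add)
qed

lemma trig_mult: "trig f \<Longrightarrow> trig g \<Longrightarrow> trig (\<lambda>x. f x * g x)"
  by (induction rule: trig.induct) (simp_all add: trig_mono_mult distrib_right trig.add)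

lemma continuous_trig: "trig f \<Longrightarrow> continuous_on UNIV f"
  by (induction rule: trig.induct) (intro continuous_intros continuous_efun; assumption)+

lemma integral_mult_trig_eq_0:
  assumes f: "continuous_on UNIV f" and c: "\<And>l. coef f l = 0" and "trig p"
  shows "(\<integral>x. f x * p x \<partial>T3) = 0"
  using assms(3)
proof (induction rule: trig.induct)
  case (mono a k)
  have "(\<integral>x. f x * (a * efun k x) \<partial>T3) = (\<integral>x. a * (f x * efun k x) \<partial>T3)"
    by (simp add: mult_ac)
  also have "\<dots> = a * coef f (- k)"
    by (simp add: coef_def)
  finally show ?case by (simp add: c)
next
  case (add p q)
  have "integrable T3 (\<lambda>x. f x * p x)" "integrable T3 (\<lambda>x. f x * q x)"
    by (intro integrable_T3_continuous continuous_on_mult f continuous_trig add.hyps)+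
  with add.IH show ?case by (simp add: distrib_left)
qed

text \<open>Embeds the torus as a compact subset of \<open>\<complex>\<^sup>3\<close>. Continuous periodic functions become continuous
  functions there, which is the setting of the Stone-Weierstrass theorem.\<close>

definition torus_map :: "real^3 \<Rightarrow> complex^3" where
  "torus_map x = (\<chi> i. efun (axis i 1) x)"

lemma torus_map_nth: "torus_map x $ i = efun (axis i 1) x"
  by (simp add: torus_map_def)

lemma lat_axis: "lat (axis i 1) = axis i 1"
  by (simp add: vec_eq_iff axis_def)

lemma torus_map_periodic: "torus_map (x + lat k) = torus_map x"
  using periodic_efun by (simp add: periodic_def torus_map_def)

lemma torus_map_eqD:
  assumes "torus_map x = torus_map y"
  obtains k where "x = y + lat k"
proof -
  have "\<exists>n::int. x $ i = y $ i + of_int n" for i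
  proof -
    have "efun (axis i 1) x = efun (axis i 1) y"
      using assms by (metis torus_map_nth)
    then have "exp (2 * complex_of_real pi * \<i> * complex_of_real (x $ i)) = exp (2 * complex_of_real pi * \<i> * complex_of_real (y $ i))"
      by (simp add: efun_def lat_axis inner_axis')
    then obtain n :: int where
      "2 * complex_of_real pi * \<i> * complex_of_real (x $ i) = 2 * complex_of_real pi * \<i> * complex_of_real (y $ i) + (of_int (2 * n) * pi) * \<i>"
      unfolding exp_eq by blast
    from arg_cong[OF this, of Im] have "2 * pi * x $ i = 2 * pi * (y $ i + of_int n)"
      by (simp add: algebra_simps)
    then show ?thesis by (intro exI[of _ n]) simp
  qed
  then obtain n where "\<And>i. x $ i = y $ i + of_int (n i)" by metis
  then have "x = y + lat (\<chi> i. n i)" by (simp add: vec_eq_iff)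
  then show ?thesis by (rule that)
qed

lemma continuous_torus_map: "continuous_on A torus_map"
  unfolding torus_map_def
  by (intro continuous_on_vec_lambda continuous_on_subset[OF continuous_efun]) auto

lemma range_torus_map: "range torus_map = torus_map ` cbox 0 1"
proof -
  have "torus_map x \<in> torus_map ` cbox 0 1" for x
    by (rule unit_cube_representative[of x]) (simp add: torus_map_periodic)
  then show ?thesis by auto
qed

lemma compact_torus: "compact (range torus_map)"
  unfolding range_torus_map by (intro compact_continuous_image continuous_torus_map compact_cbox)

text \<open>The factor is continuous because the preimage of a closed set is the image under
  \<open>torus_map\<close> of a compact part of the cube.\<close>

lemma periodic_factor:
  fixes u :: "real^3 \<Rightarrow> real"
  assumes cont: "continuous_on UNIV u" and per: "periodic u"
  obtains F where "continuous_on (range torus_map) F" "\<And>x. F (torus_map x) = u x"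
proof -
  define F where "F z = u (SOME x. torus_map x = z)" for z
  have F: "F (torus_map x) = u x" for x
  proof -
    have "torus_map (SOME y. torus_map y = torus_map x) = torus_map x"
      by (rule someI) simp
    then obtain k where "(SOME y. torus_map y = torus_map x) = x + lat k"
      by (rule torus_map_eqD)
    with per show ?thesis by (simp add: F_def periodic_def)
  qed
  have "continuous_on (range torus_map) F"
    unfolding continuous_on_closed_vimage[OF compact_imp_closed[OF compact_torus]]
  proof (intro allI impI)
    fix B :: "real set" assume "closed B"
    have "F -` B \<inter> range torus_map = torus_map ` (cbox 0 1 \<inter> u -` B)"
    proof (intro equalityI subsetI)
      fix z assume z: "z \<in> F -` B \<inter> range torus_map"
      then obtain x where x: "x \<in> cbox 0 1" "z = torus_map x" unfolding range_torus_map by auto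
      with z show "z \<in> torus_map ` (cbox 0 1 \<inter> u -` B)" by (auto simp: F)
    qed (auto simp: F)
    moreover have "closed (u -` B)"
      using cont \<open>closed B\<close> by (simp add: continuous_on_closed_vimage)
    ultimately show "closed (F -` B \<inter> range torus_map)"
      by (auto intro!: compact_imp_closed compact_continuous_image continuous_torus_map compact_Int_closed)
  qed
  with F show ?thesis by (rule that[rotated])
qed

text \<open>Stone-Weierstrass for the algebra of functions on the embedded torus whose pullback is a
  trigonometric polynomial. The real and imaginary parts of the coordinates belong to it and
  separate points.\<close>

lemma trig_approximation:
  fixes u :: "real^3 \<Rightarrow> real"
  assumes cont: "continuous_on UNIV u" and per: "periodic u" and e: "e > 0"
  obtains p where "trig p" "\<And>x. norm (complex_of_real (u x) - p x) < e"
proof -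
  obtain F where F: "continuous_on (range torus_map) F" "\<And>x. F (torus_map x) = u x"
    using periodic_factor[OF cont per] by blast
  define P where "P G \<longleftrightarrow> continuous_on (range torus_map) G \<and> trig (\<lambda>x. complex_of_real (G (torus_map x)))" for G
  have "\<exists>G. P G \<and> (\<forall>z\<in>range torus_map. \<bar>F z - G z\<bar> < e)"
  proof (rule Stone_Weierstrass_HOL[OF compact_torus _ _ _ _ _ F(1) e])
    show "P (\<lambda>x. c)" for c by (simp add: P_def trig_const)
    show "continuous_on (range torus_map) G" if "P G" for G using that by (simp add: P_def)
    show "P (\<lambda>x. G x + G' x)" if "P G \<and> P G'" for G G'
      using that by (auto simp: P_def intro!: continuous_intros trig.add)
    show "P (\<lambda>x. G x * G' x)" if "P G \<and> P G'" for G G'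
      using that by (auto simp: P_def intro!: continuous_intros trig_mult)
    fix z w :: "complex^3" assume "z \<in> range torus_map \<and> w \<in> range torus_map \<and> z \<noteq> w"
    then obtain i where i: "z $ i \<noteq> w $ i" by (auto simp: vec_eq_iff)
    \<comment> \<open>the coordinate functions as combinations of a character and its conjugate\<close>
    have eR: "complex_of_real (Re (efun k x)) = 1/2 * efun k x + 1/2 * efun (- k) x" for k x
      by (simp add: efun_minus complex_eq_iff)
    have eI: "complex_of_real (Im (efun k x)) = (- \<i>/2) * efun k x + (\<i>/2) * efun (- k) x" for k x
      by (simp add: efun_minus complex_eq_iff)
    have "P (\<lambda>z. Re (z $ i))" "P (\<lambda>z. Im (z $ i))"
      unfolding P_def torus_map_nth eR eI by (intro conjI continuous_intros trig.add trig.mono)+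
    moreover have "Re (z $ i) \<noteq> Re (w $ i) \<or> Im (z $ i) \<noteq> Im (w $ i)"
      using i by (simp add: complex_eq_iff)
    ultimately show "\<exists>f. P f \<and> f z \<noteq> f w" by blast
  qed
  then obtain G where G: "P G" "\<And>z. z \<in> range torus_map \<Longrightarrow> \<bar>F z - G z\<bar> < e" by blast
  show ?thesis
  proof
    show "trig (\<lambda>x. complex_of_real (G (torus_map x)))" using G(1) by (simp add: P_def)
    show "norm (complex_of_real (u x) - complex_of_real (G (torus_map x))) < e" for x
      using G(2)[of "torus_map x"] by (simp add: F(2) norm_of_real flip: of_real_diff)
  qed
qed

text \<open>A function without Fourier coefficients is orthogonal to trigonometric polynomials, hence to
  their uniform limits.\<close>

lemma integral_mult_real_eq_0:
  fixes u :: "real^3 \<Rightarrow> real"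
  assumes f: "continuous_on UNIV f" "periodic f" and c: "\<And>l. coef f l = 0"
    and u: "continuous_on UNIV u" "periodic u"
  shows "(\<integral>x. f x * complex_of_real (u x) \<partial>T3) = 0"
proof -
  obtain M where M: "\<And>x. norm (f x) \<le> M" using periodic_bounded[OF f] by blast
  have "norm (\<integral>x. f x * complex_of_real (u x) \<partial>T3) \<le> 0 + e" if "e > 0" for e
  proof -
    have M0: "0 \<le> M" using order_trans[OF norm_ge_zero M] .
    define d where "d = e / (M + 1)"
    have d: "d > 0" using \<open>e > 0\<close> M0 by (simp add: d_def)
    obtain p where p: "trig p" "\<And>x. norm (complex_of_real (u x) - p x) < d"
      using trig_approximation[OF u d] by blast
    have i: "integrable T3 (\<lambda>x. f x * complex_of_real (u x))" "integrable T3 (\<lambda>x. f x * p x)"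
      by (intro integrable_T3_continuous continuous_on_mult continuous_on_of_real f u continuous_trig[OF p(1)])+
    have "(\<integral>x. f x * complex_of_real (u x) \<partial>T3) = (\<integral>x. f x * complex_of_real (u x) - f x * p x \<partial>T3)"
      using integral_mult_trig_eq_0[OF f(1) c p(1)] by (simp add: Bochner_Integration.integral_diff[OF i])
    also have "norm \<dots> \<le> M * d"
    proof (rule norm_integral_T3_le)
      fix x
      have "norm (f x * (complex_of_real (u x) - p x)) \<le> M * d"
        unfolding norm_mult by (intro mult_mono M less_imp_le[OF p(2)] M0) simp
      then show "norm (f x * complex_of_real (u x) - f x * p x) \<le> M * d"
        by (simp only: right_diff_distrib)
    qed
    also have "M * d \<le> e" using \<open>e > 0\<close> M0 by (simp add: d_def field_simps)
    finally show ?thesis by simp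
  qed
  then have "norm (\<integral>x. f x * complex_of_real (u x) \<partial>T3) \<le> 0" by (rule field_le_epsilon)
  then show ?thesis by simp
qed

lemma integral_T3_eq_0_imp:
  fixes g :: "real^3 \<Rightarrow> real"
  assumes g: "continuous_on UNIV g" "periodic g" "\<And>x. 0 \<le> g x" and i: "(\<integral>x. g x \<partial>T3) = 0"
  shows "g x = 0"
proof -
  have si: "set_integrable lborel (cbox 0 1) g"
    using integrable_T3_continuous[OF g(1)] unfolding T3_def set_integrable_def
    by (subst (asm) integrable_restrict_space) simp_all
  have "(LINT x : cbox 0 1 | lborel. g x) = (\<integral>x. g x \<partial>T3)"
    unfolding T3_def set_lebesgue_integral_def by (rule integral_restrict_space[symmetric]) simp
  with i set_borel_integral_eq_integral[OF si] have "(g has_integral 0) (cbox 0 1)"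
    by (metis integrable_integral)
  moreover have "box 0 (1::real^3) \<noteq> {}"
    using content_unit_cube(2) by (metis emeasure_empty zero_neq_one)
  ultimately have *: "g y = 0" if "y \<in> cbox 0 1" for y
    using has_integral_0_cbox_imp_0[of 0 1 g y] continuous_on_subset[OF g(1)] g(3) that by blast
  obtain y k where "y \<in> cbox 0 1" "x = y + lat k" by (rule unit_cube_representative)
  with * g(2) show ?thesis by (simp add: periodic_def)
qed

text \<open>Testing \<open>f\<close> against its own real and imaginary parts yields \<open>\<integral> |f|\<^sup>2 = 0\<close>.\<close>

theorem zero_coef_imp_zero:
  assumes f: "continuous_on UNIV f" "periodic f" and c: "\<And>l. coef f l = 0"
  shows "f x = 0"
proof -
  have per: "periodic (\<lambda>x. Re (f x))" "periodic (\<lambda>x. Im (f x))" "periodic (\<lambda>x. (norm (f x))\<^sup>2)"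
    using f(2) by (simp_all add: periodic_def)
  have z: "(\<integral>x. f x * complex_of_real (Re (f x)) \<partial>T3) = 0" "(\<integral>x. f x * complex_of_real (Im (f x)) \<partial>T3) = 0"
    by (intro integral_mult_real_eq_0 f c per continuous_intros)+
  have i: "integrable T3 (\<lambda>x. f x * complex_of_real (Re (f x)))" "integrable T3 (\<lambda>x. \<i> * (f x * complex_of_real (Im (f x))))"
    by (intro integrable_T3_continuous continuous_intros f)+
  have "f x * complex_of_real (Re (f x)) - \<i> * (f x * complex_of_real (Im (f x))) = complex_of_real ((norm (f x))\<^sup>2)" for x
    by (subst complex_norm_square) (simp add: complex_eq_iff)
  then have "(\<integral>x. complex_of_real ((norm (f x))\<^sup>2) \<partial>T3) = 0"
    using Bochner_Integration.integral_diff[OF i] z by simp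
  then have "complex_of_real (\<integral>x. (norm (f x))\<^sup>2 \<partial>T3) = 0"
    by (simp only: integral_complex_of_real)
  then have "(\<integral>x. (norm (f x))\<^sup>2 \<partial>T3) = 0" by simp
  moreover have "continuous_on UNIV (\<lambda>x. (norm (f x))\<^sup>2)"
    by (intro continuous_intros f)
  ultimately have "(norm (f x))\<^sup>2 = 0"
    by (intro integral_T3_eq_0_imp[OF _ per(3)]) simp_all
  then show ?thesis by simp
qed

lemma summable_on_inverse_square_int: "(\<lambda>m::int. 1 / (1 + (real_of_int m)\<^sup>2)) summable_on UNIV"
proof -
  let ?g = "\<lambda>m::int. 1 / (1 + (real_of_int m)\<^sup>2)"
  have "summable (\<lambda>n. 1 / (1 + (real n)\<^sup>2))"
  proof (rule summable_comparison_test_ev)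
    show "summable (\<lambda>n. inverse ((real n)\<^sup>2))" by (rule inverse_power_summable) simp
    show "\<forall>\<^sub>F n in sequentially. norm (1 / (1 + (real n)\<^sup>2)) \<le> inverse ((real n)\<^sup>2)"
      using eventually_gt_at_top[of 0] by eventually_elim (simp add: divide_simps add_pos_nonneg)
  qed
  then have s: "(\<lambda>n. 1 / (1 + (real n)\<^sup>2)) summable_on UNIV"
    by (rule summable_nonneg_imp_summable_on) simp
  have "?g summable_on (int ` UNIV)" "?g summable_on ((\<lambda>n. - int n) ` UNIV)"
    using s by (subst summable_on_reindex; simp add: inj_on_def o_def)+
  then have "?g summable_on (int ` UNIV \<union> (\<lambda>n. - int n) ` UNIV)" by (rule summable_on_union)
  moreover have "int ` UNIV \<union> (\<lambda>n. - int n) ` UNIV = UNIV"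
  proof -
    have "m \<in> int ` UNIV \<union> (\<lambda>n. - int n) ` UNIV" for m :: int
      by (cases m rule: int_cases2) auto
    then show ?thesis by auto
  qed
  ultimately show ?thesis by simp
qed

text \<open>A finite set of frequencies lies in a box, over which the sum factorizes into
  one-dimensional sums.\<close>

lemma summable_on_prod_inverse_squares: "(\<lambda>l::int^3. \<Prod>i\<in>UNIV. 1 / (1 + (real_of_int (l $ i))\<^sup>2)) summable_on UNIV"
proof (rule nonneg_bdd_above_summable_on)
  let ?g = "\<lambda>m::int. 1 / (1 + (real_of_int m)\<^sup>2)"
  show "0 \<le> (\<Prod>i\<in>UNIV. ?g (l $ i))" for l :: "int^3" by (intro prod_nonneg) simp
  have "(\<Sum>l\<in>S. \<Prod>i\<in>UNIV. ?g (l $ i)) \<le> (\<Prod>i\<in>(UNIV::3 set). (\<Sum>\<^sub>\<infinity>m. ?g m))" if "finite S" for S :: "(int^3) set"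
  proof -
    define A where "A = (\<Union>i. (\<lambda>l. l $ i) ` S)"
    have A: "finite A" using that by (simp add: A_def)
    have "(\<Sum>l\<in>S. \<Prod>i\<in>UNIV. ?g (l $ i)) = (\<Sum>h\<in>($) ` S. \<Prod>i\<in>UNIV. ?g (h i))"
      by (subst sum.reindex) (auto simp: inj_on_def vec_eq_iff)
    also have "\<dots> \<le> (\<Sum>h\<in>PiE UNIV (\<lambda>_::3. A). \<Prod>i\<in>UNIV. ?g (h i))"
      by (intro sum_mono2 finite_PiE A prod_nonneg) (auto simp: A_def)
    also have "\<dots> = (\<Prod>i\<in>(UNIV::3 set). \<Sum>m\<in>A. ?g m)"
      by (rule prod_sum_PiE[symmetric]) (simp_all add: A)
    also have "\<dots> \<le> (\<Prod>i\<in>(UNIV::3 set). (\<Sum>\<^sub>\<infinity>m. ?g m))"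
      by (intro prod_mono conjI sum_nonneg finite_sum_le_infsum summable_on_inverse_square_int A) auto
    finally show ?thesis .
  qed
  then show "bdd_above (sum (\<lambda>l::int^3. \<Prod>i\<in>UNIV. ?g (l $ i)) ` {F. F \<subseteq> UNIV \<and> finite F})"
    by (intro bdd_aboveI2) auto
qed

lemma weight_eq: "1 + (norm (lat l))\<^sup>2 = 1 + (\<Sum>i\<in>UNIV. (real_of_int (l $ i))\<^sup>2)"
  by (simp add: norm_vec_def L2_set_def sum_nonneg)

text \<open>The weight is at most four times the largest of \<open>1\<close> and the \<open>l\<^sub>i\<^sup>2\<close>. Bounds on pure powers of single
  coordinates therefore suffice, and these come from derivatives in one direction.\<close>

lemma weight_power_le:
  "(1 + (norm (lat l))\<^sup>2) ^ q \<le> 4 ^ q * (1 + (\<Sum>i\<in>UNIV. \<bar>real_of_int (l $ i)\<bar> ^ (2 * q)))"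
proof -
  define a where "a i = (real_of_int (l $ i))\<^sup>2" for i
  define m where "m = Max (insert 1 (range a))"
  have a: "a i \<le> m" "0 \<le> a i" for i
    unfolding m_def by (rule Max_ge) (simp_all add: a_def)
  have m1: "1 \<le> m" unfolding m_def by (rule Max_ge) simp_all
  have mem: "m \<in> insert 1 (range a)" unfolding m_def by (rule Max_in) auto
  have "(\<Sum>i\<in>UNIV. a i) \<le> of_nat (card (UNIV :: 3 set)) * m"
    by (rule sum_bounded_above) (rule a)
  with m1 have "1 + (norm (lat l))\<^sup>2 \<le> 4 * m" unfolding weight_eq a_def[symmetric] by simp
  then have pw: "(1 + (norm (lat l))\<^sup>2) ^ q \<le> (4 * m) ^ q" by (rule power_mono) simp
  have "m ^ q \<le> 1 + (\<Sum>i\<in>UNIV. a i ^ q)"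
  proof (cases "m = 1")
    case True
    then show ?thesis by (simp add: sum_nonneg a)
  next
    case False
    with mem obtain i where "m = a i" by auto
    moreover have "a i ^ q \<le> (\<Sum>i\<in>UNIV. a i ^ q)"
      by (rule member_le_sum) (simp_all add: a)
    ultimately show ?thesis by simp
  qed
  then have "4 ^ q * m ^ q \<le> 4 ^ q * (1 + (\<Sum>i\<in>UNIV. a i ^ q))"
    by (intro mult_left_mono) simp_all
  with pw have "(1 + (norm (lat l))\<^sup>2) ^ q \<le> 4 ^ q * (1 + (\<Sum>i\<in>UNIV. a i ^ q))"
    unfolding power_mult_distrib by (rule order_trans)
  moreover have "a i ^ q = \<bar>real_of_int (l $ i)\<bar> ^ (2 * q)" for i
    by (simp add: a_def power_mult)
  ultimately show ?thesis by simp
qed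

lemma smooth_pd: "smooth_T3 f \<Longrightarrow> smooth_T3 (pd j f)"
  unfolding smooth_T3_def using periodic_pd Ck.simps(2) by blast

lemma smooth_differentiable: "smooth_T3 f \<Longrightarrow> f differentiable (at x)"
  unfolding smooth_T3_def using Ck.simps(2) by blast

lemma smooth_continuous: "smooth_T3 f \<Longrightarrow> continuous_on UNIV f"
  unfolding smooth_T3_def using Ck.simps(1) by blast

lemma smooth_periodic: "smooth_T3 f \<Longrightarrow> periodic f"
  by (simp add: smooth_T3_def)

lemma coef_pd_smooth:
  "smooth_T3 f \<Longrightarrow> coef (pd j f) l = 2 * complex_of_real pi * \<i> * of_int (l $ j) * coef f l"
  by (intro coef_pd smooth_differentiable smooth_continuous smooth_pd smooth_periodic)

text \<open>The \<open>n\<close>-th derivative in direction \<open>j\<close> multiplies the coefficients by \<open>(2 \<pi> i l\<^sub>j)\<^sup>n\<close> and is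
  bounded.\<close>

lemma coef_decay:
  assumes "smooth_T3 f"
  obtains B where "\<And>l. \<bar>real_of_int (l $ j)\<bar> ^ n * norm (coef f l) \<le> B"
proof -
  have sm: "smooth_T3 ((pd j ^^ m) f)" for m
    by (induction m) (simp_all add: assms smooth_pd)
  have eq: "coef ((pd j ^^ m) f) l = (2 * complex_of_real pi * \<i> * of_int (l $ j)) ^ m * coef f l" for m l
    by (induction m) (simp_all add: coef_pd_smooth[OF sm])
  obtain B where B: "\<And>x. norm ((pd j ^^ n) f x) \<le> B"
    using periodic_bounded[OF smooth_continuous[OF sm] smooth_periodic[OF sm]] by blast
  have "\<bar>real_of_int (l $ j)\<bar> ^ n * norm (coef f l) \<le> B" for l
  proof -
    have "1 \<le> 2 * pi" using pi_gt3 by linarith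
    then have "\<bar>real_of_int (l $ j)\<bar> \<le> 2 * pi * \<bar>real_of_int (l $ j)\<bar>"
      using mult_right_mono[of 1 "2 * pi" "\<bar>real_of_int (l $ j)\<bar>"] by simp
    then have "\<bar>real_of_int (l $ j)\<bar> ^ n * norm (coef f l) \<le> (2 * pi * \<bar>real_of_int (l $ j)\<bar>) ^ n * norm (coef f l)"
      by (intro mult_right_mono power_mono) auto
    also have "\<dots> = norm (coef ((pd j ^^ n) f) l)"
      by (simp add: eq norm_mult norm_power)
    also have "\<dots> \<le> B"
      unfolding coef_def by (rule norm_integral_T3_le) (simp add: norm_mult B)
    finally show ?thesis .
  qed
  then show ?thesis by (rule that)
qed

text \<open>Three additional powers of the weight dominate \<open>\<Prod>i. 1 + l\<^sub>i\<^sup>2\<close> and thereby buy summability.\<close>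

lemma rapid_coef:
  assumes f: "smooth_T3 f"
  shows "rapid (coef f)"
  unfolding rapid_def
proof
  fix p
  have "\<forall>j. \<exists>B. \<forall>l. \<bar>real_of_int (l $ j)\<bar> ^ (2 * (p + 3)) * norm (coef f l) \<le> B"
    using coef_decay[OF f] by metis
  then obtain B where B: "\<And>j l. \<bar>real_of_int (l $ j)\<bar> ^ (2 * (p + 3)) * norm (coef f l) \<le> B j" by metis
  obtain B0 where B0: "\<And>l. \<bar>real_of_int (l $ 1)\<bar> ^ 0 * norm (coef f l) \<le> B0"
    using coef_decay[OF f, of 1 0] by blast
  define K where "K = 4 ^ (p + 3) * (B0 + (\<Sum>j\<in>UNIV. B j))"
  have "(\<lambda>l::int^3. K * (\<Prod>i\<in>UNIV. 1 / (1 + (real_of_int (l $ i))\<^sup>2))) summable_on UNIV"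
    by (intro summable_on_cmult_right summable_on_prod_inverse_squares)
  then show "(\<lambda>l. (1 + (norm (lat l))\<^sup>2) ^ p * norm (coef f l)) summable_on UNIV"
  proof (rule summable_on_comparison_test)
    fix l :: "int^3"
    let ?W = "1 + (norm (lat l))\<^sup>2" and ?Q = "\<Prod>i\<in>UNIV. 1 + (real_of_int (l $ i))\<^sup>2"
    have Q: "0 < ?Q" by (intro prod_pos) (simp add: add_pos_nonneg)
    have "?Q \<le> (\<Prod>i\<in>(UNIV :: 3 set). ?W)"
      unfolding weight_eq by (intro prod_mono conjI add_left_mono member_le_sum) auto
    then have "?Q \<le> ?W ^ 3" by simp
    then have "?W ^ p * norm (coef f l) * ?Q \<le> ?W ^ p * norm (coef f l) * ?W ^ 3"
      by (intro mult_left_mono) auto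
    also have "\<dots> = ?W ^ (p + 3) * norm (coef f l)" by (simp add: power_add)
    also have "\<dots> \<le> (4 ^ (p + 3) * (1 + (\<Sum>i\<in>UNIV. \<bar>real_of_int (l $ i)\<bar> ^ (2 * (p + 3))))) * norm (coef f l)"
      by (intro mult_right_mono weight_power_le) simp
    also have "\<dots> = 4 ^ (p + 3) * (norm (coef f l) + (\<Sum>i\<in>UNIV. \<bar>real_of_int (l $ i)\<bar> ^ (2 * (p + 3)) * norm (coef f l)))"
      by (simp only: ring_distribs mult.assoc sum_distrib_right mult_1)
    also have "\<dots> \<le> K"
      unfolding K_def using B0[of l] by (intro mult_left_mono add_mono sum_mono B) simp_all
    finally have "?W ^ p * norm (coef f l) \<le> K / ?Q"
      using Q by (simp only: pos_le_divide_eq)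
    then show "?W ^ p * norm (coef f l) \<le> K * (\<Prod>i\<in>UNIV. 1 / (1 + (real_of_int (l $ i))\<^sup>2))"
      by (simp add: prod_dividef)
  qed simp
qed

text \<open>A function and the sum of its Fourier series have the same coefficients.\<close>

theorem fourier_inversion:
  assumes f: "smooth_T3 f"
  shows "f = tser (coef f)"
proof
  fix x
  note c = rapid_coef[OF f]
  have "f x - tser (coef f) x = 0"
  proof (rule zero_coef_imp_zero)
    show "continuous_on UNIV (\<lambda>x. f x - tser (coef f) x)"
      by (intro continuous_intros smooth_continuous f continuous_tser c)
    show "periodic (\<lambda>x. f x - tser (coef f) x)"
      using smooth_periodic[OF f] periodic_tser[of "coef f"] by (simp add: periodic_def)
    fix l
    have i: "integrable T3 (\<lambda>x. f x * efun (- l) x)" "integrable T3 (\<lambda>x. tser (coef f) x * efun (- l) x)"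
      by (intro integrable_T3_continuous continuous_intros smooth_continuous f continuous_tser c continuous_efun)+
    have "coef (\<lambda>x. f x - tser (coef f) x) l = coef f l - coef (tser (coef f)) l"
      using Bochner_Integration.integral_diff[OF i] by (simp only: coef_def[of _ l] left_diff_distrib)
    then show "coef (\<lambda>x. f x - tser (coef f) x) l = 0"
      by (simp add: coef_tser c)
  qed
  then show "f x = tser (coef f) x" by simp
qed


section \<open>The Leray projection of a Fourier series\<close>

definition fser :: "(int^3 \<Rightarrow> complex^3) \<Rightarrow> real^3 \<Rightarrow> complex^3" where
  "fser c x = (\<chi> i. tser (\<lambda>l. c l $ i) x)"

definition vrapid :: "(int^3 \<Rightarrow> complex^3) \<Rightarrow> bool" where
  "vrapid c \<longleftrightarrow> (\<forall>i. rapid (\<lambda>l. c l $ i))"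

lemma fser_nth: "fser c x $ i = tser (\<lambda>l. c l $ i) x"
  by (simp add: fser_def)

lemma vrapidD: "vrapid c \<Longrightarrow> rapid (\<lambda>l. c l $ i)"
  by (simp add: vrapid_def)

lemma continuous_fser: "vrapid c \<Longrightarrow> continuous_on UNIV (fser c)"
  unfolding fser_def by (intro continuous_on_vec_lambda continuous_tser vrapidD)

lemma periodic_fser: "periodic (fser c)"
  using periodic_tser by (simp add: periodic_def fser_def)

lemma has_derivative_vec_componentwise:
  fixes f :: "'a::real_normed_vector \<Rightarrow> 'b::real_normed_vector^'n"
  assumes "\<And>i. ((\<lambda>x. f x $ i) has_derivative (\<lambda>h. D h $ i)) F"
  shows "(f has_derivative D) F"
proof -
  have bl: "bounded_linear (axis i :: 'b \<Rightarrow> 'b^'n)" for i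
  proof (rule bounded_linear_intro[where K = 1])
    fix x :: 'b
    have "norm (axis i x :: 'b^'n) \<le> (\<Sum>k\<in>UNIV. norm ((axis i x :: 'b^'n) $ k))"
      unfolding norm_vec_def by (rule L2_set_le_sum) simp
    also have "\<dots> = (\<Sum>k\<in>UNIV. if k = i then norm x else 0)"
      by (rule sum.cong) (simp_all add: axis_def)
    finally show "norm (axis i x :: 'b^'n) \<le> norm x * 1" by simp
  qed (simp_all add: axis_def vec_eq_iff)
  have "((\<lambda>x. \<Sum>i\<in>UNIV. axis i (f x $ i)) has_derivative (\<lambda>h. \<Sum>i\<in>UNIV. axis i (D h $ i))) F"
    by (rule has_derivative_sum, rule bounded_linear.has_derivative[OF bl], rule assms)
  moreover have "(\<Sum>i\<in>UNIV. axis i (v $ i)) = v" for v :: "'b^'n"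
    by (simp add: vec_eq_iff axis_def)
  ultimately show ?thesis by simp
qed

lemma pd_nth:
  fixes f :: "real^3 \<Rightarrow> 'b::real_normed_vector^'n"
  assumes "\<And>i. (\<lambda>x. f x $ i) differentiable (at x)"
  shows "pd j f x $ i = pd j (\<lambda>x. f x $ i) x"
proof -
  have "(f has_derivative (\<lambda>h. \<chi> i. frechet_derivative (\<lambda>x. f x $ i) (at x) h)) (at x)"
    by (rule has_derivative_vec_componentwise) (simp add: has_derivative_pd assms)
  from pd_eqI[OF this] show ?thesis by (simp add: pd_def)
qed

lemma pd_fser:
  assumes "vrapid c"
  shows "pd j (fser c) x $ i = tser (\<lambda>l. 2 * complex_of_real pi * \<i> * of_int (l $ j) * c l $ i) x"
proof -
  have "(\<lambda>x. fser c x $ i) = tser (\<lambda>l. c l $ i)" for i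
    by (rule ext) (rule fser_nth)
  moreover have "tser (\<lambda>l. c l $ i) differentiable (at x)" for i
    using has_derivative_tser[OF vrapidD[OF assms]] by (rule differentiableI)
  ultimately show ?thesis
    by (subst pd_nth) (simp_all add: pd_tser vrapidD[OF assms])
qed

text \<open>Entry of the orthogonal projection onto the complement of \<open>m\<close>. For \<open>m = 0\<close> the convention
  \<open>x / 0 = 0\<close> makes it the identity, which is how the Leray projection treats constant fields.\<close>

definition proj_entry :: "real^3 \<Rightarrow> 3 \<Rightarrow> 3 \<Rightarrow> real" where
  "proj_entry m i j = (if i = j then 1 else 0) - m $ i * m $ j / (norm m)\<^sup>2"

definition proj :: "real^3 \<Rightarrow> complex^3 \<Rightarrow> complex^3" where
  "proj m z = (\<chi> i. \<Sum>j\<in>UNIV. complex_of_real (proj_entry m i j) * z $ j)"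

text \<open>Bilinear, without conjugation: up to \<open>2 \<pi> i\<close> this is the divergence on the Fourier side.\<close>

definition cdot :: "real^3 \<Rightarrow> complex^3 \<Rightarrow> complex" where
  "cdot m z = (\<Sum>j\<in>UNIV. complex_of_real (m $ j) * z $ j)"

lemma sum_delta_entry:
  fixes z :: "complex^3"
  shows "(\<Sum>j\<in>UNIV. complex_of_real (if i = j then 1 else 0) * z $ j) = z $ i"
proof -
  have "(\<Sum>j\<in>UNIV. complex_of_real (if i = j then 1 else 0) * z $ j) = (\<Sum>j\<in>UNIV. if j = i then z $ j else 0)"
    by (rule sum.cong) auto
  then show ?thesis by simp
qed

lemma proj_nth: "proj m z $ i = z $ i - complex_of_real (m $ i / (norm m)\<^sup>2) * cdot m z"
proof -
  have "complex_of_real (d - m $ i * m $ j / (norm m)\<^sup>2) * w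
      = complex_of_real d * w - complex_of_real (m $ i / (norm m)\<^sup>2) * (complex_of_real (m $ j) * w)" for d j w
    by (simp add: left_diff_distrib)
  then have "proj m z $ i = (\<Sum>j\<in>UNIV. complex_of_real (if i = j then 1 else 0) * z $ j)
      - (\<Sum>j\<in>UNIV. complex_of_real (m $ i / (norm m)\<^sup>2) * (complex_of_real (m $ j) * z $ j))"
    by (simp only: proj_def proj_entry_def vec_lambda_beta sum_subtractf)
  then show ?thesis by (simp only: sum_delta_entry sum_distrib_left[symmetric] cdot_def)
qed

lemma abs_proj_entry_le: "\<bar>proj_entry m i j\<bar> \<le> 2"
proof -
  have "\<bar>m $ i * m $ j\<bar> \<le> norm m * norm m"
    unfolding abs_mult by (intro mult_mono component_le_norm_cart) auto
  then have "\<bar>m $ i * m $ j / (norm m)\<^sup>2\<bar> \<le> 1"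
    by (cases "m = 0") (simp_all add: abs_divide power2_eq_square)
  moreover have "\<bar>(if i = j then 1 else 0) - t\<bar> \<le> 2" if "\<bar>t\<bar> \<le> 1" for t :: real
    using that by auto
  ultimately show ?thesis unfolding proj_entry_def by blast
qed

lemma cdot_proj [simp]: "cdot m (proj m z) = 0"
proof -
  define q where "q = cdot m z"
  have "complex_of_real (m $ i) * (z $ i - complex_of_real (m $ i / (norm m)\<^sup>2) * q)
      = complex_of_real (m $ i) * z $ i - complex_of_real (m $ i * m $ i / (norm m)\<^sup>2) * q" for i
    by (simp add: right_diff_distrib)
  then have "cdot m (proj m z) = q - (\<Sum>i\<in>UNIV. complex_of_real (m $ i * m $ i / (norm m)\<^sup>2)) * q"
    by (simp only: cdot_def[of m "proj m z"] proj_nth q_def[symmetric] sum_subtractf sum_distrib_right)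
       (simp only: q_def cdot_def)
  also have "(\<Sum>i\<in>UNIV. complex_of_real (m $ i * m $ i / (norm m)\<^sup>2)) = complex_of_real (m \<bullet> m / (norm m)\<^sup>2)"
    by (simp add: inner_vec_def sum_divide_distrib)
  finally show ?thesis
    by (cases "m = 0") (simp_all add: q_def cdot_def flip: power2_norm_eq_inner)
qed

lemma proj_cmult: "proj m (s *s z) = s *s proj m z"
  by (simp add: proj_def vec_eq_iff sum_distrib_left mult_ac)

lemma proj_sum: "proj m (\<Sum>j\<in>J. z j) = (\<Sum>j\<in>J. proj m (z j))"
proof (unfold vec_eq_iff, intro allI)
  fix i
  have "proj m (\<Sum>j\<in>J. z j) $ i = (\<Sum>r\<in>UNIV. \<Sum>j\<in>J. complex_of_real (proj_entry m i r) * z j $ r)"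
    by (simp add: proj_def sum_distrib_left)
  also have "\<dots> = (\<Sum>j\<in>J. \<Sum>r\<in>UNIV. complex_of_real (proj_entry m i r) * z j $ r)"
    by (rule sum.swap)
  finally show "proj m (\<Sum>j\<in>J. z j) $ i = (\<Sum>j\<in>J. proj m (z j)) $ i"
    by (simp add: proj_def)
qed

lemma vrapid_proj: "vrapid c \<Longrightarrow> vrapid (\<lambda>l. proj (g l) (c l))"
  unfolding vrapid_def proj_def vec_lambda_beta
  by (intro allI rapid_sum rapid_mult_bounded[where C = 2 and q = 0]) (simp_all add: abs_proj_entry_le)

lemma L2_T3_continuous:
  fixes f :: "real^3 \<Rightarrow> 'b::real_normed_vector"
  assumes "continuous_on UNIV f" "periodic f"
  shows "f \<in> L2_T3"
  unfolding L2_T3_def mem_Collect_eq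
  by (intro conjI assms borel_measurable_continuous_onI integrable_T3_continuous continuous_on_power continuous_on_norm)

lemma L2_T3_component:
  fixes h :: "real^3 \<Rightarrow> complex^3"
  assumes "h \<in> L2_T3"
  shows "integrable T3 (\<lambda>x. h x $ i)"
proof -
  have m: "h \<in> borel_measurable borel" and i: "integrable T3 (\<lambda>x. (norm (h x))\<^sup>2)"
    using assms by (auto simp: L2_T3_def)
  have m': "(\<lambda>x. h x $ i) \<in> borel_measurable borel"
    by (rule measurable_compose[OF m, where g = "\<lambda>z. z $ i"])
       (intro borel_measurable_continuous_onI continuous_on_component continuous_on_id)
  have ae: "AE x in T3. norm (h x $ i) \<le> norm (1 + (norm (h x))\<^sup>2)"
  proof (rule AE_I2)
    fix x
    have "norm (h x $ i) \<le> norm (h x)" by (rule Finite_Cartesian_Product.norm_nth_le)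
    also have "\<dots> \<le> 1 + (norm (h x))\<^sup>2"
    proof -
      have "2 * norm (h x) \<le> 1 + (norm (h x))\<^sup>2"
        using sum_squares_bound[of 1 "norm (h x)"] by simp
      then show ?thesis using norm_ge_zero[of "h x"] by linarith
    qed
    finally show "norm (h x $ i) \<le> norm (1 + (norm (h x))\<^sup>2)" by simp
  qed
  have "integrable T3 (\<lambda>x. 1 + (norm (h x))\<^sup>2)" using i by simp
  from Bochner_Integration.integrable_bound[OF this borel_measurable_T3[OF m'] ae] show ?thesis .
qed

lemma has_sum_sum_3:
  fixes f :: "3 \<Rightarrow> 'a \<Rightarrow> complex"
  assumes "\<And>j. (f j has_sum s j) A"
  shows "((\<lambda>l. \<Sum>j\<in>UNIV. f j l) has_sum (\<Sum>j\<in>UNIV. s j)) A"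
  unfolding sum_3 by (intro has_sum_add assms)

text \<open>Paired with a test function, the \<open>l\<close>-th mode contributes \<open>l \<cdot> c\<^sub>l\<close> times the coefficient of the
  test function at \<open>- l\<close>.\<close>

lemma fser_div_free:
  assumes c: "vrapid c" and dot: "\<And>l. cdot (lat l) (c l) = 0"
  shows "fser c \<in> L2_div_free"
  unfolding L2_div_free_def mem_Collect_eq
proof (intro conjI allI impI)
  show "fser c \<in> L2_T3" by (intro L2_T3_continuous continuous_fser periodic_fser c)
  fix \<phi> :: "real^3 \<Rightarrow> complex" assume \<phi>: "smooth_T3 \<phi>"
  note cont = smooth_continuous[OF smooth_pd[OF \<phi>]]
  have hs: "((\<lambda>l. c l $ j * (\<integral>x. efun l x * pd j \<phi> x \<partial>T3)) has_sum (\<integral>x. fser c x $ j * pd j \<phi> x \<partial>T3)) UNIV" for j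
    unfolding fser_nth by (intro integral_tser_has_sum vrapidD[OF c] integrable_T3_continuous cont)
  have coef: "(\<integral>x. efun l x * pd j \<phi> x \<partial>T3) = complex_of_real (lat l $ j) * (- (2 * complex_of_real pi * \<i>) * coef \<phi> (- l))" for l j
    using coef_pd_smooth[OF \<phi>, of j "- l"] by (simp add: coef_def mult_ac)
  have "(\<Sum>j\<in>UNIV. c l $ j * (\<integral>x. efun l x * pd j \<phi> x \<partial>T3)) = cdot (lat l) (c l) * (- (2 * complex_of_real pi * \<i>) * coef \<phi> (- l))" for l
    unfolding coef cdot_def sum_distrib_right by (rule sum.cong) (simp_all only: mult_ac)
  then have "((\<lambda>l::int^3. 0) has_sum (\<Sum>j\<in>UNIV. \<integral>x. fser c x $ j * pd j \<phi> x \<partial>T3)) UNIV"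
    using has_sum_sum_3[of "\<lambda>j l. c l $ j * (\<integral>x. efun l x * pd j \<phi> x \<partial>T3)", OF hs] by (simp add: dot)
  then have "(\<Sum>j\<in>UNIV. \<integral>x. fser c x $ j * pd j \<phi> x \<partial>T3) = 0"
    by (rule has_sum_unique) simp
  moreover have "(\<integral>x. (\<Sum>j\<in>UNIV. fser c x $ j * pd j \<phi> x) \<partial>T3) = (\<Sum>j\<in>UNIV. \<integral>x. fser c x $ j * pd j \<phi> x \<partial>T3)"
    by (rule Bochner_Integration.integral_sum)
       (unfold fser_nth, intro integrable_T3_continuous continuous_on_mult cont continuous_tser vrapidD[OF c])
  ultimately show "(\<integral>x. (\<Sum>j\<in>UNIV. fser c x $ j * pd j \<phi> x) \<partial>T3) = 0" by simp
qed

text \<open>Weak divergence freeness, tested with the conjugate character.\<close>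

lemma div_free_coef:
  assumes h: "h \<in> L2_div_free"
  shows "(\<Sum>j\<in>UNIV. complex_of_real (lat l $ j) * (\<integral>x. efun l x * cnj (h x $ j) \<partial>T3)) = 0"
proof -
  have hi: "integrable T3 (\<lambda>x. h x $ j)" for j
    using h by (intro L2_T3_component) (simp add: L2_div_free_def)
  have ib: "integrable T3 (\<lambda>x. efun (- l) x * h x $ j)" for j
  proof (rule Bochner_Integration.integrable_bound[OF hi[of j]])
    show "(\<lambda>x. efun (- l) x * h x $ j) \<in> borel_measurable T3"
      by (intro borel_measurable_times continuous_measurable_T3 continuous_efun borel_measurable_integrable hi)
  qed (simp add: norm_mult)
  have pde: "pd j (efun (- l)) x = - (2 * complex_of_real pi * \<i>) * (complex_of_real (lat l $ j) * efun (- l) x)" for j x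
    using pd_efun[of j 1 "- l" x] by (simp add: mult_ac)
  have "0 = (\<integral>x. (\<Sum>j\<in>UNIV. h x $ j * pd j (efun (- l)) x) \<partial>T3)"
    using h smooth_efun[of "- l"] by (simp add: L2_div_free_def)
  also have "\<dots> = (\<integral>x. - (2 * complex_of_real pi * \<i>) * (\<Sum>j\<in>UNIV. complex_of_real (lat l $ j) * (efun (- l) x * h x $ j)) \<partial>T3)"
    unfolding pde sum_distrib_left by (intro Bochner_Integration.integral_cong sum.cong refl) (simp only: mult_ac)
  also have "\<dots> = - (2 * complex_of_real pi * \<i>) * (\<integral>x. (\<Sum>j\<in>UNIV. complex_of_real (lat l $ j) * (efun (- l) x * h x $ j)) \<partial>T3)"
    by (rule integral_mult_right_zero)
  also have "(\<integral>x. (\<Sum>j\<in>UNIV. complex_of_real (lat l $ j) * (efun (- l) x * h x $ j)) \<partial>T3)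
      = (\<Sum>j\<in>UNIV. complex_of_real (lat l $ j) * (\<integral>x. efun (- l) x * h x $ j \<partial>T3))"
    by (subst Bochner_Integration.integral_sum) (intro integrable_mult_right ib, rule sum.cong, simp_all only: integral_mult_right_zero)
  finally have "(\<Sum>j\<in>UNIV. complex_of_real (lat l $ j) * (\<integral>x. efun (- l) x * h x $ j \<partial>T3)) = 0"
    by simp
  from arg_cong[OF this, of cnj]
  have "(\<Sum>j\<in>UNIV. complex_of_real (lat l $ j) * cnj (\<integral>x. efun (- l) x * h x $ j \<partial>T3)) = 0"
    by (simp only: cnj_sum complex_cnj_mult complex_cnj_complex_of_real complex_cnj_zero)
  moreover have "cnj (\<integral>x. efun (- l) x * h x $ j \<partial>T3) = (\<integral>x. efun l x * cnj (h x $ j) \<partial>T3)" for j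
    by (subst Bochner_Integration.integral_cnj[symmetric]) (simp add: efun_minus)
  ultimately show ?thesis by simp
qed

text \<open>The discarded part \<open>c\<^sub>l - P\<^sub>l c\<^sub>l\<close> is a multiple of \<open>l\<close>, and such gradients are orthogonal to
  every weakly divergence free field by \<open>div_free_coef\<close>.\<close>

lemma is_leray_fser:
  assumes c: "vrapid c"
  shows "is_leray (fser c) (fser (\<lambda>l. proj (lat l) (c l)))"
  unfolding is_leray_def
proof (intro conjI ballI)
  note pc = vrapid_proj[OF c, of lat]
  show "fser c \<in> L2_T3" by (intro L2_T3_continuous continuous_fser periodic_fser c)
  show "fser (\<lambda>l. proj (lat l) (c l)) \<in> L2_div_free"
    by (intro fser_div_free pc) simp
  fix h assume h: "h \<in> L2_div_free"
  have hi: "integrable T3 (\<lambda>x. cnj (h x $ j))" for j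
    using h L2_T3_component[of h j] by (simp add: L2_div_free_def)
  define g where "g l j = c l $ j - proj (lat l) (c l) $ j" for l j
  have rg: "rapid (\<lambda>l. g l j)" for j
    unfolding g_def by (intro rapid_diff vrapidD c pc)
  have diff: "(fser c x - fser (\<lambda>l. proj (lat l) (c l)) x) $ j = tser (\<lambda>l. g l j) x" for x j
    unfolding g_def by (simp add: fser_nth tser_diff vrapidD c pc)
  have hs: "((\<lambda>l. g l j * (\<integral>x. efun l x * cnj (h x $ j) \<partial>T3)) has_sum (\<integral>x. tser (\<lambda>l. g l j) x * cnj (h x $ j) \<partial>T3)) UNIV" for j
    by (intro integral_tser_has_sum rg hi)
  have g: "g l j = cdot (lat l) (c l) / complex_of_real ((norm (lat l))\<^sup>2) * complex_of_real (lat l $ j)" for l j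
    unfolding g_def proj_nth by simp
  have "(\<Sum>j\<in>UNIV. g l j * (\<integral>x. efun l x * cnj (h x $ j) \<partial>T3)) = 0" for l
    unfolding g mult.assoc sum_distrib_left[symmetric] div_free_coef[OF h] by simp
  then have "((\<lambda>l::int^3. 0) has_sum (\<Sum>j\<in>UNIV. \<integral>x. tser (\<lambda>l. g l j) x * cnj (h x $ j) \<partial>T3)) UNIV"
    using has_sum_sum_3[of "\<lambda>j l. g l j * (\<integral>x. efun l x * cnj (h x $ j) \<partial>T3)", OF hs] by simp
  then have z: "(\<Sum>j\<in>UNIV. \<integral>x. tser (\<lambda>l. g l j) x * cnj (h x $ j) \<partial>T3) = 0"
    by (rule has_sum_unique) simp
  have int: "integrable T3 (\<lambda>x. tser (\<lambda>l. g l j) x * cnj (h x $ j))" for j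
  proof -
    define s where "s = (\<Sum>\<^sub>\<infinity>l. norm (g l j))"
    have b: "norm (tser (\<lambda>l. g l j) x) \<le> s" for x
      unfolding s_def by (rule norm_tser_le[OF rapid_summable[OF rg]])
    then have "norm (tser (\<lambda>l. g l j) x) \<le> \<bar>s\<bar>" for x by (rule order_trans) simp
    then show ?thesis
    proof (intro Bochner_Integration.integrable_bound[OF integrable_mult_right[OF hi[of j], of "complex_of_real s"]])
      show "(\<lambda>x. tser (\<lambda>l. g l j) x * cnj (h x $ j)) \<in> borel_measurable T3"
        by (intro borel_measurable_times continuous_measurable_T3 continuous_tser rg borel_measurable_integrable[OF hi])
    qed (simp add: norm_mult mult_right_mono)
  qed
  show "L2_inner_T3 (\<lambda>x. fser c x - fser (\<lambda>l. proj (lat l) (c l)) x) h = 0"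
    unfolding L2_inner_T3_def diff
    by (subst Bochner_Integration.integral_sum) (rule int, rule z)
qed

text \<open>The difference of two projections is divergence free and orthogonal to itself; continuity
  turns equality almost everywhere into equality.\<close>

lemma is_leray_unique:
  assumes g: "is_leray f g" "continuous_on UNIV g" and g': "is_leray f g'" "continuous_on UNIV g'"
    and f: "continuous_on UNIV f"
  shows "g = g'"
proof
  fix x
  define k where "k y = g y - g' y" for y
  have k: "continuous_on UNIV k" unfolding k_def by (intro continuous_intros g g')
  have pk: "periodic k" using g(1) g'(1) by (simp add: is_leray_def L2_div_free_def L2_T3_def periodic_def k_def)
  have "k \<in> L2_div_free"
    unfolding L2_div_free_def mem_Collect_eq
  proof (intro conjI allI impI)
    show "k \<in> L2_T3" by (rule L2_T3_continuous[OF k pk])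
    fix \<phi> :: "real^3 \<Rightarrow> complex" assume \<phi>: "smooth_T3 \<phi>"
    note cont = smooth_continuous[OF smooth_pd[OF \<phi>]]
    have "(\<integral>x. (\<Sum>j\<in>UNIV. g x $ j * pd j \<phi> x) \<partial>T3) = 0" "(\<integral>x. (\<Sum>j\<in>UNIV. g' x $ j * pd j \<phi> x) \<partial>T3) = 0"
      using g(1) g'(1) \<phi> by (simp_all add: is_leray_def L2_div_free_def)
    moreover have "integrable T3 (\<lambda>x. \<Sum>j\<in>UNIV. g x $ j * pd j \<phi> x)" "integrable T3 (\<lambda>x. \<Sum>j\<in>UNIV. g' x $ j * pd j \<phi> x)"
      by (intro integrable_T3_continuous continuous_on_sum continuous_on_mult continuous_on_component cont g g')+
    ultimately show "(\<integral>x. (\<Sum>j\<in>UNIV. k x $ j * pd j \<phi> x) \<partial>T3) = 0"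
      by (simp add: k_def left_diff_distrib sum_subtractf)
  qed
  then have z: "L2_inner_T3 (\<lambda>x. f x - g x) k = 0" "L2_inner_T3 (\<lambda>x. f x - g' x) k = 0"
    using g(1) g'(1) by (simp_all add: is_leray_def)
  have i: "integrable T3 (\<lambda>x. \<Sum>i\<in>UNIV. (f x - g' x) $ i * cnj (k x $ i))" "integrable T3 (\<lambda>x. \<Sum>i\<in>UNIV. (f x - g x) $ i * cnj (k x $ i))"
    by (intro integrable_T3_continuous continuous_on_sum continuous_on_mult continuous_on_component continuous_on_cnj continuous_on_diff f g g' k)+
  have "(\<Sum>i\<in>UNIV. (f x - g' x) $ i * cnj (k x $ i)) - (\<Sum>i\<in>UNIV. (f x - g x) $ i * cnj (k x $ i)) = complex_of_real ((norm (k x))\<^sup>2)" for x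
  proof -
    have "(\<Sum>i\<in>UNIV. (f x - g' x) $ i * cnj (k x $ i)) - (\<Sum>i\<in>UNIV. (f x - g x) $ i * cnj (k x $ i)) = (\<Sum>i\<in>UNIV. k x $ i * cnj (k x $ i))"
      unfolding sum_subtractf[symmetric] left_diff_distrib[symmetric] by (simp add: k_def)
    also have "\<dots> = complex_of_real (\<Sum>i\<in>UNIV. (norm (k x $ i))\<^sup>2)"
      by (simp only: of_real_sum complex_norm_square)
    finally show ?thesis by (simp add: norm_vec_def L2_set_def sum_nonneg)
  qed
  then have "complex_of_real (\<integral>x. (norm (k x))\<^sup>2 \<partial>T3) = 0"
    using Bochner_Integration.integral_diff[OF i] z by (simp add: L2_inner_T3_def del: of_real_power)
  then have i0: "(\<integral>x. (norm (k x))\<^sup>2 \<partial>T3) = 0" by simp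
  have kc: "continuous_on UNIV (\<lambda>x. (norm (k x))\<^sup>2)"
    by (rule continuous_on_power[OF continuous_on_norm[OF k]])
  have kp: "periodic (\<lambda>x. (norm (k x))\<^sup>2)" using pk by (simp add: periodic_def)
  have "(norm (k x))\<^sup>2 = 0"
    by (rule integral_T3_eq_0_imp[OF kc kp _ i0]) simp
  then show "g x = g' x" by (simp add: k_def)
qed

text \<open>The multiplier gives a continuous projection, so the choice in \<open>leray\<close> selects a continuous one,
  and that is unique.\<close>

theorem leray_fser:
  assumes c: "vrapid c"
  shows "leray (fser c) = fser (\<lambda>l. proj (lat l) (c l))"
proof -
  let ?g = "fser (\<lambda>l. proj (lat l) (c l))"
  let ?P = "\<lambda>g. is_leray (fser c) g \<and> ((\<exists>g'. is_leray (fser c) g' \<and> continuous_on UNIV g') \<longrightarrow> continuous_on UNIV g)"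
  have g: "is_leray (fser c) ?g" "continuous_on UNIV ?g"
    by (intro is_leray_fser continuous_fser vrapid_proj c)+
  have "?P (leray (fser c))"
    unfolding leray_def by (rule someI[of ?P ?g]) (simp add: g)
  with g have L: "is_leray (fser c) (leray (fser c))" "continuous_on UNIV (leray (fser c))" by blast+
  show ?thesis by (rule is_leray_unique[OF L g continuous_fser[OF c]])
qed

section \<open>Transport along the modes\<close>

text \<open>The derivative brings down \<open>2 \<pi> i (a \<cdot> l)\<close>, and multiplication by the character \<open>e\<^sub>k\<close> moves
  frequency \<open>l - k\<close> to \<open>l\<close>.\<close>

lemma advect_sigma_fser:
  assumes c: "vrapid c"
  shows "advect (sigma a k \<alpha>) (fser c) =
    fser (\<lambda>l. (2 * complex_of_real pi * \<i> * complex_of_real (a k \<alpha> \<bullet> lat (l - k))) *s c (l - k))"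
proof (rule ext, unfold vec_eq_iff, intro allI)
  fix x i
  define d where "d j l = complex_of_real (a k \<alpha> $ j) * (2 * complex_of_real pi * \<i> * of_int (l $ j) * c l $ i)" for j l
  have rd: "rapid (d j)" for j
    unfolding d_def by (intro rapid_cmult rapid_deriv vrapidD c)
  have "sigma a k \<alpha> x $ j * pd j (fser c) x $ i = efun k x * tser (d j) x" for j
    unfolding sigma_def vec_lambda_beta pd_fser[OF c] d_def tser_cmult[of "complex_of_real (a k \<alpha> $ j)"]
    by (simp only: mult_ac)
  then have "advect (sigma a k \<alpha>) (fser c) x $ i = (\<Sum>j\<in>UNIV. efun k x * tser (d j) x)"
    by (simp only: advect_def vec_lambda_beta)
  also have "\<dots> = efun k x * tser (\<lambda>l. \<Sum>j\<in>UNIV. d j l) x"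
    by (simp add: tser_sum rd sum_distrib_left)
  also have "\<dots> = tser (\<lambda>l. \<Sum>j\<in>UNIV. d j (l - k)) x"
    by (rule tser_shift)
  also have "(\<lambda>l. \<Sum>j\<in>UNIV. d j (l - k)) = (\<lambda>l. (2 * complex_of_real pi * \<i> * complex_of_real (a k \<alpha> \<bullet> lat (l - k))) * c (l - k) $ i)"
    by (simp add: d_def inner_vec_def sum_distrib_left sum_distrib_right mult_ac)
  finally show "advect (sigma a k \<alpha>) (fser c) x $ i =
      fser (\<lambda>l. (2 * complex_of_real pi * \<i> * complex_of_real (a k \<alpha> \<bullet> lat (l - k))) *s c (l - k)) x $ i"
    by (simp add: fser_nth)
qed

lemma vrapid_advect:
  assumes c: "vrapid c"
  shows "vrapid (\<lambda>l. (2 * complex_of_real pi * \<i> * complex_of_real (b \<bullet> lat (l - k))) *s c (l - k))"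
  unfolding vrapid_def vector_smult_component
  using rapid_shift[OF rapid_mult_inner[OF vrapidD[OF c]]] by blast

text \<open>The frequency \<open>l\<close> is sent to \<open>l - k\<close> and back. Since \<open>a \<perp> k\<close>, both transports contribute the
  same factor \<open>2 \<pi> i (a \<cdot> l)\<close>.\<close>

lemma leray_advect_twice:
  assumes c: "vrapid c" and orth: "a k \<alpha> \<bullet> lat k = 0" and sym: "a (- k) \<alpha> = a k \<alpha>"
  shows "leray (advect (sigma a k \<alpha>) (leray (advect (sigma a (- k) \<alpha>) (fser c)))) =
    fser (\<lambda>l. complex_of_real (- (4 * pi\<^sup>2) * (a k \<alpha> \<bullet> lat l)\<^sup>2) *s proj (lat l) (proj (lat (l - k)) (c l)))"
    and "vrapid (\<lambda>l. complex_of_real (- (4 * pi\<^sup>2) * (a k \<alpha> \<bullet> lat l)\<^sup>2) *s proj (lat l) (proj (lat (l - k)) (c l)))"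
proof -
  let ?f = "\<lambda>l. 2 * complex_of_real pi * \<i> * complex_of_real (a k \<alpha> \<bullet> lat l)"
  have shift: "a k \<alpha> \<bullet> lat (l - k) = a k \<alpha> \<bullet> lat l" "a k \<alpha> \<bullet> lat (l + k) = a k \<alpha> \<bullet> lat l" for l
    by (simp_all add: lat_diff lat_add inner_diff_right inner_add_right orth)
  define c1 where "c1 l = ?f l *s c (l + k)" for l
  have "(\<lambda>l. (2 * complex_of_real pi * \<i> * complex_of_real (a (- k) \<alpha> \<bullet> lat (l - (- k)))) *s c (l - (- k))) = c1"
    by (rule ext) (simp add: c1_def sym shift)
  with advect_sigma_fser[OF c, of a "- k" \<alpha>] vrapid_advect[OF c, of "a (- k) \<alpha>" "- k"]
  have 1: "advect (sigma a (- k) \<alpha>) (fser c) = fser c1" "vrapid c1" by simp_all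
  define c2 where "c2 l = proj (lat l) (c1 l)" for l
  have 2: "leray (fser c1) = fser c2" "vrapid c2"
    using leray_fser[OF 1(2)] vrapid_proj[OF 1(2)] by (simp_all add: c2_def[abs_def])
  define c3 where "c3 l = ?f l *s c2 (l - k)" for l
  have "(\<lambda>l. (2 * complex_of_real pi * \<i> * complex_of_real (a k \<alpha> \<bullet> lat (l - k))) *s c2 (l - k)) = c3"
    by (rule ext) (simp add: c3_def shift)
  with advect_sigma_fser[OF 2(2), of a k \<alpha>] vrapid_advect[OF 2(2), of "a k \<alpha>" "k"]
  have 3: "advect (sigma a k \<alpha>) (fser c2) = fser c3" "vrapid c3" by simp_all
  have "c3 l = ?f l *s proj (lat (l - k)) (?f l *s c l)" for l
    by (simp add: c3_def c2_def c1_def shift)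
  moreover have "?f l * ?f l = complex_of_real (- (4 * pi\<^sup>2) * (a k \<alpha> \<bullet> lat l)\<^sup>2)" for l
    by (simp add: power2_eq_square)
  ultimately have c3: "c3 l = complex_of_real (- (4 * pi\<^sup>2) * (a k \<alpha> \<bullet> lat l)\<^sup>2) *s proj (lat (l - k)) (c l)" for l
    by (simp only: proj_cmult vector_smult_assoc)
  have 4: "leray (fser c3) = fser (\<lambda>l. proj (lat l) (c3 l))" "vrapid (\<lambda>l. proj (lat l) (c3 l))"
    by (intro leray_fser vrapid_proj 3)+
  show "leray (advect (sigma a k \<alpha>) (leray (advect (sigma a (- k) \<alpha>) (fser c)))) =
    fser (\<lambda>l. complex_of_real (- (4 * pi\<^sup>2) * (a k \<alpha> \<bullet> lat l)\<^sup>2) *s proj (lat l) (proj (lat (l - k)) (c l)))"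
    and "vrapid (\<lambda>l. complex_of_real (- (4 * pi\<^sup>2) * (a k \<alpha> \<bullet> lat l)\<^sup>2) *s proj (lat l) (proj (lat (l - k)) (c l)))"
    using 4 by (simp_all only: 1 2 3 c3 proj_cmult)
qed

text \<open>The frames are prescribed on one half of the frequencies; the symmetry \<open>a\<^sub>-\<^sub>k = a\<^sub>k\<close> carries them
  to the other half.\<close>

lemma frame_family_Z0:
  assumes "half_partition Zp Zm" "frame_family Zp a" "k \<in> Z0"
  shows "norm (a k 1) = 1" "norm (a k 2) = 1" "a k 1 \<bullet> a k 2 = 0"
    "span {a k 1, a k 2} = {x. x \<bullet> lat k = 0}"
    "\<alpha> \<in> {1, 2} \<Longrightarrow> a (- k) \<alpha> = a k \<alpha>"
proof -
  have "norm (a k 1) = 1 \<and> norm (a k 2) = 1 \<and> a k 1 \<bullet> a k 2 = 0 \<and>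
    span {a k 1, a k 2} = {x. x \<bullet> lat k = 0} \<and> (\<forall>\<alpha>\<in>{1, 2}. a (- k) \<alpha> = a k \<alpha>)"
  proof (cases "k \<in> Zp")
    case True
    with assms(2) show ?thesis unfolding frame_family_def by blast
  next
    case False
    with assms(1,3) have "- k \<in> Zp" unfolding half_partition_def by auto
    with assms(2) have "norm (a (- k) 1) = 1 \<and> norm (a (- k) 2) = 1 \<and> a (- k) 1 \<bullet> a (- k) 2 = 0 \<and>
      span {a (- k) 1, a (- k) 2} = {x. x \<bullet> lat (- k) = 0} \<and> (\<forall>\<alpha>\<in>{1, 2}. a (- (- k)) \<alpha> = a (- k) \<alpha>)"
      unfolding frame_family_def by blast
    then show ?thesis by (simp add: lat_minus)
  qed
  then show "norm (a k 1) = 1" "norm (a k 2) = 1" "a k 1 \<bullet> a k 2 = 0"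
    "span {a k 1, a k 2} = {x. x \<bullet> lat k = 0}" "\<alpha> \<in> {1, 2} \<Longrightarrow> a (- k) \<alpha> = a k \<alpha>"
    by blast+
qed

text \<open>Pythagoras: the left side is the squared length of the component of \<open>l\<close> orthogonal to \<open>k\<close>.\<close>

lemma sum_frame_squares:
  fixes a b k l :: "real^3"
  assumes n: "norm a = 1" "norm b = 1" "a \<bullet> b = 0" and sp: "span {a, b} = {x. x \<bullet> k = 0}" and k: "k \<noteq> 0"
  shows "(a \<bullet> l)\<^sup>2 + (b \<bullet> l)\<^sup>2 = (norm l)\<^sup>2 - (k \<bullet> l)\<^sup>2 / (norm k)\<^sup>2"
proof -
  define p where "p = l - ((l \<bullet> k) / (k \<bullet> k)) *\<^sub>R k"
  have kk: "k \<bullet> k \<noteq> 0" using k by simp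
  have ak: "a \<bullet> k = 0" "b \<bullet> k = 0" using span_base[of a "{a, b}"] span_base[of b "{a, b}"] sp by auto
  have "p \<bullet> k = 0" using kk by (simp add: p_def inner_diff_left)
  then have "p \<in> span {a, b}" by (simp add: sp)
  then obtain s t where p: "p = s *\<^sub>R a + t *\<^sub>R b"
    by (auto simp: span_insert span_singleton algebra_simps)
  have aa: "a \<bullet> a = 1" "b \<bullet> b = 1" using n by (simp_all add: norm_eq_1)
  have "a \<bullet> l = a \<bullet> p" "b \<bullet> l = b \<bullet> p" by (simp_all add: p_def inner_diff_right ak)
  then have st: "a \<bullet> l = s" "b \<bullet> l = t" using n(3) aa by (simp_all add: p inner_add_right inner_commute)
  have "p \<bullet> p = s\<^sup>2 + t\<^sup>2"
    using n(3) aa by (simp add: p inner_add_left inner_add_right inner_commute power2_eq_square)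
  moreover have "p \<bullet> p = l \<bullet> l - (k \<bullet> l)\<^sup>2 / (k \<bullet> k)"
    using kk by (simp add: p_def inner_diff_left inner_diff_right inner_commute power2_eq_square field_simps)
  ultimately show ?thesis by (simp add: st power2_norm_eq_inner)
qed


section \<open>Lattice sums over shells\<close>

text \<open>The cubes of side \<open>1/N\<close> with corners in \<open>\<int>\<^sup>3/N\<close> tile space; this is the index of the cube
  containing \<open>y\<close>. Lattice sums become integrals of functions that are constant on these cubes, to
  which dominated convergence applies.\<close>

definition cell_index :: "real \<Rightarrow> real^3 \<Rightarrow> int^3" where
  "cell_index N y = (\<chi> i. \<lfloor>N * y $ i\<rfloor>)"

lemma cell_index_eq_iff:
  assumes "N > 0"
  shows "cell_index N y = k \<longleftrightarrow> (\<forall>i. real_of_int (k $ i) / N \<le> y $ i \<and> y $ i < (real_of_int (k $ i) + 1) / N)"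
proof -
  have "\<lfloor>N * y $ i\<rfloor> = k $ i \<longleftrightarrow> real_of_int (k $ i) / N \<le> y $ i \<and> y $ i < (real_of_int (k $ i) + 1) / N" for i
    using assms by (simp add: floor_eq_iff pos_divide_le_eq pos_less_divide_eq mult.commute)
  then show ?thesis by (simp add: cell_index_def vec_eq_iff)
qed

lemma cell_measurable [measurable]: "N > 0 \<Longrightarrow> {y. cell_index N y = k} \<in> sets borel"
  unfolding cell_index_eq_iff by measurable

lemma emeasure_cell:
  assumes N: "N > 0"
  shows "emeasure lborel {y. cell_index N y = k} = ennreal (1 / N ^ 3)"
proof -
  define a b :: "real^3" where "a = (\<chi> i. real_of_int (k $ i) / N)" and "b = (\<chi> i. (real_of_int (k $ i) + 1) / N)"
  have ba: "(b - a) \<bullet> e = 1 / N" if "e \<in> Basis" for e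
  proof -
    obtain i where "e = axis i 1" using \<open>e \<in> Basis\<close> by (auto simp: Basis_vec_def)
    then show ?thesis by (simp add: inner_axis a_def b_def add_divide_distrib)
  qed
  then have le: "\<forall>e\<in>Basis. a \<bullet> e \<le> b \<bullet> e"
    using N by (auto simp: inner_diff_left) (metis diff_ge_0_iff_ge divide_nonneg_pos zero_le_one)
  have "(\<Prod>e\<in>Basis. (b - a) \<bullet> e) = 1 / N ^ 3"
    by (simp add: ba power_one_over)
  then have e: "emeasure lborel (box a b) = ennreal (1 / N ^ 3)" "emeasure lborel (cbox a b) = ennreal (1 / N ^ 3)"
    using le by (simp_all add: emeasure_lborel_box_eq emeasure_lborel_cbox_eq)
  have "box a b \<subseteq> {y. cell_index N y = k}"
    by (simp add: subset_iff mem_box_cart cell_index_eq_iff[OF N] a_def b_def less_imp_le)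
  moreover have "{y. cell_index N y = k} \<subseteq> cbox a b"
    by (simp add: subset_iff mem_box_cart cell_index_eq_iff[OF N] a_def b_def less_imp_le)
  ultimately have "emeasure lborel (box a b) \<le> emeasure lborel {y. cell_index N y = k}"
    "emeasure lborel {y. cell_index N y = k} \<le> emeasure lborel (cbox a b)"
    using N by (simp_all add: emeasure_mono)
  then show ?thesis using e by simp
qed

lemma lattice_sum_eq_integral:
  fixes G :: "int^3 \<Rightarrow> real"
  assumes N: "N > 0" and K: "finite K" "\<And>k. k \<notin> K \<Longrightarrow> G k = 0"
  shows "(\<lambda>y. G (cell_index N y)) \<in> borel_measurable lborel"
    and "(\<integral>y. G (cell_index N y) \<partial>lborel) = (\<Sum>k\<in>K. G k) / N ^ 3"
proof -
  have eq: "(\<lambda>y. G (cell_index N y)) = (\<lambda>y. \<Sum>k\<in>K. G k * indicator {y. cell_index N y = k} y)"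
  proof
    fix y
    have "(\<Sum>k\<in>K. G k * indicator {y. cell_index N y = k} y) = (\<Sum>k\<in>K. if k = cell_index N y then G k else 0)"
      by (rule sum.cong) (auto simp: indicator_def)
    also have "\<dots> = G (cell_index N y)"
      using K by simp
    finally show "G (cell_index N y) = (\<Sum>k\<in>K. G k * indicator {y. cell_index N y = k} y)" by simp
  qed
  have m: "{y. cell_index N y = k} \<in> sets lborel" for k using N by simp
  show "(\<lambda>y. G (cell_index N y)) \<in> borel_measurable lborel"
    unfolding eq by (intro borel_measurable_sum borel_measurable_times borel_measurable_const borel_measurable_indicator m)
  have i: "integrable lborel (indicator {y. cell_index N y = k} :: _ \<Rightarrow> real)" for k
    by (rule integrable_real_indicator[OF m]) (simp add: emeasure_cell[OF N])
  have v: "(\<integral>y. indicator {y. cell_index N y = k} y \<partial>lborel) = 1 / N ^ 3" for k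
    using N by (simp add: measure_def emeasure_cell[OF N])
  have "(\<integral>y. (\<Sum>k\<in>K. G k * indicator {y. cell_index N y = k} y) \<partial>lborel) = (\<Sum>k\<in>K. G k * (1 / N ^ 3))"
    by (subst Bochner_Integration.integral_sum, rule integrable_mult_right, rule i)
       (simp only: integral_mult_right_zero v)
  then show "(\<integral>y. G (cell_index N y) \<partial>lborel) = (\<Sum>k\<in>K. G k) / N ^ 3"
    unfolding eq by (simp add: sum_divide_distrib)
qed

lemma cell_corner_close:
  assumes N: "N > 0"
  shows "norm (lat (cell_index N y) /\<^sub>R N - y) \<le> 3 / N"
proof -
  have "\<bar>(lat (cell_index N y) /\<^sub>R N - y) $ i\<bar> \<le> 1 / N" for i
  proof -
    have "\<bar>real_of_int \<lfloor>N * y $ i\<rfloor> - N * y $ i\<bar> \<le> 1" by linarith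
    from divide_right_mono[OF this less_imp_le[OF N]]
    have "\<bar>(real_of_int \<lfloor>N * y $ i\<rfloor> - N * y $ i) / N\<bar> \<le> 1 / N"
      using N by (simp add: abs_divide)
    moreover have "(lat (cell_index N y) /\<^sub>R N - y) $ i = (real_of_int \<lfloor>N * y $ i\<rfloor> - N * y $ i) / N"
      using N by (simp add: cell_index_def field_simps)
    ultimately show ?thesis by simp
  qed
  then have "(\<Sum>i\<in>UNIV. \<bar>(lat (cell_index N y) /\<^sub>R N - y) $ i\<bar>) \<le> of_nat (card (UNIV :: 3 set)) * (1 / N)"
    by (intro sum_bounded_above) simp
  with norm_le_l1_cart[of "lat (cell_index N y) /\<^sub>R N - y"] show ?thesis by simp
qed

lemma cell_corner_tendsto: "(\<lambda>N. lat (cell_index (real (Suc N)) y) /\<^sub>R real (Suc N)) \<longlonglongrightarrow> y"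
proof (rule LIM_zero_cancel, rule Lim_null_comparison[OF always_eventually])
  show "\<forall>N. norm (lat (cell_index (real (Suc N)) y) /\<^sub>R real (Suc N) - y) \<le> 3 / real (Suc N)"
    by (intro allI cell_corner_close) simp
  show "(\<lambda>N. 3 / real (Suc N)) \<longlonglongrightarrow> 0"
    using tendsto_mult_right[OF LIMSEQ_inverse_real_of_nat, of 3] by (simp add: divide_inverse mult.commute)
qed

lemma finite_lattice_ball: "finite {k. norm (lat k) \<le> R}"
proof -
  have "($) ` {k. norm (lat k) \<le> R} \<subseteq> PiE UNIV (\<lambda>_. {- \<lceil>R\<rceil>..\<lceil>R\<rceil>})"
  proof
    fix h :: "3 \<Rightarrow> int" assume "h \<in> ($) ` {k. norm (lat k) \<le> R}"
    then obtain k where k: "norm (lat k) \<le> R" "h = ($) k" by auto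
    have "k $ i \<in> {- \<lceil>R\<rceil>..\<lceil>R\<rceil>}" for i
    proof -
      have "\<bar>real_of_int (k $ i)\<bar> \<le> R" using component_le_norm_cart[of "lat k" i] k(1) by simp
      then have "real_of_int (k $ i) \<le> R" "- real_of_int (k $ i) \<le> R" by linarith+
      then show ?thesis by simp linarith
    qed
    with k show "h \<in> PiE UNIV (\<lambda>_. {- \<lceil>R\<rceil>..\<lceil>R\<rceil>})" by auto
  qed
  moreover have "finite (PiE (UNIV :: 3 set) (\<lambda>_. {- \<lceil>R\<rceil>..\<lceil>R\<rceil>}))" by (intro finite_PiE) auto
  ultimately have "finite (($) ` {k. norm (lat k) \<le> R})" by (rule finite_subset)
  then show ?thesis by (rule finite_imageD) (auto simp: inj_on_def vec_eq_iff)
qed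

text \<open>The profile of \<open>(\<theta>\<^sup>N)\<^sup>2\<close> at scale \<open>N\<close>, see \<open>thetaN_square\<close>.\<close>

definition shell_weight :: "real \<Rightarrow> real^3 \<Rightarrow> real" where
  "shell_weight \<gamma> y = (if 1 \<le> norm y \<and> norm y \<le> 2 then norm y powr (- 2 * \<gamma>) else 0)"

lemma shell_weight_nonneg: "0 \<le> shell_weight \<gamma> y"
  by (simp add: shell_weight_def)

lemma shell_weight_le_1: "\<gamma> > 0 \<Longrightarrow> shell_weight \<gamma> y \<le> 1"
proof (cases "1 \<le> norm y \<and> norm y \<le> 2")
  case True
  assume "\<gamma> > 0"
  with True have "norm y powr (- 2 * \<gamma>) \<le> norm y powr 0" by (intro powr_mono) auto
  also have "\<dots> \<le> 1" by simp
  finally show ?thesis unfolding shell_weight_def if_P[OF True] .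
next
  case False
  then show ?thesis unfolding shell_weight_def if_not_P[OF False] by simp
qed

lemma shell_weight_measurable [measurable]: "shell_weight \<gamma> \<in> borel_measurable borel"
  unfolding shell_weight_def by measurable

lemma thetaN_square:
  assumes "N > 0"
  shows "(thetaN \<gamma> N k)\<^sup>2 = real N powr (- 2 * \<gamma>) * shell_weight \<gamma> (lat k /\<^sub>R real N)"
proof -
  have n: "norm (lat k /\<^sub>R real N) = norm (lat k) / real N"
    by (simp add: divide_inverse mult.commute)
  have iff: "1 \<le> norm (lat k) / real N \<and> norm (lat k) / real N \<le> 2 \<longleftrightarrow> real N \<le> norm (lat k) \<and> norm (lat k) \<le> 2 * real N"
    using assms by (simp add: pos_le_divide_eq pos_divide_le_eq)
  show ?thesis
  proof (cases "real N \<le> norm (lat k) \<and> norm (lat k) \<le> 2 * real N")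
    case True
    with assms have pos: "norm (lat k) > 0" by linarith
    have "(norm (lat k) powr (- \<gamma>))\<^sup>2 = norm (lat k) powr (- 2 * \<gamma>)"
      by (simp add: power2_eq_square powr_add[symmetric])
    also have "\<dots> = (real N * (norm (lat k) / real N)) powr (- 2 * \<gamma>)"
      using assms by simp
    also have "\<dots> = real N powr (- 2 * \<gamma>) * (norm (lat k) / real N) powr (- 2 * \<gamma>)"
      by (rule powr_mult)
    finally show ?thesis unfolding thetaN_def shell_weight_def n iff if_P[OF True] .
  next
    case False
    show ?thesis unfolding thetaN_def shell_weight_def n iff if_not_P[OF False] by simp
  qed
qed

lemma AE_norm_neq: "AE y in lborel. norm (y :: real^3) \<noteq> r"
proof -
  have "sphere 0 r \<in> null_sets (lborel :: (real^3) measure)"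
    using negligible_sphere[of "0 :: real^3" r] by (auto simp: null_sets_completion_iff negligible_iff_null_sets)
  from AE_not_in[OF this] show ?thesis by simp
qed

text \<open>The weight jumps only on the two bounding spheres, which are null sets.\<close>

lemma shell_weight_tendsto:
  assumes y: "norm y \<noteq> 1" "norm y \<noteq> 2" and u: "u \<longlonglongrightarrow> y"
  shows "(\<lambda>N. shell_weight \<gamma> (u N)) \<longlonglongrightarrow> shell_weight \<gamma> y"
proof -
  have nu: "(\<lambda>N. norm (u N)) \<longlonglongrightarrow> norm y" using u by (rule tendsto_norm)
  consider "norm y < 1" | "norm y > 2" | "1 < norm y" "norm y < 2" using y by linarith
  then show ?thesis
  proof cases
    case 1
    from order_tendstoD(2)[OF nu 1] have "\<forall>\<^sub>F N in sequentially. shell_weight \<gamma> (u N) = shell_weight \<gamma> y"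
      by eventually_elim (use 1 in \<open>simp add: shell_weight_def\<close>)
    then show ?thesis by (rule tendsto_eventually)
  next
    case 2
    from order_tendstoD(1)[OF nu 2] have "\<forall>\<^sub>F N in sequentially. shell_weight \<gamma> (u N) = shell_weight \<gamma> y"
      by eventually_elim (use 2 in \<open>simp add: shell_weight_def\<close>)
    then show ?thesis by (rule tendsto_eventually)
  next
    case 3
    from order_tendstoD(1)[OF nu 3(1)] order_tendstoD(2)[OF nu 3(2)]
    have "\<forall>\<^sub>F N in sequentially. norm (u N) powr (- 2 * \<gamma>) = shell_weight \<gamma> (u N)"
      by eventually_elim (simp add: shell_weight_def)
    moreover have "(\<lambda>N. norm (u N) powr (- 2 * \<gamma>)) \<longlonglongrightarrow> norm y powr (- 2 * \<gamma>)"
      using 3 by (intro tendsto_powr nu tendsto_const) auto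
    moreover have "shell_weight \<gamma> y = norm y powr (- 2 * \<gamma>)"
      using 3 by (simp add: shell_weight_def)
    ultimately show ?thesis by (simp add: tendsto_cong)
  qed
qed

text \<open>The two arguments of \<open>h\<close> become the rescaled frequencies \<open>k/N\<close> and \<open>(k - l)/N\<close>. They have the
  same limit, so the fixed shift by \<open>l\<close> disappears.\<close>

lemma shell_lattice_sum_tendsto:
  fixes h :: "real^3 \<Rightarrow> real^3 \<Rightarrow> real"
  assumes \<gamma>: "\<gamma> > 0" and bound: "\<And>x y. \<bar>h x y\<bar> \<le> C"
    and cont: "\<And>y u w. y \<noteq> 0 \<Longrightarrow> u \<longlonglongrightarrow> y \<Longrightarrow> w \<longlonglongrightarrow> y \<Longrightarrow> (\<lambda>N. h (u N) (w N)) \<longlonglongrightarrow> h y y"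
    and meas: "(\<lambda>y. h y y) \<in> borel_measurable borel"
  shows "(\<lambda>N. (\<Sum>k\<in>{k. norm (lat k) \<le> 2 * real (Suc N)}.
      shell_weight \<gamma> (lat k /\<^sub>R real (Suc N)) * h (lat k /\<^sub>R real (Suc N)) (lat (k - l) /\<^sub>R real (Suc N))) / real (Suc N) ^ 3)
    \<longlonglongrightarrow> (\<integral>y. shell_weight \<gamma> y * h y y \<partial>lborel)"
proof -
  define G where "G N k = shell_weight \<gamma> (lat k /\<^sub>R real (Suc N)) * h (lat k /\<^sub>R real (Suc N)) (lat (k - l) /\<^sub>R real (Suc N))" for N k
  have C: "0 \<le> C" using bound[of 0 0] by linarith
  have w0: "shell_weight \<gamma> y = 0" if "norm y > 2" for y using that by (simp add: shell_weight_def)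
  have G0: "G N k = 0" if "k \<notin> {k. norm (lat k) \<le> 2 * real (Suc N)}" for N k
  proof -
    have "2 < norm (lat k /\<^sub>R real (Suc N))"
      using that by (simp add: divide_inverse[symmetric] mult.commute[of "inverse _"] pos_less_divide_eq not_le del: of_nat_Suc)
    then show ?thesis by (simp add: G_def w0 del: of_nat_Suc)
  qed
  have sum_eq: "(\<Sum>k\<in>{k. norm (lat k) \<le> 2 * real (Suc N)}. G N k) / real (Suc N) ^ 3 = (\<integral>y. G N (cell_index (real (Suc N)) y) \<partial>lborel)" for N
    by (rule lattice_sum_eq_integral(2)[symmetric]) (simp_all only: of_nat_0_less_iff zero_less_Suc finite_lattice_ball G0 not_False_eq_True)
  have "(\<lambda>N. \<integral>y. G N (cell_index (real (Suc N)) y) \<partial>lborel) \<longlonglongrightarrow> (\<integral>y. shell_weight \<gamma> y * h y y \<partial>lborel)"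
  \<comment> \<open>the corner of the cell of \<open>y\<close> is within \<open>3\<close> of \<open>y\<close> and must lie in the ball of radius \<open>2\<close> to count\<close>
  proof (rule integral_dominated_convergence[where w = "\<lambda>y. C * indicator (cball 0 5) y"])
    show "(\<lambda>y. shell_weight \<gamma> y * h y y) \<in> borel_measurable lborel"
      using meas by measurable
    show "(\<lambda>y. G N (cell_index (real (Suc N)) y)) \<in> borel_measurable lborel" for N
      by (rule lattice_sum_eq_integral(1)[where K = "{k. norm (lat k) \<le> 2 * real (Suc N)}"])
         (simp_all only: of_nat_0_less_iff zero_less_Suc finite_lattice_ball G0 not_False_eq_True)
    show "integrable lborel (\<lambda>y::real^3. C * indicator (cball 0 5) y)"
      by (intro integrable_mult_right integrable_real_indicator emeasure_bounded_finite bounded_cball) simp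
    show "AE y in lborel. norm (G N (cell_index (real (Suc N)) y)) \<le> C * indicator (cball 0 5) y" for N
    proof (rule AE_I2)
      fix y :: "real^3"
      let ?z = "lat (cell_index (real (Suc N)) y) /\<^sub>R real (Suc N)"
      show "norm (G N (cell_index (real (Suc N)) y)) \<le> C * indicator (cball 0 5) y"
      proof (cases "norm y \<le> 5")
        case True
        have "\<bar>shell_weight \<gamma> ?z\<bar> * \<bar>h ?z (lat (cell_index (real (Suc N)) y - l) /\<^sub>R real (Suc N))\<bar> \<le> 1 * C"
          using shell_weight_nonneg[of \<gamma> ?z] shell_weight_le_1[OF \<gamma>, of ?z] by (intro mult_mono bound) auto
        with True show ?thesis by (simp add: G_def abs_mult del: of_nat_Suc)
      next
        case False
        have "norm (?z - y) \<le> 3 / real (Suc N)" by (rule cell_corner_close) simp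
        also have "\<dots> \<le> 3" by (simp add: divide_le_eq)
        finally have "norm ?z > 2" using False norm_triangle_ineq2[of y ?z] by (simp add: norm_minus_commute del: of_nat_Suc)
        then show ?thesis using C by (simp add: G_def w0 del: of_nat_Suc)
      qed
    qed
    show "AE y in lborel. (\<lambda>N. G N (cell_index (real (Suc N)) y)) \<longlonglongrightarrow> shell_weight \<gamma> y * h y y"
      using AE_norm_neq[of 1] AE_norm_neq[of 2] AE_norm_neq[of 0]
    proof eventually_elim
      fix y :: "real^3" assume y: "norm y \<noteq> 1" "norm y \<noteq> 2" "norm y \<noteq> 0"
      have u: "(\<lambda>N. lat (cell_index (real (Suc N)) y) /\<^sub>R real (Suc N)) \<longlonglongrightarrow> y"
        by (rule cell_corner_tendsto)
      have "(\<lambda>N. lat (cell_index (real (Suc N)) y) /\<^sub>R real (Suc N) - inverse (real (Suc N)) *\<^sub>R lat l) \<longlonglongrightarrow> y - 0 *\<^sub>R lat l"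
        by (intro tendsto_diff u tendsto_scaleR tendsto_const LIMSEQ_inverse_real_of_nat)
      then have w: "(\<lambda>N. lat (cell_index (real (Suc N)) y - l) /\<^sub>R real (Suc N)) \<longlonglongrightarrow> y"
        by (simp add: lat_diff scaleR_diff_right del: of_nat_Suc)
      show "(\<lambda>N. G N (cell_index (real (Suc N)) y)) \<longlonglongrightarrow> shell_weight \<gamma> y * h y y"
        unfolding G_def using y by (intro tendsto_mult shell_weight_tendsto u cont w) auto
    qed
  qed
  then show ?thesis unfolding sum_eq[symmetric] unfolding G_def .
qed

section \<open>Directional moments of radial weights\<close>

lemma continuous_orthogonal_transformation:
  fixes T :: "real^3 \<Rightarrow> real^3"
  assumes "orthogonal_transformation T"
  shows "continuous_on UNIV T"
  by (rule linear_continuous_on, rule linear_conv_bounded_linear[THEN iffD1], rule orthogonal_transformation_linear, rule assms)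

lemma lborel_distr_orthogonal:
  fixes T :: "real^3 \<Rightarrow> real^3"
  assumes T: "orthogonal_transformation T"
  shows "distr lborel borel T = lborel"
proof (rule lborel_eqI[symmetric])
  have cT: "continuous_on UNIV T"
    by (rule continuous_orthogonal_transformation[OF T])
  have mT: "T \<in> borel_measurable borel" by (rule borel_measurable_continuous_onI[OF cT])
  show "sets (distr lborel borel T) = sets borel" by simp
  fix l u :: "real^3" assume le: "\<And>b. b \<in> Basis \<Longrightarrow> l \<bullet> b \<le> u \<bullet> b"
  define S where "S = inv T ` box l u"
  have vS: "T -` box l u = S"
    using orthogonal_transformation_bij[OF T] by (simp add: S_def bij_vimage_eq_inv_image)
  have "orthogonal_transformation (inv T)" by (rule orthogonal_transformation_inv[OF T])
  then have S: "S \<in> lmeasurable" "measure lebesgue S = measure lebesgue (box l u)"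
    unfolding S_def by (simp_all add: measurable_orthogonal_image measure_orthogonal_image)
  have Sb: "S \<in> sets borel"
    using measurable_sets[OF mT, of "box l u"] by (simp add: vS)
  have "emeasure (distr lborel borel T) (box l u) = emeasure lborel S"
    using mT by (simp add: emeasure_distr vS)
  also have "emeasure lborel S = emeasure lebesgue S" using Sb by (simp add: emeasure_completion)
  also have "\<dots> = ennreal (measure lebesgue S)"
    using S(1) by (simp add: emeasure_eq_measure2)
  also have "\<dots> = ennreal (\<Prod>b\<in>Basis. (u - l) \<bullet> b)"
    unfolding S(2) using le by (simp add: measure_completion measure_def emeasure_lborel_box_eq prod_nonneg inner_diff_left)
  finally show "emeasure (distr lborel borel T) (box l u) = (\<Prod>b\<in>Basis. (u - l) \<bullet> b)" .
qed

definition bounded_borel :: "(real^3 \<Rightarrow> real) \<Rightarrow> bool" where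
  "bounded_borel f \<longleftrightarrow> f \<in> borel_measurable borel \<and> (\<exists>C. \<forall>y. \<bar>f y\<bar> \<le> C)"

lemma bounded_borel_const: "bounded_borel (\<lambda>y. c)"
  by (auto simp: bounded_borel_def)

lemma bounded_borel_add: "bounded_borel f \<Longrightarrow> bounded_borel g \<Longrightarrow> bounded_borel (\<lambda>y. f y + g y)"
  unfolding bounded_borel_def
proof (elim conjE exE, intro conjI)
  fix C D assume "\<forall>y. \<bar>f y\<bar> \<le> C" "\<forall>y. \<bar>g y\<bar> \<le> D"
  then have "\<bar>f y + g y\<bar> \<le> C + D" for y by (meson abs_triangle_ineq add_mono order_trans)
  then show "\<exists>C. \<forall>y. \<bar>f y + g y\<bar> \<le> C" by blast
qed simp

lemma bounded_borel_mult: "bounded_borel f \<Longrightarrow> bounded_borel g \<Longrightarrow> bounded_borel (\<lambda>y. f y * g y)"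
  unfolding bounded_borel_def
proof (elim conjE exE, intro conjI)
  fix C D assume C: "\<forall>y. \<bar>f y\<bar> \<le> C" "\<forall>y. \<bar>g y\<bar> \<le> D"
  have "0 \<le> C" using C(1) by (meson abs_ge_zero order_trans)
  then have "\<bar>f y * g y\<bar> \<le> C * D" for y unfolding abs_mult using C by (intro mult_mono) auto
  then show "\<exists>C. \<forall>y. \<bar>f y * g y\<bar> \<le> C" by blast
qed simp

lemma bounded_borel_power: "bounded_borel f \<Longrightarrow> bounded_borel (\<lambda>y. f y ^ n)"
  by (induction n) (simp_all add: bounded_borel_const bounded_borel_mult)

text \<open>The component of \<open>u\<close> in the direction \<open>y/|y|\<close>: linear in \<open>u\<close> and homogeneous of degree zero in \<open>y\<close>.\<close>

definition dircos :: "real^3 \<Rightarrow> real^3 \<Rightarrow> real" where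
  "dircos u y = (u \<bullet> y) / norm y"

lemma abs_dircos_le: "\<bar>dircos u y\<bar> \<le> norm u"
  using Cauchy_Schwarz_ineq2[of u y] by (cases "y = 0") (simp_all add: dircos_def abs_divide divide_le_eq)

lemma bounded_borel_dircos: "bounded_borel (dircos u)"
  unfolding bounded_borel_def
proof (intro conjI exI[of _ "norm u"] allI abs_dircos_le)
  show "dircos u \<in> borel_measurable borel" unfolding dircos_def by measurable
qed

lemma dircos_add: "dircos (u + v) y = dircos u y + dircos v y"
  and dircos_diff: "dircos (u - v) y = dircos u y - dircos v y"
  and dircos_scaleR: "dircos (s *\<^sub>R u) y = s * dircos u y"
  by (simp_all add: dircos_def inner_add_left inner_diff_left add_divide_distrib diff_divide_distrib)

lemma dircos_axis: "dircos (axis i 1) y = y $ i / norm y"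
  by (simp add: dircos_def inner_axis')

lemma sum_dircos_squares: "y \<noteq> 0 \<Longrightarrow> (\<Sum>i\<in>UNIV. (dircos (axis i 1) y)\<^sup>2) = 1"
proof -
  assume "y \<noteq> 0"
  have "(\<Sum>i\<in>UNIV. (dircos (axis i 1) y)\<^sup>2) = (\<Sum>i\<in>UNIV. (y $ i)\<^sup>2) / (norm y)\<^sup>2"
    by (simp add: dircos_axis power_divide sum_divide_distrib)
  also have "(\<Sum>i\<in>UNIV. (y $ i)\<^sup>2) = (norm y)\<^sup>2"
    by (simp add: norm_vec_def L2_set_def sum_nonneg)
  finally show ?thesis using \<open>y \<noteq> 0\<close> by simp
qed

text \<open>The normalization at the origin lets identities that hold for \<open>y \<noteq> 0\<close> be used pointwise under the
  integral.\<close>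

locale radial_weight =
  fixes w :: "real^3 \<Rightarrow> real"
  assumes integrable_w: "integrable lborel w"
    and radial: "norm x = norm y \<Longrightarrow> w x = w y"
    and w_zero: "w 0 = 0"
begin

definition wint :: "(real^3 \<Rightarrow> real) \<Rightarrow> real" where
  "wint f = (\<integral>y. w y * f y \<partial>lborel)"

lemma integrable_E:
  assumes "bounded_borel f" shows "integrable lborel (\<lambda>y. w y * f y)"
proof -
  obtain C where f: "f \<in> borel_measurable borel" "\<And>y. \<bar>f y\<bar> \<le> C" using assms by (auto simp: bounded_borel_def)
  have ae: "AE y in lborel. norm (w y * f y) \<le> norm (C * w y)"
  proof (rule AE_I2)
    fix y
    have "\<bar>f y\<bar> \<le> \<bar>C\<bar>" using f(2)[of y] by linarith
    then have "\<bar>w y\<bar> * \<bar>f y\<bar> \<le> \<bar>w y\<bar> * \<bar>C\<bar>" by (rule mult_left_mono) simp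
    then show "norm (w y * f y) \<le> norm (C * w y)" by (simp add: abs_mult mult.commute)
  qed
  have "(\<lambda>y. w y * f y) \<in> borel_measurable lborel"
    using f(1) borel_measurable_integrable[OF integrable_w] by simp
  from Bochner_Integration.integrable_bound[OF integrable_mult_right[OF integrable_w] this ae] show ?thesis .
qed

lemma wint_add: "bounded_borel f \<Longrightarrow> bounded_borel g \<Longrightarrow> wint (\<lambda>y. f y + g y) = wint f + wint g"
  unfolding wint_def distrib_left by (intro Bochner_Integration.integral_add integrable_E)

lemma wint_diff: "bounded_borel f \<Longrightarrow> bounded_borel g \<Longrightarrow> wint (\<lambda>y. f y - g y) = wint f - wint g"
  unfolding wint_def right_diff_distrib by (intro Bochner_Integration.integral_diff integrable_E)

lemma wint_cmult: "wint (\<lambda>y. c * f y) = c * wint f"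
  unfolding wint_def by (simp add: mult.left_commute)

lemma wint_sum: "(\<And>i. i \<in> I \<Longrightarrow> bounded_borel (f i)) \<Longrightarrow> wint (\<lambda>y. \<Sum>i\<in>I. f i y) = (\<Sum>i\<in>I. wint (f i))"
  unfolding wint_def sum_distrib_left by (intro Bochner_Integration.integral_sum integrable_E)

lemma wint_rotation:
  assumes T: "orthogonal_transformation T" and f: "bounded_borel f"
  shows "wint (\<lambda>y. f (T y)) = wint f"
proof -
  have cT: "continuous_on UNIV T"
    by (rule continuous_orthogonal_transformation[OF T])
  have mT: "T \<in> measurable lborel borel" using borel_measurable_continuous_onI[OF cT] by simp
  have "wint f = (\<integral>y. w y * f y \<partial>(distr lborel borel T))"
    by (simp only: wint_def lborel_distr_orthogonal[OF T])
  also have "\<dots> = (\<integral>y. w (T y) * f (T y) \<partial>lborel)"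
    using f borel_measurable_integrable[OF integrable_w]
    by (intro integral_distr[OF mT] borel_measurable_times) (simp_all add: bounded_borel_def)
  also have "\<dots> = wint (\<lambda>y. f (T y))"
    unfolding wint_def using radial[OF orthogonal_transformation_norm[OF T]] by simp
  finally show ?thesis by simp
qed

text \<open>A rotation takes \<open>u\<close> to a multiple of the first basis vector, so a directional moment depends on
  \<open>u\<close> through its length alone.\<close>

lemma wint_dircos_power: "wint (\<lambda>y. dircos u y ^ p) = norm u ^ p * wint (\<lambda>y. dircos (axis 1 1) y ^ p)"
proof -
  have n: "norm (norm u *\<^sub>R axis 1 (1::real) :: real^3) = norm u" by simp
  obtain T :: "real^3 \<Rightarrow> real^3" where T: "orthogonal_transformation T" "T (norm u *\<^sub>R axis 1 1) = u"
    using n by (rule orthogonal_transformation_exists) blast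
  have rot: "dircos (T v) (T y) = dircos v y" for v y
    using T(1) by (simp add: dircos_def orthogonal_transformation_norm) (simp add: orthogonal_transformation_def)
  have "dircos u (T y) = dircos (norm u *\<^sub>R axis 1 1) y" for y
    by (subst T(2)[symmetric], rule rot)
  then have "wint (\<lambda>y. dircos u y ^ p) = wint (\<lambda>y. dircos (norm u *\<^sub>R axis 1 1) y ^ p)"
    using wint_rotation[OF T(1), of "\<lambda>y. dircos u y ^ p"] by (simp add: bounded_borel_power bounded_borel_dircos)
  also have "\<dots> = wint (\<lambda>y. norm u ^ p * dircos (axis 1 1) y ^ p)"
    by (simp only: dircos_scaleR power_mult_distrib)
  also have "\<dots> = norm u ^ p * wint (\<lambda>y. dircos (axis 1 1) y ^ p)"
    by (rule wint_cmult)
  finally show ?thesis .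
qed

lemma wint_partition: "wint (\<lambda>y. \<Sum>i\<in>UNIV. (dircos (axis i 1) y)\<^sup>2 * f y) = wint f"
proof -
  have "w y * (\<Sum>i\<in>UNIV. (dircos (axis i 1) y)\<^sup>2 * f y) = w y * f y" for y
    by (cases "y = 0") (simp_all add: w_zero sum_dircos_squares flip: sum_distrib_right)
  then show ?thesis unfolding wint_def by (simp only:)
qed

text \<open>By polarization the moment is a multiple of the inner product; summing over an orthonormal basis
  fixes the constant.\<close>

lemma second_moment: "wint (\<lambda>y. dircos p y * dircos q y) = wint (\<lambda>y. 1) / 3 * (p \<bullet> q)"
proof -
  define B where "B = wint (\<lambda>y. (dircos (axis 1 1) y)\<^sup>2)"
  have sq: "wint (\<lambda>y. (dircos u y)\<^sup>2) = B * (norm u)\<^sup>2" for u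
    unfolding B_def using wint_dircos_power[of u 2] by simp
  have b: "bounded_borel (\<lambda>y. (dircos u y)\<^sup>2)" for u by (intro bounded_borel_power bounded_borel_dircos)
  have "wint (\<lambda>y. 1) = (\<Sum>i\<in>UNIV. wint (\<lambda>y. (dircos (axis i 1) y)\<^sup>2))"
    using wint_partition[of "\<lambda>y. 1"] by (simp add: wint_sum b)
  then have "wint (\<lambda>y. 1) = 3 * B" by (simp add: sq)
  moreover have "(\<lambda>y. dircos p y * dircos q y) = (\<lambda>y. 1/4 * ((dircos (p + q) y)\<^sup>2 - (dircos (p - q) y)\<^sup>2))"
    by (rule ext) (simp add: dircos_add dircos_diff power2_eq_square algebra_simps)
  then have "wint (\<lambda>y. dircos p y * dircos q y) = 1/4 * (wint (\<lambda>y. (dircos (p + q) y)\<^sup>2) - wint (\<lambda>y. (dircos (p - q) y)\<^sup>2))"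
    by (simp only: wint_cmult wint_diff b)
  moreover have "(norm (p + q))\<^sup>2 - (norm (p - q))\<^sup>2 = 4 * (p \<bullet> q)"
    by (simp add: power2_norm_eq_inner inner_add_left inner_add_right inner_diff_left inner_diff_right inner_commute)
  ultimately show ?thesis
    by (simp add: sq flip: right_diff_distrib)
qed

text \<open>As for the second moment, \<open>\<integral> w (u \<cdot> y/|y|)\<^sup>4 = A |u|\<^sup>4\<close> determines the fourth
  moments by polarization, first for products of squares, then in the last two arguments.\<close>

lemma fourth_moment:
  "wint (\<lambda>y. (dircos u y)\<^sup>2 * (dircos p y * dircos q y)) = wint (\<lambda>y. 1) / 15 * ((norm u)\<^sup>2 * (p \<bullet> q) + 2 * (u \<bullet> p) * (u \<bullet> q))"
proof -
  define A where "A = wint (\<lambda>y. dircos (axis 1 1) y ^ 4)"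
  have q4: "wint (\<lambda>y. dircos u y ^ 4) = A * ((norm u)\<^sup>2)\<^sup>2" for u
    unfolding A_def using wint_dircos_power[of u 4] by (simp flip: power_mult)
  have b4: "bounded_borel (\<lambda>y. c * dircos u y ^ 4)" for u c by (intro bounded_borel_mult bounded_borel_const bounded_borel_power bounded_borel_dircos)
  have b: "bounded_borel (\<lambda>y. (dircos u y)\<^sup>2 * (dircos p y)\<^sup>2)" for u p
    by (intro bounded_borel_mult bounded_borel_power bounded_borel_dircos)
  have J: "wint (\<lambda>y. (dircos u y)\<^sup>2 * (dircos p y)\<^sup>2) = A / 3 * ((norm u)\<^sup>2 * (norm p)\<^sup>2 + 2 * (u \<bullet> p)\<^sup>2)" for u p
  proof -
    have "(\<lambda>y. (dircos u y)\<^sup>2 * (dircos p y)\<^sup>2) = (\<lambda>y. (1/12 * dircos (u + p) y ^ 4 + 1/12 * dircos (u - p) y ^ 4)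
        - (1/6 * dircos u y ^ 4 + 1/6 * dircos p y ^ 4))"
      by (rule ext) (simp add: dircos_add dircos_diff power2_eq_square power4_eq_xxxx algebra_simps)
    then have "wint (\<lambda>y. (dircos u y)\<^sup>2 * (dircos p y)\<^sup>2) =
        (1/12 * (A * ((norm (u + p))\<^sup>2)\<^sup>2) + 1/12 * (A * ((norm (u - p))\<^sup>2)\<^sup>2)) - (1/6 * (A * ((norm u)\<^sup>2)\<^sup>2) + 1/6 * (A * ((norm p)\<^sup>2)\<^sup>2))"
      by (simp only: wint_diff wint_add wint_cmult b4 bounded_borel_add q4)
    moreover have "(norm (u + p))\<^sup>2 = (norm u)\<^sup>2 + (norm p)\<^sup>2 + 2 * (u \<bullet> p)" "(norm (u - p))\<^sup>2 = (norm u)\<^sup>2 + (norm p)\<^sup>2 - 2 * (u \<bullet> p)"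
      by (simp_all add: power2_norm_eq_inner inner_add_left inner_add_right inner_diff_left inner_diff_right inner_commute)
    ultimately show ?thesis
      by (simp only:) (simp add: power2_eq_square field_simps)
  qed
  have "wint (\<lambda>y. 1) = (\<Sum>i\<in>UNIV. wint (\<lambda>y. (dircos (axis i 1) y)\<^sup>2))"
    using wint_partition[of "\<lambda>y. 1"] by (simp add: wint_sum bounded_borel_power bounded_borel_dircos)
  also have "\<dots> = (\<Sum>i\<in>UNIV. \<Sum>j\<in>UNIV. wint (\<lambda>y. (dircos (axis j 1) y)\<^sup>2 * (dircos (axis i 1) y)\<^sup>2))"
  proof (rule sum.cong[OF refl])
    fix i :: 3
    show "wint (\<lambda>y. (dircos (axis i 1) y)\<^sup>2) = (\<Sum>j\<in>UNIV. wint (\<lambda>y. (dircos (axis j 1) y)\<^sup>2 * (dircos (axis i 1) y)\<^sup>2))"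
      unfolding wint_partition[of "\<lambda>y. (dircos (axis i 1) y)\<^sup>2", symmetric] by (rule wint_sum[OF b])
  qed
  \<comment> \<open>nine terms \<open>A/3\<close> from the norms and three terms \<open>2 A/3\<close> from the inner products\<close>
  also have "\<dots> = 5 * A"
    unfolding J by (simp add: sum_3 inner_axis_axis)
  finally have A: "A = wint (\<lambda>y. 1) / 5" by simp
  have "(\<lambda>y. (dircos u y)\<^sup>2 * (dircos p y * dircos q y)) =
      (\<lambda>y. 1/4 * ((dircos u y)\<^sup>2 * (dircos (p + q) y)\<^sup>2 - (dircos u y)\<^sup>2 * (dircos (p - q) y)\<^sup>2))"
    by (rule ext) (simp add: dircos_add dircos_diff power2_eq_square algebra_simps)
  then have "wint (\<lambda>y. (dircos u y)\<^sup>2 * (dircos p y * dircos q y)) =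
      1/4 * (A / 3 * ((norm u)\<^sup>2 * (norm (p + q))\<^sup>2 + 2 * (u \<bullet> (p + q))\<^sup>2) - A / 3 * ((norm u)\<^sup>2 * (norm (p - q))\<^sup>2 + 2 * (u \<bullet> (p - q))\<^sup>2))"
    by (simp only: wint_cmult wint_diff b J)
  moreover have "(norm (p + q))\<^sup>2 = (norm p)\<^sup>2 + (norm q)\<^sup>2 + 2 * (p \<bullet> q)" "(norm (p - q))\<^sup>2 = (norm p)\<^sup>2 + (norm q)\<^sup>2 - 2 * (p \<bullet> q)"
    by (simp_all add: power2_norm_eq_inner inner_add_left inner_add_right inner_diff_left inner_diff_right inner_commute)
  ultimately show ?thesis
    unfolding A by (simp only: inner_add_right inner_diff_right) (simp add: power2_eq_square field_simps)
qed

text \<open>With \<open>e = y/|y|\<close> this averages \<open>(|u|\<^sup>2 - (u \<cdot> e)\<^sup>2) (I - e e\<^sup>T)\<close>, whose mean is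
  \<open>2/5 |u|\<^sup>2 I + 2/15 u u\<^sup>T\<close> because \<open>1 - 1/3 - 1/3 + 1/15 = 2/5\<close>.\<close>

lemma projected_moment:
  "wint (\<lambda>y. ((norm u)\<^sup>2 - (dircos u y)\<^sup>2) * ((p \<bullet> q) - dircos p y * dircos q y))
    = wint (\<lambda>y. 1) * (2/5 * (norm u)\<^sup>2 * (p \<bullet> q) + 2/15 * (u \<bullet> p) * (u \<bullet> q))"
proof -
  have b: "bounded_borel (\<lambda>y. c)" "bounded_borel (\<lambda>y. c * (dircos p y * dircos q y))" "bounded_borel (\<lambda>y. c * (dircos u y * dircos u y))"
    "bounded_borel (\<lambda>y. (dircos u y)\<^sup>2 * (dircos p y * dircos q y))" for c
    by (intro bounded_borel_mult bounded_borel_const bounded_borel_dircos bounded_borel_power)+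
  have "(\<lambda>y. ((norm u)\<^sup>2 - (dircos u y)\<^sup>2) * ((p \<bullet> q) - dircos p y * dircos q y)) =
    (\<lambda>y. ((norm u)\<^sup>2 * (p \<bullet> q) * 1 + (dircos u y)\<^sup>2 * (dircos p y * dircos q y))
      - ((norm u)\<^sup>2 * (dircos p y * dircos q y) + (p \<bullet> q) * (dircos u y * dircos u y)))"
    by (rule ext) (simp add: power2_eq_square algebra_simps)
  then have "wint (\<lambda>y. ((norm u)\<^sup>2 - (dircos u y)\<^sup>2) * ((p \<bullet> q) - dircos p y * dircos q y)) =
    ((norm u)\<^sup>2 * (p \<bullet> q) * wint (\<lambda>y. 1) + wint (\<lambda>y. (dircos u y)\<^sup>2 * (dircos p y * dircos q y)))
      - ((norm u)\<^sup>2 * wint (\<lambda>y. dircos p y * dircos q y) + (p \<bullet> q) * wint (\<lambda>y. dircos u y * dircos u y))"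
    by (simp only: wint_diff wint_add wint_cmult b bounded_borel_add)
  then show ?thesis
    unfolding second_moment fourth_moment by (simp add: power2_norm_eq_inner field_simps)
qed

end


section \<open>The operator as a Fourier multiplier\<close>

text \<open>The mass has to be positive because it becomes the denominator of the averages.\<close>

lemma shell_weight_mass_pos:
  assumes \<gamma>: "\<gamma> > 0"
  shows "integrable lborel (shell_weight \<gamma>)" and "(\<integral>y. shell_weight \<gamma> y \<partial>lborel) > 0"
proof -
  have ic: "integrable lborel (indicator (cball 0 2) :: real^3 \<Rightarrow> real)"
    by (intro integrable_real_indicator emeasure_bounded_finite bounded_cball) simp
  have ae: "AE y in lborel. norm (shell_weight \<gamma> y) \<le> norm (indicator (cball 0 2) y :: real)"
  proof (rule AE_I2)
    fix y :: "real^3"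
    show "norm (shell_weight \<gamma> y) \<le> norm (indicator (cball 0 2) y :: real)"
    proof (cases "norm y \<le> 2")
      case True
      then show ?thesis using shell_weight_le_1[OF \<gamma>, of y] shell_weight_nonneg[of \<gamma> y] by simp
    next
      case False
      then show ?thesis by (simp add: shell_weight_def)
    qed
  qed
  have m: "shell_weight \<gamma> \<in> borel_measurable lborel" by simp
  show i: "integrable lborel (shell_weight \<gamma>)"
    by (rule Bochner_Integration.integrable_bound[OF ic m ae])
  \<comment> \<open>the ball of radius \<open>1/4\<close> about a point of the middle sphere stays inside the shell\<close>
  define z :: "real^3" where "z = (3/2) *\<^sub>R axis 1 1"
  have nz: "norm z = 3/2" by (simp add: z_def)
  have ib: "integrable lborel (indicator (ball z (1/4)) :: real^3 \<Rightarrow> real)"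
    by (intro integrable_real_indicator emeasure_bounded_finite bounded_ball) simp
  have "2 powr (- 2 * \<gamma>) * indicator (ball z (1/4)) y \<le> shell_weight \<gamma> y" for y
  proof (cases "y \<in> ball z (1/4)")
    case True
    then have "norm (z - y) < 1/4" by (simp add: dist_norm)
    then have y: "1 \<le> norm y \<and> norm y \<le> 2"
      using norm_triangle_ineq2[of z y] norm_triangle_ineq2[of y z] nz by (simp add: norm_minus_commute)
    then have "2 powr (- 2 * \<gamma>) \<le> norm y powr (- 2 * \<gamma>)"
      using \<gamma> by (intro powr_mono2') auto
    with True show ?thesis unfolding shell_weight_def if_P[OF y] by simp
  next
    case False
    then show ?thesis by (simp add: shell_weight_nonneg)
  qed
  then have "(\<integral>y. 2 powr (- 2 * \<gamma>) * indicator (ball z (1/4)) y \<partial>lborel) \<le> (\<integral>y. shell_weight \<gamma> y \<partial>lborel)"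
    by (intro integral_mono integrable_mult_right ib i)
  moreover have "(\<integral>y. 2 powr (- 2 * \<gamma>) * indicator (ball z (1/4)) y \<partial>lborel) = 2 powr (- 2 * \<gamma>) * measure lborel (ball z (1/4))"
    by simp
  moreover have "0 < 2 powr (- 2 * \<gamma>) * measure lborel (ball z (1/4))"
    by (intro mult_pos_pos content_ball_pos) simp_all
  ultimately show "(\<integral>y. shell_weight \<gamma> y \<partial>lborel) > 0" by linarith
qed

lemma radial_weight_shell: "\<gamma> > 0 \<Longrightarrow> radial_weight (shell_weight \<gamma>)"
  by unfold_locales (simp_all add: shell_weight_mass_pos, simp_all add: shell_weight_def)

lemma dircos_scaleR_right: "s > 0 \<Longrightarrow> dircos u (s *\<^sub>R y) = dircos u y"
  by (simp add: dircos_def)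

lemma proj_entry_dircos:
  "proj_entry y i j = axis i 1 \<bullet> (axis j 1 :: real^3) - dircos (axis i 1) y * dircos (axis j 1) y"
  by (simp add: proj_entry_def dircos_axis inner_axis_axis power2_eq_square)

lemma proj_entry_scaleR: "s > 0 \<Longrightarrow> proj_entry (s *\<^sub>R y) i j = proj_entry y i j"
  by (simp add: proj_entry_dircos dircos_scaleR_right)

lemma proj_entry_uminus: "proj_entry (- y) i j = proj_entry y i j"
  by (simp add: proj_entry_def)

lemma dircos_tendsto:
  assumes "y \<noteq> 0" "u \<longlonglongrightarrow> y" shows "(\<lambda>N. dircos b (u N)) \<longlonglongrightarrow> dircos b y"
  unfolding dircos_def using assms by (intro tendsto_intros) auto

text \<open>Entry of the \<open>\<theta>\<^sup>2\<close>-weighted average over \<open>k\<close> of \<open>(|l|\<^sup>2 - (l \<cdot> k)\<^sup>2/|k|\<^sup>2) P\<^bsub>l-k\<^esub>\<close>. The ball of radius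
  \<open>2 N\<close> contains the support of the weight.\<close>

definition entry_average :: "real \<Rightarrow> nat \<Rightarrow> int^3 \<Rightarrow> 3 \<Rightarrow> 3 \<Rightarrow> real" where
  "entry_average \<gamma> N l i j = (\<Sum>k\<in>{k. norm (lat k) \<le> 2 * real N}.
      (thetaN \<gamma> N k)\<^sup>2 * (((norm (lat l))\<^sup>2 - (dircos (lat l) (lat k))\<^sup>2) * proj_entry (lat (l - k)) i j))
    / (\<Sum>k\<in>{k. norm (lat k) \<le> 2 * real N}. (thetaN \<gamma> N k)\<^sup>2)"

lemma abs_symbol_le: "\<bar>((norm u)\<^sup>2 - (dircos u x)\<^sup>2) * proj_entry y i j\<bar> \<le> 2 * (norm u)\<^sup>2"
proof -
  have "(dircos u x)\<^sup>2 \<le> (norm u)\<^sup>2"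
    using abs_dircos_le[of u x] by (simp add: abs_le_square_iff[symmetric])
  then have "\<bar>(norm u)\<^sup>2 - (dircos u x)\<^sup>2\<bar> \<le> (norm u)\<^sup>2" by simp
  then have "\<bar>(norm u)\<^sup>2 - (dircos u x)\<^sup>2\<bar> * \<bar>proj_entry y i j\<bar> \<le> (norm u)\<^sup>2 * 2"
    by (intro mult_mono abs_proj_entry_le) auto
  then show ?thesis by (simp add: abs_mult mult.commute)
qed

lemma entry_average_bound: "\<bar>entry_average \<gamma> N l i j\<bar> \<le> 2 * (norm (lat l))\<^sup>2"
proof -
  define K where "K = {k. norm (lat k) \<le> 2 * real N}"
  define S where "S = (\<Sum>k\<in>K. (thetaN \<gamma> N k)\<^sup>2)"
  have "\<bar>\<Sum>k\<in>K. (thetaN \<gamma> N k)\<^sup>2 * (((norm (lat l))\<^sup>2 - (dircos (lat l) (lat k))\<^sup>2) * proj_entry (lat (l - k)) i j)\<bar>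
      \<le> (\<Sum>k\<in>K. \<bar>(thetaN \<gamma> N k)\<^sup>2 * (((norm (lat l))\<^sup>2 - (dircos (lat l) (lat k))\<^sup>2) * proj_entry (lat (l - k)) i j)\<bar>)"
    by (rule sum_abs)
  also have "\<dots> \<le> (\<Sum>k\<in>K. (thetaN \<gamma> N k)\<^sup>2 * (2 * (norm (lat l))\<^sup>2))"
    unfolding abs_mult[of "(thetaN \<gamma> N _)\<^sup>2"] abs_power2 by (intro sum_mono mult_left_mono abs_symbol_le) simp
  also have "\<dots> = S * (2 * (norm (lat l))\<^sup>2)" by (simp add: S_def sum_distrib_right)
  finally have num: "\<bar>\<Sum>k\<in>K. (thetaN \<gamma> N k)\<^sup>2 * (((norm (lat l))\<^sup>2 - (dircos (lat l) (lat k))\<^sup>2) * proj_entry (lat (l - k)) i j)\<bar>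
      \<le> S * (2 * (norm (lat l))\<^sup>2)" .
  have "0 \<le> S" unfolding S_def by (intro sum_nonneg) simp
  show ?thesis
  proof (cases "S = 0")
    case True
    then show ?thesis by (simp add: entry_average_def K_def[symmetric] S_def[symmetric])
  next
    case False
    with \<open>0 \<le> S\<close> have "S > 0" by simp
    with num show ?thesis
      unfolding entry_average_def K_def[symmetric] S_def[symmetric] abs_divide
      by (simp add: pos_divide_le_eq mult.commute)
  qed
qed

text \<open>The summand is homogeneous of degree zero in \<open>(k, k - l)\<close>, so both can be divided by \<open>N\<close>. The
  factor \<open>N\<^bsup>-2\<gamma>\<^esup>\<close> of the weights and the volume of the cells cancel in the quotient.\<close>

theorem entry_average_tendsto:
  assumes \<gamma>: "\<gamma> > 0"
  shows "(\<lambda>N. entry_average \<gamma> (Suc N) l i j)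
    \<longlonglongrightarrow> 2/5 * (norm (lat l))\<^sup>2 * (axis i 1 \<bullet> (axis j 1 :: real^3)) + 2/15 * lat l $ i * lat l $ j"
proof -
  interpret radial_weight "shell_weight \<gamma>" by (rule radial_weight_shell[OF \<gamma>])
  define h where "h x y = ((norm (lat l))\<^sup>2 - (dircos (lat l) x)\<^sup>2) * proj_entry y i j" for x y
  define K where "K N = {k. norm (lat k) \<le> 2 * real (Suc N)}" for N
  define W where "W N k = shell_weight \<gamma> (lat k /\<^sub>R real (Suc N))" for N k
  have [measurable]: "dircos u \<in> borel_measurable borel" for u
    using bounded_borel_dircos by (simp add: bounded_borel_def)
  have hm: "(\<lambda>y. h y y) \<in> borel_measurable borel"
    unfolding h_def proj_entry_dircos by measurable
  have hc: "(\<lambda>N. h (u N) (w N)) \<longlonglongrightarrow> h y y" if "y \<noteq> 0" "u \<longlonglongrightarrow> y" "w \<longlonglongrightarrow> y" for y u w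
    unfolding h_def proj_entry_dircos using that by (intro tendsto_intros dircos_tendsto)
  have num: "(\<lambda>N. (\<Sum>k\<in>K N. W N k * h (lat k /\<^sub>R real (Suc N)) (lat (k - l) /\<^sub>R real (Suc N))) / real (Suc N) ^ 3) \<longlonglongrightarrow> wint (\<lambda>y. h y y)"
    unfolding wint_def K_def W_def
    by (rule shell_lattice_sum_tendsto[where h = h and C = "2 * (norm (lat l))\<^sup>2"])
       (rule \<gamma>, unfold h_def, rule abs_symbol_le, fold h_def, rule hc, assumption+, rule hm)
  have den: "(\<lambda>N. (\<Sum>k\<in>K N. W N k * 1) / real (Suc N) ^ 3) \<longlonglongrightarrow> wint (\<lambda>y. 1)"
    unfolding wint_def K_def W_def
    by (rule shell_lattice_sum_tendsto[where h = "\<lambda>_ _. 1" and C = 1]) (simp_all add: \<gamma> tendsto_const)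
  have E1: "wint (\<lambda>y. 1) > 0" using shell_weight_mass_pos(2)[OF \<gamma>] by (simp add: wint_def)
  have hk: "h (lat k /\<^sub>R real (Suc N)) (lat (k - l) /\<^sub>R real (Suc N)) = h (lat k) (lat (l - k))" for N k
  proof -
    have "proj_entry (lat (k - l)) i j = proj_entry (lat (l - k)) i j"
      using proj_entry_uminus[of "lat (l - k)" i j] by (simp add: lat_diff)
    then show ?thesis by (simp add: h_def dircos_scaleR_right proj_entry_scaleR del: of_nat_Suc)
  qed
  have "entry_average \<gamma> (Suc N) l i j = ((\<Sum>k\<in>K N. W N k * h (lat k /\<^sub>R real (Suc N)) (lat (k - l) /\<^sub>R real (Suc N))) / real (Suc N) ^ 3)
      / ((\<Sum>k\<in>K N. W N k * 1) / real (Suc N) ^ 3)" for N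
  proof -
    define s where "s = real (Suc N) powr (- 2 * \<gamma>)"
    have s: "s \<noteq> 0" by (simp add: s_def del: of_nat_Suc)
    have \<theta>: "(thetaN \<gamma> (Suc N) k)\<^sup>2 = s * W N k" for k
      unfolding s_def W_def by (rule thetaN_square) simp
    have "entry_average \<gamma> (Suc N) l i j = (s * (\<Sum>k\<in>K N. W N k * h (lat k) (lat (l - k)))) / (s * (\<Sum>k\<in>K N. W N k))"
      unfolding entry_average_def \<theta> K_def[symmetric] h_def[symmetric] by (simp only: sum_distrib_left mult.assoc)
    then show ?thesis unfolding hk using s by simp
  qed
  moreover have "wint (\<lambda>y. h y y) = wint (\<lambda>y. 1) * (2/5 * (norm (lat l))\<^sup>2 * (axis i 1 \<bullet> (axis j 1 :: real^3)) + 2/15 * lat l $ i * lat l $ j)"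
    unfolding h_def proj_entry_dircos projected_moment by (simp add: inner_axis)
  ultimately show ?thesis
    using tendsto_divide[OF num den] E1 by simp
qed

lemma entry_average_uminus: "entry_average \<gamma> N (- l) i j = entry_average \<gamma> N l i j"
proof -
  let ?K = "{k. norm (lat k) \<le> 2 * real N}"
  have th: "thetaN \<gamma> N (- k) = thetaN \<gamma> N k" for k by (simp add: thetaN_def lat_minus)
  have dc: "(dircos (lat (- l)) (lat (- k)))\<^sup>2 = (dircos (lat l) (lat k))\<^sup>2" for k
    by (simp add: dircos_def lat_minus)
  have pe: "proj_entry (lat (- l - (- k))) i j = proj_entry (lat (l - k)) i j" for k
    using proj_entry_uminus[of "lat (l - k)" i j] by (simp add: lat_diff lat_minus)
  have "(\<Sum>k\<in>?K. (thetaN \<gamma> N k)\<^sup>2 * (((norm (lat (- l)))\<^sup>2 - (dircos (lat (- l)) (lat k))\<^sup>2) * proj_entry (lat (- l - k)) i j))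
      = (\<Sum>k\<in>?K. (thetaN \<gamma> N (- k))\<^sup>2 * (((norm (lat (- l)))\<^sup>2 - (dircos (lat (- l)) (lat (- k)))\<^sup>2) * proj_entry (lat (- l - (- k))) i j))"
    by (rule sum.reindex_bij_witness[where i = uminus and j = uminus]) (simp_all add: lat_minus)
  also have "\<dots> = (\<Sum>k\<in>?K. (thetaN \<gamma> N k)\<^sup>2 * (((norm (lat l))\<^sup>2 - (dircos (lat l) (lat k))\<^sup>2) * proj_entry (lat (l - k)) i j))"
    unfolding th dc pe by (simp add: lat_minus)
  finally show ?thesis unfolding entry_average_def by (rule arg_cong)
qed

text \<open>The constant is \<open>4 \<pi>\<^sup>2 C\<^sub>\<nu>\<^sup>2\<close> with \<open>C\<^sub>\<nu>\<^sup>2 = 3 \<nu>/2\<close>.\<close>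

definition S_symbol :: "real \<Rightarrow> real \<Rightarrow> nat \<Rightarrow> int^3 \<Rightarrow> complex^3 \<Rightarrow> complex^3" where
  "S_symbol \<nu> \<gamma> N l z = complex_of_real (- (6 * pi\<^sup>2 * \<nu>)) *s
     proj (lat l) (\<chi> i. \<Sum>j\<in>UNIV. complex_of_real (entry_average \<gamma> N l i j) * z $ j)"

lemma l2_norm_thetaN:
  assumes "N \<ge> 1"
  shows "(l2_norm (thetaN \<gamma> N))\<^sup>2 = (\<Sum>k\<in>{k. norm (lat k) \<le> 2 * real N}. (thetaN \<gamma> N k)\<^sup>2)"
proof -
  let ?K = "{k. norm (lat k) \<le> 2 * real N}"
  have "(\<Sum>\<^sub>\<infinity>k\<in>Z0. (thetaN \<gamma> N k)\<^sup>2) = (\<Sum>\<^sub>\<infinity>k\<in>?K. (thetaN \<gamma> N k)\<^sup>2)"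
    by (rule infsum_cong_neutral) (use assms in \<open>auto simp: Z0_def thetaN_def\<close>)
  also have "\<dots> = (\<Sum>k\<in>?K. (thetaN \<gamma> N k)\<^sup>2)"
    by (rule infsum_finite) (rule finite_lattice_ball)
  finally show ?thesis
    unfolding l2_norm_def by (simp add: sum_nonneg)
qed

text \<open>Each summand acts on the coefficients by \<open>leray_advect_twice\<close>; the two directions of a frame add
  up by \<open>sum_frame_squares\<close>, and dividing by the squared norm of \<open>\<theta>\<close> turns the sum over \<open>k\<close> into an
  average.\<close>

theorem S_op_fser:
  assumes hp: "half_partition Zp Zm" and ff: "frame_family Zp a" and N: "N \<ge> 1" and \<nu>: "\<nu> > 0" and c: "vrapid c"
  shows "S_op \<nu> a (thetaN \<gamma> N) (fser c) = fser (\<lambda>l. S_symbol \<nu> \<gamma> N l (c l))"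
    and "vrapid (\<lambda>l. S_symbol \<nu> \<gamma> N l (c l))"
proof -
  define K where "K = {k. norm (lat k) \<le> 2 * real N}"
  define K' where "K' = K - {0}"
  define \<theta> where "\<theta> = thetaN \<gamma> N"
  define \<Theta> where "\<Theta> = (\<Sum>k\<in>K. (\<theta> k)\<^sup>2)"
  have fK: "finite K" unfolding K_def by (rule finite_lattice_ball)
  then have fK': "finite K'" by (simp add: K'_def)
  have \<theta>0: "\<theta> 0 = 0" using N by (simp add: \<theta>_def thetaN_def)
  have \<theta>K: "\<theta> k = 0" if "k \<notin> K" for k using that by (simp add: \<theta>_def thetaN_def K_def)
  define D where "D k \<alpha> l = complex_of_real (- (4 * pi\<^sup>2) * (a k \<alpha> \<bullet> lat l)\<^sup>2) *s proj (lat l) (proj (lat (l - k)) (c l))" for k \<alpha> l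
  have lat2: "leray (advect (sigma a k \<alpha>) (leray (advect (sigma a (- k) \<alpha>) (fser c)))) = fser (D k \<alpha>)" "vrapid (D k \<alpha>)"
    if k: "k \<in> Z0" and \<alpha>: "\<alpha> \<in> {1, 2}" for k \<alpha>
  proof -
    have "a k \<alpha> \<in> span {a k 1, a k 2}" using \<alpha> by (auto intro: span_base)
    then have orth: "a k \<alpha> \<bullet> lat k = 0" using frame_family_Z0(4)[OF hp ff k] by simp
    have sym: "a (- k) \<alpha> = a k \<alpha>" by (rule frame_family_Z0(5)[OF hp ff k \<alpha>])
    show "leray (advect (sigma a k \<alpha>) (leray (advect (sigma a (- k) \<alpha>) (fser c)))) = fser (D k \<alpha>)" "vrapid (D k \<alpha>)"
      using leray_advect_twice[where a = a and k = k and \<alpha> = \<alpha>, OF c orth sym] by (simp_all only: D_def[abs_def])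
  qed
  have KZ: "k \<in> Z0" if "k \<in> K'" for k using that by (simp add: K'_def Z0_def)
  define s where "s k = (C_nu \<nu>)\<^sup>2 / \<Theta> * (\<theta> k)\<^sup>2" for k
  define m where "m l = (\<Sum>k\<in>K'. \<Sum>\<alpha>\<in>{1, 2::nat}. complex_of_real (s k) *s D k \<alpha> l)" for l
  have m_nth: "(\<lambda>l. m l $ i) = (\<lambda>l. \<Sum>k\<in>K'. \<Sum>\<alpha>\<in>{1, 2::nat}. complex_of_real (s k) * D k \<alpha> l $ i)" for i
    by (rule ext) (simp add: m_def)
  have rD: "rapid (\<lambda>l. complex_of_real (s k) * D k \<alpha> l $ i)" if "k \<in> K'" "\<alpha> \<in> {1, 2}" for k \<alpha> i
    by (intro rapid_cmult vrapidD lat2(2) KZ that)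
  have rm: "rapid (\<lambda>l. m l $ i)" for i
    unfolding m_nth by (intro rapid_sum rD)
  have Sm: "S_op \<nu> a \<theta> (fser c) = fser m"
  proof (rule ext, unfold vec_eq_iff, intro allI)
    fix x i
    have "(\<Sum>\<^sub>\<infinity>k\<in>Z0. \<Sum>\<alpha>\<in>{1, 2}. (\<theta> k)\<^sup>2 *\<^sub>R leray (advect (sigma a k \<alpha>) (leray (advect (sigma a (- k) \<alpha>) (fser c)))) x)
        = (\<Sum>\<^sub>\<infinity>k\<in>K'. \<Sum>\<alpha>\<in>{1, 2}. (\<theta> k)\<^sup>2 *\<^sub>R fser (D k \<alpha>) x)"
    proof (rule infsum_cong_neutral)
      fix k assume "k \<in> K' - Z0"
      then show "(\<Sum>\<alpha>\<in>{1, 2}. (\<theta> k)\<^sup>2 *\<^sub>R fser (D k \<alpha>) x) = 0" using KZ by blast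
    next
      fix k assume "k \<in> Z0 - K'"
      then have "k \<notin> K" by (auto simp: K'_def Z0_def)
      then show "(\<Sum>\<alpha>\<in>{1, 2}. (\<theta> k)\<^sup>2 *\<^sub>R leray (advect (sigma a k \<alpha>) (leray (advect (sigma a (- k) \<alpha>) (fser c)))) x) = 0"
        by (simp add: \<theta>K)
    next
      fix k assume "k \<in> Z0 \<inter> K'"
      then show "(\<Sum>\<alpha>\<in>{1, 2}. (\<theta> k)\<^sup>2 *\<^sub>R leray (advect (sigma a k \<alpha>) (leray (advect (sigma a (- k) \<alpha>) (fser c)))) x)
          = (\<Sum>\<alpha>\<in>{1, 2}. (\<theta> k)\<^sup>2 *\<^sub>R fser (D k \<alpha>) x)"
        by (intro sum.cong refl) (simp only: lat2(1) Int_iff)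
    qed
    also have "\<dots> = (\<Sum>k\<in>K'. \<Sum>\<alpha>\<in>{1, 2}. (\<theta> k)\<^sup>2 *\<^sub>R fser (D k \<alpha>) x)"
      by (rule infsum_finite[OF fK'])
    finally have "S_op \<nu> a \<theta> (fser c) x = ((C_nu \<nu>)\<^sup>2 / \<Theta>) *\<^sub>R (\<Sum>k\<in>K'. \<Sum>\<alpha>\<in>{1, 2}. (\<theta> k)\<^sup>2 *\<^sub>R fser (D k \<alpha>) x)"
      unfolding S_op_def \<Theta>_def \<theta>_def K_def l2_norm_thetaN[OF N] by (simp only:)
    then have "S_op \<nu> a \<theta> (fser c) x $ i = (\<Sum>k\<in>K'. \<Sum>\<alpha>\<in>{1, 2}. complex_of_real (s k) * tser (\<lambda>l. D k \<alpha> l $ i) x)"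
      by (simp only: scaleR_sum_right sum_component vector_scaleR_component scaleR_scaleR s_def[symmetric] scaleR_conv_of_real[where 'a = complex] fser_nth)
    also have "\<dots> = tser (\<lambda>l. m l $ i) x"
    proof -
      have "tser (\<lambda>l. m l $ i) x = (\<Sum>k\<in>K'. tser (\<lambda>l. \<Sum>\<alpha>\<in>{1, 2::nat}. complex_of_real (s k) * D k \<alpha> l $ i) x)"
        unfolding m_nth by (intro tser_sum rapid_sum rD)
      also have "\<dots> = (\<Sum>k\<in>K'. \<Sum>\<alpha>\<in>{1, 2}. tser (\<lambda>l. complex_of_real (s k) * D k \<alpha> l $ i) x)"
        by (intro sum.cong refl tser_sum rD)
      finally show ?thesis by (simp only: tser_cmult)
    qed
    finally show "S_op \<nu> a \<theta> (fser c) x $ i = fser m x $ i" by (simp only: fser_nth)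
  qed
  have "m l = S_symbol \<nu> \<gamma> N l (c l)" for l
  proof -
    define q where "q k = (norm (lat l))\<^sup>2 - (dircos (lat l) (lat k))\<^sup>2" for k
    have qs: "(\<Sum>\<alpha>\<in>{1, 2::nat}. complex_of_real (s k) *s D k \<alpha> l)
        = proj (lat l) (complex_of_real (s k * (- (4 * pi\<^sup>2) * q k)) *s proj (lat (l - k)) (c l))" if "k \<in> K'" for k
    proof -
      have "(a k 1 \<bullet> lat l)\<^sup>2 + (a k 2 \<bullet> lat l)\<^sup>2 = (norm (lat l))\<^sup>2 - (lat k \<bullet> lat l)\<^sup>2 / (norm (lat k))\<^sup>2"
        using frame_family_Z0(1-4)[OF hp ff KZ[OF that]] that
        by (intro sum_frame_squares) (simp_all add: K'_def)
      then have q: "(a k 1 \<bullet> lat l)\<^sup>2 + (a k 2 \<bullet> lat l)\<^sup>2 = q k"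
        by (simp add: q_def dircos_def power_divide inner_commute)
      have "(\<Sum>\<alpha>\<in>{1, 2::nat}. complex_of_real (s k) *s D k \<alpha> l)
          = complex_of_real (s k * (- (4 * pi\<^sup>2) * ((a k 1 \<bullet> lat l)\<^sup>2 + (a k 2 \<bullet> lat l)\<^sup>2))) *s proj (lat l) (proj (lat (l - k)) (c l))"
        by (simp add: D_def vec_eq_iff algebra_simps)
      then show ?thesis by (simp only: q proj_cmult)
    qed
    have "m l = proj (lat l) (\<Sum>k\<in>K'. complex_of_real (s k * (- (4 * pi\<^sup>2) * q k)) *s proj (lat (l - k)) (c l))"
      unfolding m_def proj_sum by (rule sum.cong[OF refl]) (rule qs)
    also have "(\<Sum>k\<in>K'. complex_of_real (s k * (- (4 * pi\<^sup>2) * q k)) *s proj (lat (l - k)) (c l))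
        = complex_of_real (- (6 * pi\<^sup>2 * \<nu>)) *s (\<chi> i. \<Sum>j\<in>UNIV. complex_of_real (entry_average \<gamma> N l i j) * c l $ j)"
    proof (unfold vec_eq_iff, intro allI)
      fix i
      have ea: "(\<Sum>k\<in>K'. s k * (- (4 * pi\<^sup>2) * q k) * proj_entry (lat (l - k)) i j) = - (6 * pi\<^sup>2 * \<nu>) * entry_average \<gamma> N l i j" for j
      proof -
        have "(C_nu \<nu>)\<^sup>2 = 3 * \<nu> / 2" using \<nu> by (simp add: C_nu_def)
        then have "(\<Sum>k\<in>K'. s k * (- (4 * pi\<^sup>2) * q k) * proj_entry (lat (l - k)) i j)
            = (\<Sum>k\<in>K'. - (6 * pi\<^sup>2 * \<nu>) * ((\<theta> k)\<^sup>2 * (q k * proj_entry (lat (l - k)) i j) / \<Theta>))"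
          by (intro sum.cong refl) (simp add: s_def)
        also have "\<dots> = (\<Sum>k\<in>K. - (6 * pi\<^sup>2 * \<nu>) * ((\<theta> k)\<^sup>2 * (q k * proj_entry (lat (l - k)) i j) / \<Theta>))"
          by (rule sum.mono_neutral_left[OF fK]) (auto simp: K'_def \<theta>0)
        also have "\<dots> = - (6 * pi\<^sup>2 * \<nu>) * ((\<Sum>k\<in>K. (\<theta> k)\<^sup>2 * (q k * proj_entry (lat (l - k)) i j)) / \<Theta>)"
          by (simp only: sum_distrib_left sum_divide_distrib)
        finally show ?thesis by (simp only: entry_average_def \<Theta>_def \<theta>_def K_def q_def)
      qed
      have "(\<Sum>k\<in>K'. complex_of_real (s k * (- (4 * pi\<^sup>2) * q k)) *s proj (lat (l - k)) (c l)) $ i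
          = (\<Sum>k\<in>K'. \<Sum>j\<in>UNIV. complex_of_real (s k * (- (4 * pi\<^sup>2) * q k) * proj_entry (lat (l - k)) i j) * c l $ j)"
        by (simp only: sum_component vector_smult_component proj_def vec_lambda_beta sum_distrib_left of_real_mult mult.assoc)
      also have "\<dots> = (\<Sum>j\<in>UNIV. \<Sum>k\<in>K'. complex_of_real (s k * (- (4 * pi\<^sup>2) * q k) * proj_entry (lat (l - k)) i j) * c l $ j)"
        by (rule sum.swap)
      also have "\<dots> = (\<Sum>j\<in>UNIV. complex_of_real (- (6 * pi\<^sup>2 * \<nu>) * entry_average \<gamma> N l i j) * c l $ j)"
        by (simp only: sum_distrib_right[symmetric] of_real_sum[symmetric] ea)
      also have "\<dots> = (complex_of_real (- (6 * pi\<^sup>2 * \<nu>)) *s (\<chi> i. \<Sum>j\<in>UNIV. complex_of_real (entry_average \<gamma> N l i j) * c l $ j)) $ i"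
        by (simp only: vector_smult_component vec_lambda_beta sum_distrib_left of_real_mult mult.assoc)
      finally show "(\<Sum>k\<in>K'. complex_of_real (s k * (- (4 * pi\<^sup>2) * q k)) *s proj (lat (l - k)) (c l)) $ i
        = (complex_of_real (- (6 * pi\<^sup>2 * \<nu>)) *s (\<chi> i. \<Sum>j\<in>UNIV. complex_of_real (entry_average \<gamma> N l i j) * c l $ j)) $ i" .
    qed
    finally show ?thesis by (simp only: S_symbol_def proj_cmult)
  qed
  then have mS: "m = (\<lambda>l. S_symbol \<nu> \<gamma> N l (c l))" by (rule ext)
  show "S_op \<nu> a (thetaN \<gamma> N) (fser c) = fser (\<lambda>l. S_symbol \<nu> \<gamma> N l (c l))"
    using Sm unfolding \<theta>_def mS .
  show "vrapid (\<lambda>l. S_symbol \<nu> \<gamma> N l (c l))"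
    using rm unfolding vrapid_def mS by blast
qed

section \<open>Convergence of the operators\<close>

lemma fser_real:
  assumes c: "vrapid c" and sym: "\<And>l i. c (- l) $ i = cnj (c l $ i)"
  shows "fser c \<in> L2_T3_real"
  unfolding L2_T3_real_def
proof (intro CollectI conjI allI)
  show "fser c \<in> L2_T3" by (intro L2_T3_continuous continuous_fser periodic_fser c)
  fix x i
  have "cnj (fser c x $ i) = fser c x $ i"
    by (simp only: fser_nth cnj_tser sym complex_cnj_cnj)
  then show "fser c x $ i \<in> \<real>" by (simp only: Reals_cnj_iff)
qed

lemma S_symbol_cnj:
  assumes "\<And>i. z' $ i = cnj (z $ i)"
  shows "S_symbol \<nu> \<gamma> N (- l) z' $ i = cnj (S_symbol \<nu> \<gamma> N l z $ i)"
  by (simp add: S_symbol_def proj_def proj_entry_uminus lat_minus entry_average_uminus assms)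

text \<open>The limit matrix is \<open>2/5 |l|\<^sup>2 I + 2/15 l l\<^sup>T\<close>. The rank one part annihilates vectors orthogonal
  to \<open>l\<close>, and the projection leaves the scalar multiple of such a vector unchanged.\<close>

lemma S_symbol_tendsto:
  assumes \<gamma>: "\<gamma> > 0" and z: "cdot (lat l) z = 0"
  shows "(\<lambda>N. S_symbol \<nu> \<gamma> (Suc N) l z $ i) \<longlonglongrightarrow> complex_of_real (- (12 / 5 * pi\<^sup>2 * \<nu> * (norm (lat l))\<^sup>2)) * z $ i"
proof -
  define L where "L r j = 2/5 * (norm (lat l))\<^sup>2 * (axis r 1 \<bullet> (axis j 1 :: real^3)) + 2/15 * lat l $ r * lat l $ j" for r j
  have "(\<lambda>N. S_symbol \<nu> \<gamma> (Suc N) l z $ i) \<longlonglongrightarrow> complex_of_real (- (6 * pi\<^sup>2 * \<nu>)) *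
      (\<Sum>r\<in>UNIV. complex_of_real (proj_entry (lat l) i r) * (\<Sum>j\<in>UNIV. complex_of_real (L r j) * z $ j))"
    unfolding S_symbol_def vector_smult_component proj_def vec_lambda_beta L_def
    by (intro tendsto_mult tendsto_const tendsto_sum tendsto_of_real entry_average_tendsto \<gamma>)
  moreover have "(\<Sum>j\<in>UNIV. complex_of_real (L r j) * z $ j) = complex_of_real (2/5 * (norm (lat l))\<^sup>2) * z $ r" for r
  proof -
    have "complex_of_real (L r j) * z $ j = complex_of_real (2/5 * (norm (lat l))\<^sup>2) * (complex_of_real (if r = j then 1 else 0) * z $ j)
        + complex_of_real (2/15 * lat l $ r) * (complex_of_real (lat l $ j) * z $ j)" for j
      by (simp add: L_def inner_axis_axis algebra_simps)
    then have "(\<Sum>j\<in>UNIV. complex_of_real (L r j) * z $ j) = complex_of_real (2/5 * (norm (lat l))\<^sup>2) * z $ r + complex_of_real (2/15 * lat l $ r) * cdot (lat l) z"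
      by (simp only: sum.distrib sum_distrib_left[symmetric] sum_delta_entry cdot_def)
    then show ?thesis by (simp only: z mult_zero_right add_0_right)
  qed
  moreover have "(\<Sum>r\<in>UNIV. complex_of_real (proj_entry (lat l) i r) * (w * z $ r)) = w * z $ i" for w
  proof -
    have "(\<Sum>r\<in>UNIV. complex_of_real (proj_entry (lat l) i r) * (w * z $ r)) = w * proj (lat l) z $ i"
      by (simp add: proj_def sum_distrib_left mult_ac)
    then show ?thesis by (simp add: proj_nth z)
  qed
  moreover have "complex_of_real (- (6 * pi\<^sup>2 * \<nu>)) * (complex_of_real (2/5 * (norm (lat l))\<^sup>2) * z $ i)
      = complex_of_real (- (12 / 5 * pi\<^sup>2 * \<nu> * (norm (lat l))\<^sup>2)) * z $ i"
    by simp
  ultimately show ?thesis by (simp only:)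
qed

lemma S_symbol_bound:
  assumes \<nu>: "\<nu> > 0"
  shows "norm (S_symbol \<nu> \<gamma> N l z $ i) \<le> 72 * pi\<^sup>2 * \<nu> * (norm (lat l))\<^sup>2 * (\<Sum>j\<in>UNIV. norm (z $ j))"
proof -
  define s where "s = (\<Sum>j\<in>UNIV. norm (z $ j))"
  have 1: "norm (\<Sum>j\<in>UNIV. complex_of_real (entry_average \<gamma> N l r j) * z $ j) \<le> 2 * (norm (lat l))\<^sup>2 * s" for r
    unfolding s_def sum_distrib_left
    by (intro order_trans[OF norm_sum] sum_mono)
       (simp add: norm_mult mult_right_mono entry_average_bound)
  have "norm (\<Sum>r\<in>UNIV. complex_of_real (proj_entry (lat l) i r) * (\<Sum>j\<in>UNIV. complex_of_real (entry_average \<gamma> N l r j) * z $ j))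
      \<le> (\<Sum>r\<in>(UNIV :: 3 set). 2 * (2 * (norm (lat l))\<^sup>2 * s))"
  proof (intro order_trans[OF norm_sum] sum_mono)
    fix r
    show "norm (complex_of_real (proj_entry (lat l) i r) * (\<Sum>j\<in>UNIV. complex_of_real (entry_average \<gamma> N l r j) * z $ j))
        \<le> 2 * (2 * (norm (lat l))\<^sup>2 * s)"
      unfolding norm_mult norm_of_real by (rule mult_mono[OF abs_proj_entry_le 1]) auto
  qed
  then have "6 * pi\<^sup>2 * \<nu> * norm (\<Sum>r\<in>UNIV. complex_of_real (proj_entry (lat l) i r) * (\<Sum>j\<in>UNIV. complex_of_real (entry_average \<gamma> N l r j) * z $ j))
      \<le> 6 * pi\<^sup>2 * \<nu> * (12 * (norm (lat l))\<^sup>2 * s)"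
    using \<nu> by (intro mult_left_mono) simp_all
  moreover have "norm (complex_of_real (- (6 * pi\<^sup>2 * \<nu>))) = 6 * pi\<^sup>2 * \<nu>"
    unfolding norm_of_real using \<nu> by simp
  ultimately show ?thesis
    unfolding S_symbol_def vector_smult_component proj_def vec_lambda_beta norm_mult s_def[symmetric] by (simp add: mult_ac)
qed

text \<open>Dominated convergence for sums over an arbitrary index set: outside a finite set the terms are
  controlled by the tail of the majorant.\<close>

lemma infsum_norm_tendsto_0:
  fixes f :: "nat \<Rightarrow> 'a \<Rightarrow> 'b::real_normed_vector"
  assumes g: "g summable_on UNIV" and bound: "\<And>N l. norm (f N l) \<le> g l" and lim: "\<And>l. (\<lambda>N. f N l) \<longlonglongrightarrow> 0"
  shows "(\<lambda>N. \<Sum>\<^sub>\<infinity>l. norm (f N l)) \<longlonglongrightarrow> 0"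
proof (rule LIMSEQ_I)
  fix e :: real assume e: "0 < e"
  define s where "s = (\<Sum>\<^sub>\<infinity>l. g l)"
  have sf: "(\<lambda>l. norm (f N l)) summable_on UNIV" for N
    by (rule summable_on_comparison_test[OF g]) (auto simp: bound)
  obtain F where F: "finite F" "dist (sum g F) s \<le> e / 2"
    using has_sum_finite_approximation[OF has_sum_infsum[OF g], of "e / 2"] e by (auto simp: s_def)
  have "(\<lambda>N. \<Sum>l\<in>F. norm (f N l)) \<longlonglongrightarrow> (\<Sum>l\<in>F. 0)"
    by (intro tendsto_sum tendsto_norm_zero lim)
  then have "\<forall>\<^sub>F N in sequentially. (\<Sum>l\<in>F. norm (f N l)) < e / 2"
    using e by (intro order_tendstoD(2)) auto
  then obtain M where M: "\<And>N. N \<ge> M \<Longrightarrow> (\<Sum>l\<in>F. norm (f N l)) < e / 2"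
    by (auto simp: eventually_sequentially)
  have "norm ((\<Sum>\<^sub>\<infinity>l. norm (f N l)) - 0) < e" if "N \<ge> M" for N
  proof -
    have "((\<lambda>l. (if l \<in> F then norm (f N l) else 0) + (g l - (if l \<in> F then g l else 0))) has_sum ((\<Sum>l\<in>F. norm (f N l)) + (s - sum g F))) UNIV"
      unfolding s_def
      by (intro has_sum_add has_sum_subtract has_sum_infsum g has_sum_finite_neutralI[OF F(1)]) auto
    from has_sum_mono[OF has_sum_infsum[OF sf] this]
    have "(\<Sum>\<^sub>\<infinity>l. norm (f N l)) \<le> (\<Sum>l\<in>F. norm (f N l)) + (s - sum g F)"
      by (simp add: bound)
    moreover have "s - sum g F \<le> e / 2" using F(2) unfolding dist_real_def by linarith
    moreover have "0 \<le> (\<Sum>\<^sub>\<infinity>l. norm (f N l))" by (rule infsum_nonneg) simp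
    ultimately show ?thesis using M[OF that] by simp
  qed
  then show "\<exists>M. \<forall>N\<ge>M. norm ((\<Sum>\<^sub>\<infinity>l. norm (f N l)) - 0) < e" by blast
qed

text \<open>On a space of volume one the \<open>L\<^sup>2\<close> norm is at most the supremum, which the sum of the coefficients
  bounds.\<close>

lemma L2_norm_fser_le:
  assumes c: "vrapid c"
  shows "L2_norm_T3 (fser c) \<le> (\<Sum>i\<in>UNIV. \<Sum>\<^sub>\<infinity>l. norm (c l $ i))"
proof -
  define M where "M = (\<Sum>i\<in>UNIV. \<Sum>\<^sub>\<infinity>l. norm (c l $ i))"
  have b: "norm (fser c x) \<le> M" for x
  proof -
    have "norm (fser c x) \<le> (\<Sum>i\<in>UNIV. norm (fser c x $ i))"
      unfolding norm_vec_def by (rule L2_set_le_sum) simp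
    also have "\<dots> \<le> M"
      unfolding M_def fser_nth by (intro sum_mono norm_tser_le rapid_summable vrapidD c)
    finally show ?thesis .
  qed
  have M0: "0 \<le> M" using order_trans[OF norm_ge_zero b[of 0]] .
  have "norm (\<integral>x. (norm (fser c x))\<^sup>2 \<partial>T3) \<le> M\<^sup>2"
    by (rule norm_integral_T3_le) (simp add: power_mono b)
  then have "(\<integral>x. (norm (fser c x))\<^sup>2 \<partial>T3) \<le> M\<^sup>2" by simp
  then have "L2_norm_T3 (fser c) \<le> sqrt (M\<^sup>2)"
    unfolding L2_norm_T3_def by (rule real_sqrt_le_mono)
  then show ?thesis using M0 by (simp add: M_def)
qed

lemma pd_of_real_nth:
  fixes v :: "real^3 \<Rightarrow> real^3"
  assumes "v differentiable (at x)"
  shows "(\<lambda>x. complex_of_real (v x $ i)) differentiable (at x)"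
    and "pd j (\<lambda>x. complex_of_real (v x $ i)) x = complex_of_real (pd j v x $ i)"
proof -
  have bl: "bounded_linear (\<lambda>z::real^3. complex_of_real (z $ i))"
    by (rule bounded_linear_compose[OF bounded_linear_of_real bounded_linear_vec_nth])
  note D = bounded_linear.has_derivative[OF bl has_derivative_pd[OF assms]]
  show "(\<lambda>x. complex_of_real (v x $ i)) differentiable (at x)" using D by (rule differentiableI)
  show "pd j (\<lambda>x. complex_of_real (v x $ i)) x = complex_of_real (pd j v x $ i)"
    using pd_eqI[OF D] by (simp add: pd_def)
qed

lemma smooth_of_real_nth:
  fixes v :: "real^3 \<Rightarrow> real^3"
  assumes "smooth_T3 v"
  shows "smooth_T3 (\<lambda>x. complex_of_real (v x $ i))"
proof -
  have "Ck n v \<Longrightarrow> Ck n (\<lambda>x. complex_of_real (v x $ i))" for n and v :: "real^3 \<Rightarrow> real^3"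
  proof (induction n arbitrary: v)
    case 0
    then show ?case by (auto intro!: continuous_on_of_real continuous_on_component)
  next
    case (Suc n)
    then have d: "v differentiable (at x)" and c: "Ck n (pd j v)" for x j by auto
    have "pd j (\<lambda>x. complex_of_real (v x $ i)) = (\<lambda>x. complex_of_real (pd j v x $ i))" for j
      by (rule ext) (rule pd_of_real_nth(2)[OF d])
    with pd_of_real_nth(1)[OF d] Suc.IH[OF c] show ?case by simp
  qed
  with assms show ?thesis by (simp add: smooth_T3_def periodic_def)
qed

definition vcoef :: "(real^3 \<Rightarrow> real^3) \<Rightarrow> int^3 \<Rightarrow> complex^3" where
  "vcoef v l = (\<chi> i. coef (\<lambda>x. complex_of_real (v x $ i)) l)"

lemma vrapid_vcoef: "smooth_T3 v \<Longrightarrow> vrapid (vcoef v)"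
  by (simp add: vrapid_def vcoef_def rapid_coef smooth_of_real_nth)

lemma of_real_nth_tser: "smooth_T3 v \<Longrightarrow> (\<lambda>x. complex_of_real (v x $ i)) = tser (\<lambda>l. vcoef v l $ i)"
  using fourier_inversion[OF smooth_of_real_nth, of v i] by (simp add: vcoef_def)

lemma complexify_fser: "smooth_T3 v \<Longrightarrow> complexify v = fser (vcoef v)"
  by (rule ext) (simp add: vec_eq_iff complexify_def fser_nth fun_cong[OF of_real_nth_tser])

lemma vcoef_cnj: "vcoef v (- l) $ i = cnj (vcoef v l $ i)"
  unfolding vcoef_def vec_lambda_beta coef_def
  by (subst Bochner_Integration.integral_cnj[symmetric]) (simp add: efun_minus)

text \<open>The coefficient of the divergence at \<open>l\<close> is \<open>2 \<pi> i\<close> times this product.\<close>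

lemma cdot_vcoef:
  assumes v: "smooth_T3 v" and div: "\<And>x. divergence v x = 0"
  shows "cdot (lat l) (vcoef v l) = 0"
proof -
  let ?f = "\<lambda>j x. complex_of_real (v x $ j)"
  have sm: "smooth_T3 (?f j)" for j by (rule smooth_of_real_nth[OF v])
  have pt: "(\<Sum>j\<in>UNIV. pd j (?f j) x * efun (- l) x) = complex_of_real (divergence v x) * efun (- l) x" for x
    by (simp add: pd_of_real_nth(2)[OF smooth_differentiable[OF v]] divergence_def sum_distrib_right)
  have "(\<Sum>j\<in>UNIV. coef (pd j (?f j)) l) = (\<integral>x. (\<Sum>j\<in>UNIV. pd j (?f j) x * efun (- l) x) \<partial>T3)"
    unfolding coef_def
    by (rule Bochner_Integration.integral_sum[symmetric])
       (intro integrable_T3_continuous continuous_on_mult continuous_efun smooth_continuous smooth_pd sm)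
  then have "(\<Sum>j\<in>UNIV. coef (pd j (?f j)) l) = 0" by (simp add: pt div)
  moreover have "coef (pd j (?f j)) l = 2 * complex_of_real pi * \<i> * (complex_of_real (lat l $ j) * vcoef v l $ j)" for j
    unfolding coef_pd_smooth[OF sm] vcoef_def by simp
  ultimately have "2 * complex_of_real pi * \<i> * cdot (lat l) (vcoef v l) = 0"
    by (simp only: cdot_def sum_distrib_left)
  then show ?thesis by simp
qed

lemma complexify_laplacian:
  assumes v: "smooth_T3 v"
  shows "complexify (\<lambda>x. s *\<^sub>R laplacian v x) = fser (\<lambda>l. complex_of_real (- (4 * pi\<^sup>2 * s * (norm (lat l))\<^sup>2)) *s vcoef v l)"
    and "vrapid (\<lambda>l. complex_of_real (- (4 * pi\<^sup>2 * s * (norm (lat l))\<^sup>2)) *s vcoef v l)"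
proof -
  have r: "rapid (\<lambda>l. vcoef v l $ i)" for i by (rule vrapidD[OF vrapid_vcoef[OF v]])
  let ?d = "\<lambda>j l. 2 * complex_of_real pi * \<i> * of_int (l $ j)"
  have rd: "rapid (\<lambda>l. ?d j l * (?d j l * vcoef v l $ i))" for i j
    by (intro rapid_deriv r)
  have coefs: "(\<Sum>j\<in>UNIV. complex_of_real s * (?d j l * (?d j l * vcoef v l $ i))) = complex_of_real (- (4 * pi\<^sup>2 * s * (norm (lat l))\<^sup>2)) * vcoef v l $ i" for l i
  proof -
    have n: "(norm (lat l))\<^sup>2 = (\<Sum>j\<in>UNIV. (real_of_int (l $ j))\<^sup>2)"
      using weight_eq[of l] by simp
    have "complex_of_real s * (?d j l * (?d j l * vcoef v l $ i)) = complex_of_real (- (4 * pi\<^sup>2 * s) * (real_of_int (l $ j))\<^sup>2) * vcoef v l $ i" for j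
      by (simp add: power2_eq_square algebra_simps)
    then show ?thesis
      unfolding n by (simp only: sum_distrib_right[symmetric] of_real_sum[symmetric] sum_distrib_left[symmetric]) simp
  qed
  show "complexify (\<lambda>x. s *\<^sub>R laplacian v x) = fser (\<lambda>l. complex_of_real (- (4 * pi\<^sup>2 * s * (norm (lat l))\<^sup>2)) *s vcoef v l)"
  proof (rule ext, unfold vec_eq_iff, intro allI)
    fix x i
    have "complex_of_real (pd j (pd j v) x $ i) = tser (\<lambda>l. ?d j l * (?d j l * vcoef v l $ i)) x" for j
    proof -
      have "(\<lambda>x. complex_of_real (pd j v x $ i)) = pd j (\<lambda>x. complex_of_real (v x $ i))"
        by (rule ext) (rule pd_of_real_nth(2)[OF smooth_differentiable[OF v], symmetric])
      also have "\<dots> = tser (\<lambda>l. ?d j l * vcoef v l $ i)"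
        by (simp only: of_real_nth_tser[OF v] pd_tser r)
      finally have eq: "pd j (\<lambda>x. complex_of_real (pd j v x $ i)) = tser (\<lambda>l. ?d j l * (?d j l * vcoef v l $ i))"
        by (simp only: pd_tser rapid_deriv r)
      have "pd j (\<lambda>x. complex_of_real (pd j v x $ i)) x = complex_of_real (pd j (pd j v) x $ i)"
        by (rule pd_of_real_nth(2)) (intro smooth_differentiable smooth_pd v)
      then show ?thesis unfolding eq by (rule sym)
    qed
    then have "complexify (\<lambda>x. s *\<^sub>R laplacian v x) x $ i = (\<Sum>j\<in>UNIV. tser (\<lambda>l. complex_of_real s * (?d j l * (?d j l * vcoef v l $ i))) x)"
      by (simp add: complexify_def laplacian_def sum_distrib_left tser_cmult del: of_real_mult add: of_real_mult)
    also have "\<dots> = tser (\<lambda>l. \<Sum>j\<in>UNIV. complex_of_real s * (?d j l * (?d j l * vcoef v l $ i))) x"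
      by (rule tser_sum[symmetric]) (intro rapid_cmult rd)
    finally show "complexify (\<lambda>x. s *\<^sub>R laplacian v x) x $ i = fser (\<lambda>l. complex_of_real (- (4 * pi\<^sup>2 * s * (norm (lat l))\<^sup>2)) *s vcoef v l) x $ i"
      by (simp only: coefs fser_nth vector_smult_component)
  qed
  show "vrapid (\<lambda>l. complex_of_real (- (4 * pi\<^sup>2 * s * (norm (lat l))\<^sup>2)) *s vcoef v l)"
    unfolding vrapid_def vector_smult_component coefs[symmetric]
    by (intro allI rapid_sum rapid_cmult rd)
qed

theorem theorem5p1:
  fixes \<nu> \<gamma> :: real
    and Zp Zm :: "(int^3) set"
    and a :: "int^3 \<Rightarrow> nat \<Rightarrow> real^3"
    and v :: "real^3 \<Rightarrow> real^3"
  assumes "\<nu> > 0" and "\<gamma> > 0"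
    and "half_partition Zp Zm" and "frame_family Zp a"
    and "smooth_T3 v" and "\<And>x. divergence v x = 0"
  shows "(\<forall>N\<ge>1. S_op \<nu> a (thetaN \<gamma> N) (complexify v) \<in> L2_T3_real) \<and>
         complexify (\<lambda>x. (3 * \<nu> / 5) *\<^sub>R laplacian v x) \<in> L2_T3_real \<and>
         (\<lambda>N. L2_norm_T3 (\<lambda>x. S_op \<nu> a (thetaN \<gamma> N) (complexify v) x
                - complexify (\<lambda>x. (3 * \<nu> / 5) *\<^sub>R laplacian v x) x)) \<longlonglongrightarrow> 0"
proof (intro conjI allI impI)
  define c where "c = vcoef v"
  have rc: "vrapid c" unfolding c_def by (rule vrapid_vcoef[OF assms(5)])
  have vc: "complexify v = fser c" unfolding c_def by (rule complexify_fser[OF assms(5)])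
  have dot: "cdot (lat l) (c l) = 0" for l unfolding c_def by (rule cdot_vcoef[OF assms(5,6)])
  have cnj: "c (- l) $ i = cnj (c l $ i)" for l i unfolding c_def by (rule vcoef_cnj)
  define b where "b l = complex_of_real (- (4 * pi\<^sup>2 * (3 * \<nu> / 5) * (norm (lat l))\<^sup>2)) *s c l" for l
  have lb: "complexify (\<lambda>x. (3 * \<nu> / 5) *\<^sub>R laplacian v x) = fser b" and rb: "vrapid b"
    using complexify_laplacian[OF assms(5), of "3 * \<nu> / 5"] unfolding b_def[abs_def] c_def by blast+
  note S = S_op_fser[OF assms(3,4) _ assms(1) rc, where \<gamma> = \<gamma>]
  show "S_op \<nu> a (thetaN \<gamma> N) (complexify v) \<in> L2_T3_real" if "N \<ge> 1" for N
    unfolding vc S(1)[OF that] by (rule fser_real[OF S(2)[OF that]]) (rule S_symbol_cnj, rule cnj)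
  show "complexify (\<lambda>x. (3 * \<nu> / 5) *\<^sub>R laplacian v x) \<in> L2_T3_real"
    unfolding lb by (rule fser_real[OF rb]) (simp add: b_def cnj lat_minus)
  define d where "d N l = S_symbol \<nu> \<gamma> (Suc N) l (c l) - b l" for N l
  have rd: "vrapid (d N)" for N
    using S(2)[of "Suc N"] rb unfolding vrapid_def d_def vector_minus_component by (auto intro: rapid_diff)
  have fd: "(\<lambda>x. S_op \<nu> a (thetaN \<gamma> (Suc N)) (complexify v) x - complexify (\<lambda>x. (3 * \<nu> / 5) *\<^sub>R laplacian v x) x) = fser (d N)" for N
  proof (rule ext, unfold vec_eq_iff, intro allI)
    fix x i
    show "(S_op \<nu> a (thetaN \<gamma> (Suc N)) (complexify v) x - complexify (\<lambda>x. (3 * \<nu> / 5) *\<^sub>R laplacian v x) x) $ i = fser (d N) x $ i"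
      unfolding vc lb S(1)[of "Suc N", simplified] vector_minus_component fser_nth d_def
      by (rule tser_diff[symmetric]) (intro vrapidD S(2) rb, simp, intro vrapidD rb)
  qed
  have "(\<lambda>N. \<Sum>\<^sub>\<infinity>l. norm (d N l $ i)) \<longlonglongrightarrow> 0" for i
  proof (rule infsum_norm_tendsto_0)
    \<comment> \<open>\<open>72\<close> from the bound on the symbol and \<open>12/5 \<le> 3\<close> from the Laplacian\<close>
    define g where "g l = 75 * pi\<^sup>2 * \<nu> * (\<Sum>j\<in>UNIV. (1 + (norm (lat l))\<^sup>2) ^ 1 * norm (c l $ j))" for l
    show "g summable_on UNIV"
      unfolding g_def sum_3 using rc unfolding vrapid_def rapid_def
      by (intro summable_on_cmult_right summable_on_add) blast+
    show "norm (d N l $ i) \<le> g l" for N l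
    proof -
      define s where "s = (\<Sum>j\<in>UNIV. norm (c l $ j))"
      have cs: "norm (c l $ i) \<le> s" unfolding s_def by (rule member_le_sum) auto
      have s0: "0 \<le> s" unfolding s_def by (rule sum_nonneg) simp
      have "norm (d N l $ i) \<le> norm (S_symbol \<nu> \<gamma> (Suc N) l (c l) $ i) + norm (b l $ i)"
        unfolding d_def vector_minus_component by (rule norm_triangle_ineq4)
      also have "\<dots> \<le> 72 * pi\<^sup>2 * \<nu> * (norm (lat l))\<^sup>2 * s + 3 * pi\<^sup>2 * \<nu> * (norm (lat l))\<^sup>2 * s"
      proof (rule add_mono)
        show "norm (S_symbol \<nu> \<gamma> (Suc N) l (c l) $ i) \<le> 72 * pi\<^sup>2 * \<nu> * (norm (lat l))\<^sup>2 * s"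
          unfolding s_def by (rule S_symbol_bound[OF assms(1)])
        have "norm (b l $ i) = \<bar>4 * pi\<^sup>2 * (3 * \<nu> / 5) * (norm (lat l))\<^sup>2\<bar> * norm (c l $ i)"
          unfolding b_def vector_smult_component norm_mult norm_of_real abs_minus_cancel ..
        also have "\<dots> = 12 / 5 * (pi\<^sup>2 * \<nu> * (norm (lat l))\<^sup>2 * norm (c l $ i))"
          using assms(1) by (simp add: abs_mult)
        also have "\<dots> \<le> 3 * (pi\<^sup>2 * \<nu> * (norm (lat l))\<^sup>2 * s)"
          using assms(1) cs by (intro mult_mono mult_left_mono) auto
        finally show "norm (b l $ i) \<le> 3 * pi\<^sup>2 * \<nu> * (norm (lat l))\<^sup>2 * s" by (simp add: mult.assoc)
      qed
      also have "\<dots> = 75 * pi\<^sup>2 * \<nu> * ((norm (lat l))\<^sup>2 * s)" by (simp add: algebra_simps)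
      also have "\<dots> \<le> 75 * pi\<^sup>2 * \<nu> * ((1 + (norm (lat l))\<^sup>2) * s)"
        using assms(1) s0 by (intro mult_left_mono mult_right_mono) auto
      also have "\<dots> = g l" by (simp only: g_def s_def sum_distrib_left power_one_right)
      finally show ?thesis .
    qed
    show "(\<lambda>N. d N l $ i) \<longlonglongrightarrow> 0" for l
    proof -
      have "complex_of_real (- (12 / 5 * pi\<^sup>2 * \<nu> * (norm (lat l))\<^sup>2)) * c l $ i = b l $ i"
        by (simp add: b_def)
      with S_symbol_tendsto[OF assms(2) dot, of \<nu> l i] show ?thesis
        unfolding d_def vector_minus_component by (simp only: LIM_zero)
    qed
  qed
  then have "(\<lambda>N. \<Sum>i\<in>UNIV. \<Sum>\<^sub>\<infinity>l. norm (d N l $ i)) \<longlonglongrightarrow> (\<Sum>i\<in>(UNIV :: 3 set). 0)"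
    by (intro tendsto_sum)
  then have lim: "(\<lambda>N. \<Sum>i\<in>UNIV. \<Sum>\<^sub>\<infinity>l. norm (d N l $ i)) \<longlonglongrightarrow> 0" by simp
  have "(\<lambda>N. L2_norm_T3 (fser (d N))) \<longlonglongrightarrow> 0"
  proof (rule Lim_null_comparison[OF always_eventually lim], rule allI)
    fix N
    have "0 \<le> L2_norm_T3 (fser (d N))" by (simp add: L2_norm_T3_def)
    with L2_norm_fser_le[OF rd] show "norm (L2_norm_T3 (fser (d N))) \<le> (\<Sum>i\<in>UNIV. \<Sum>\<^sub>\<infinity>l. norm (d N l $ i))" by simp
  qed
  then have "(\<lambda>N. L2_norm_T3 (\<lambda>x. S_op \<nu> a (thetaN \<gamma> (Suc N)) (complexify v) x - complexify (\<lambda>x. (3 * \<nu> / 5) *\<^sub>R laplacian v x) x)) \<longlonglongrightarrow> 0"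
    by (simp only: fd)
  then show "(\<lambda>N. L2_norm_T3 (\<lambda>x. S_op \<nu> a (thetaN \<gamma> N) (complexify v) x - complexify (\<lambda>x. (3 * \<nu> / 5) *\<^sub>R laplacian v x) x)) \<longlonglongrightarrow> 0"
    by (rule filterlim_sequentially_Suc[THEN iffD1])
qed

end
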